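(* Let $\mathcal{L}_0$ be the closure in $L^2(\mathcal{H}_3)$ of the sub-Laplacian $\mathcal{L}=-(X^2+Y^2)$ with domain $\mathcal{S}(\mathcal{H}_3)$ on the three-dimensional Heisenberg group $\mathcal{H}_3$. Then the spectrum and the continuous spectrum of $\mathcal{L}_0$ satisfy $$\Sigma(\mathcal{L}_0)=\Sigma_c(\mathcal{L}_0)=[0,\infty).$$
   Context: $\mathcal{H}_3=\mathbb{C}\times\mathbb{R}$ is the three-dimensional Heisenberg group, with coordinates $(y_1,y_2,\tau)\in\mathbb{R}^3$ (where $z=y_1+iy_2$) and Haar measure equal to Lebesgue measure on $\mathbb{R}^3$; $L^2(\mathcal{H}_3)$ is the complex $L^2$ space and $\mathcal{S}(\mathcal{H}_3)$ the Schwartz space on $\mathbb{R}^3$. The left-invariant vector fields are $X=\partial_{y_1}-2y_2\partial_\tau$ and $Y=\partial_{y_2}+2y_1\partial_\tau$. The sub-Laplacian $\mathcal{L}=-(X^2+Y^2)$ is regarded as an unbounded operator on $L^2(\mathcal{H}_3)$ with dense domain $\mathcal{S}(\mathcal{H}_3)$; it is essentially self-adjoint, and its closure $\mathcal{L}_0$ is its unique self-adjoint extension. For a closed densely defined linear operator $T$ on a complex Banach space $B$ with domain $\mathcal{D}(T)$: the resolvent set is $\rho(T)=\{\lambda\in\mathbb{C}: T-\lambda I:\mathcal{D}(T)\to B \text{ is bijective}\}$; the spectrum is $\Sigma(T)=\mathbb{C}\setminus\rho(T)$; the continuous spectrum $\Sigma_c(T)$ is the set of $\lambda\in\mathbb{C}$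 such that the range of $T-\lambda I$ is dense in $B$ and $(T-\lambda I)^{-1}$ exists (i.e. $T-\lambda I$ is injective) but is unbounded. *)

theory Defs
  imports "HOL-Analysis.Analysis"
begin

section \<open>Complex Banach spaces\<close>

class complex_banach = banach +
  fixes scaleC :: "complex \<Rightarrow> 'a \<Rightarrow> 'a" (infixr "*\<^sub>C" 75)
  assumes scaleC_add_right: "c *\<^sub>C (x + y) = c *\<^sub>C x + c *\<^sub>C y"
    and scaleC_add_left: "(c + d) *\<^sub>C x = c *\<^sub>C x + d *\<^sub>C x"
    and scaleC_scaleC: "c *\<^sub>C d *\<^sub>C x = (c * d) *\<^sub>C x"
    and scaleR_scaleC: "r *\<^sub>R x = complex_of_real r *\<^sub>C x"
    and norm_scaleC: "norm (c *\<^sub>C x) = cmod c * norm x"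


section \<open>Unbounded operators and their spectra\<close>

text \<open>An unbounded operator is given by its graph, a single-valued linear relation; its domain
  is the \<^const>\<open>Domain\<close> of the graph. The closure of an operator is the operator whose graph is the
  topological closure of the graph in the product space.\<close>

type_synonym 'a unbounded_op = "('a \<times> 'a) set"

definition op_apply :: "'a unbounded_op \<Rightarrow> 'a \<Rightarrow> 'a" where
  "op_apply T u = (THE v. (u, v) \<in> T)"

definition op_shift :: "'a::complex_banach unbounded_op \<Rightarrow> complex \<Rightarrow> 'a \<Rightarrow> 'a" where
  "op_shift T l u = op_apply T u - l *\<^sub>C u"

definition resolvent_set :: "'a::complex_banach unbounded_op \<Rightarrow> complex set" where
  "resolvent_set T = {l. bij_betw (op_shift T l) (Domain T) UNIV}"

definition op_spectrum :: "'a::complex_banach unbounded_op \<Rightarrow> complex set" where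
  "op_spectrum T = - resolvent_set T"

definition op_continuous_spectrum :: "'a::complex_banach unbounded_op \<Rightarrow> complex set" where
  "op_continuous_spectrum T =
    {l. closure (op_shift T l ` Domain T) = UNIV \<and>
        inj_on (op_shift T l) (Domain T) \<and>
        \<not> (\<exists>K. \<forall>w \<in> op_shift T l ` Domain T.
              norm (inv_into (Domain T) (op_shift T l) w) \<le> K * norm w)}"


section \<open>The complex $L^2$ space of Lebesgue measure\<close>

definition square_integrable :: "('a::euclidean_space \<Rightarrow> complex) \<Rightarrow> bool" where
  "square_integrable f \<longleftrightarrow>
     f \<in> borel_measurable lborel \<and> integrable lborel (\<lambda>x. (cmod (f x))\<^sup>2)"

definition L2_rel :: "('a::euclidean_space \<Rightarrow> complex) \<Rightarrow> ('a \<Rightarrow> complex) \<Rightarrow> bool" where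
  "L2_rel f g \<longleftrightarrow> square_integrable f \<and> square_integrable g \<and> (AE x in lborel. f x = g x)"

lemma square_integrable_zero [simp]: "square_integrable (\<lambda>x. 0)"
  by (simp add: square_integrable_def)

lemma square_integrable_scale:
  assumes "square_integrable f" shows "square_integrable (\<lambda>x. c * f x)"
  using assms by (auto simp: square_integrable_def norm_mult power_mult_distrib)

lemma square_integrable_add:
  assumes "square_integrable f" "square_integrable g"
  shows "square_integrable (\<lambda>x. f x + g x)"
proof -
  have m[measurable]: "f \<in> borel_measurable lborel" "g \<in> borel_measurable lborel"
    using assms by (auto simp: square_integrable_def)
  have i: "integrable lborel (\<lambda>x. 2 * (cmod (f x))\<^sup>2 + 2 * (cmod (g x))\<^sup>2)"
    using assms by (auto simp: square_integrable_def)
  have le: "(cmod (f x + g x))\<^sup>2 \<le> 2 * (cmod (f x))\<^sup>2 + 2 * (cmod (g x))\<^sup>2" for x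
  proof -
    have "(cmod (f x + g x))\<^sup>2 \<le> (cmod (f x) + cmod (g x))\<^sup>2"
      by (intro power_mono norm_triangle_ineq) auto
    also have "\<dots> \<le> 2 * (cmod (f x))\<^sup>2 + 2 * (cmod (g x))\<^sup>2"
      using sum_squares_bound[of "cmod (f x)" "cmod (g x)"] by (simp add: power2_sum)
    finally show ?thesis .
  qed
  have "integrable lborel (\<lambda>x. (cmod (f x + g x))\<^sup>2)"
    by (rule Bochner_Integration.integrable_bound[OF i]) (auto intro!: AE_I2 order_trans[OF le])
  then show ?thesis by (auto simp: square_integrable_def)
qed

lemma square_integrable_uminus:
  assumes "square_integrable f" shows "square_integrable (\<lambda>x. - f x)"
  using square_integrable_scale[OF assms, of "-1"] by simp

lemma square_integrable_diff:
  assumes "square_integrable f" "square_integrable g"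
  shows "square_integrable (\<lambda>x. f x - g x)"
  using square_integrable_add[OF assms(1) square_integrable_uminus[OF assms(2)]] by simp

quotient_type (overloaded) 'a L2 = "'a::euclidean_space \<Rightarrow> complex" / partial: L2_rel
  morphisms rep_L2 L2_class
proof (rule part_equivpI)
  show "\<exists>f :: 'a \<Rightarrow> complex. L2_rel f f"
    by (rule exI[of _ "\<lambda>x. 0"]) (simp add: L2_rel_def)
  show "symp (L2_rel :: ('a \<Rightarrow> complex) \<Rightarrow> _)"
    by (rule sympI) (auto simp: L2_rel_def elim: AE_mp)
  show "transp (L2_rel :: ('a \<Rightarrow> complex) \<Rightarrow> _)"
  proof (rule transpI)
    fix f g h :: "'a \<Rightarrow> complex"
    assume a: "L2_rel f g" "L2_rel g h"
    then have "AE x in lborel. f x = g x" "AE x in lborel. g x = h x" by (auto simp: L2_rel_def)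
    then have "AE x in lborel. f x = h x" by eventually_elim simp
    with a show "L2_rel f h" by (auto simp: L2_rel_def)
  qed
qed

definition L2_seminorm :: "('a::euclidean_space \<Rightarrow> complex) \<Rightarrow> real" where
  "L2_seminorm f = sqrt (LINT x|lborel. (cmod (f x))\<^sup>2)"

lemma L2_seminorm_cong_AE:
  assumes "L2_rel f g" shows "L2_seminorm f = L2_seminorm g"
proof -
  have [measurable]: "f \<in> borel_measurable lborel" "g \<in> borel_measurable lborel"
    using assms by (auto simp: L2_rel_def square_integrable_def)
  have "AE x in lborel. f x = g x" using assms by (simp add: L2_rel_def)
  then have "AE x in lborel. (cmod (f x))\<^sup>2 = (cmod (g x))\<^sup>2" by eventually_elim simp
  then show ?thesis unfolding L2_seminorm_def
    by (intro arg_cong[of _ _ sqrt] integral_cong_AE) auto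
qed

lemma L2_seminorm_nonneg: "0 \<le> L2_seminorm f"
  by (simp add: L2_seminorm_def)

lemma L2_seminorm_sq: "(L2_seminorm f)\<^sup>2 = (LINT x|lborel. (cmod (f x))\<^sup>2)"
  by (simp add: L2_seminorm_def)

lemma L2_seminorm_nn_integral:
  assumes "square_integrable f"
  shows "(\<integral>\<^sup>+x. ennreal ((cmod (f x))\<^sup>2) \<partial>lborel) = ennreal ((L2_seminorm f)\<^sup>2)"
  unfolding L2_seminorm_sq
  by (rule nn_integral_eq_integral) (use assms in \<open>auto simp: square_integrable_def\<close>)

lemma L2_seminorm_scale: "L2_seminorm (\<lambda>x. c * f x) = cmod c * L2_seminorm f"
  by (simp add: L2_seminorm_def norm_mult power_mult_distrib real_sqrt_mult)

lemma L2_seminorm_zero_iff: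
  assumes "square_integrable f"
  shows "L2_seminorm f = 0 \<longleftrightarrow> (AE x in lborel. f x = 0)"
  using integral_nonneg_eq_0_iff_AE[of lborel "\<lambda>x. (cmod (f x))\<^sup>2"] assms
  by (simp add: L2_seminorm_def square_integrable_def)

lemma L2_Cauchy_Schwarz:
  assumes "square_integrable f" "square_integrable g"
  shows "integrable lborel (\<lambda>x. cmod (f x) * cmod (g x))"
    and "(LINT x|lborel. cmod (f x) * cmod (g x)) \<le> L2_seminorm f * L2_seminorm g"
proof -
  have [measurable]: "f \<in> borel_measurable lborel" "g \<in> borel_measurable lborel"
    using assms by (auto simp: square_integrable_def)
  have i: "integrable lborel (\<lambda>x. (cmod (f x))\<^sup>2 + (cmod (g x))\<^sup>2)"
    using assms by (auto simp: square_integrable_def)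
  show I: "integrable lborel (\<lambda>x. cmod (f x) * cmod (g x))"
  proof (rule Bochner_Integration.integrable_bound[OF i], measurable, rule AE_I2)
    fix x
    have "0 \<le> cmod (f x) * cmod (g x)" by simp
    then have "cmod (f x) * cmod (g x) \<le> (cmod (f x))\<^sup>2 + (cmod (g x))\<^sup>2"
      using sum_squares_bound[of "cmod (f x)" "cmod (g x)"] by linarith
    then show "norm (cmod (f x) * cmod (g x)) \<le> norm ((cmod (f x))\<^sup>2 + (cmod (g x))\<^sup>2)"
      by simp
  qed
  have "(\<integral>\<^sup>+x. ennreal (cmod (f x)) * ennreal (cmod (g x)) \<partial>lborel)\<^sup>2
      \<le> (\<integral>\<^sup>+x. (ennreal (cmod (f x)))\<^sup>2 \<partial>lborel) * (\<integral>\<^sup>+x. (ennreal (cmod (g x)))\<^sup>2 \<partial>lborel)"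
    by (rule Cauchy_Schwarz_nn_integral) auto
  also have "(\<integral>\<^sup>+x. ennreal (cmod (f x)) * ennreal (cmod (g x)) \<partial>lborel)
      = ennreal (LINT x|lborel. cmod (f x) * cmod (g x))"
    using nn_integral_eq_integral[OF I] by (simp add: ennreal_mult)
  finally have "(ennreal (LINT x|lborel. cmod (f x) * cmod (g x)))\<^sup>2
      \<le> ennreal ((L2_seminorm f * L2_seminorm g)\<^sup>2)"
    using assms by (simp add: ennreal_power L2_seminorm_nn_integral power_mult_distrib ennreal_mult)
  then have "(LINT x|lborel. cmod (f x) * cmod (g x))\<^sup>2 \<le> (L2_seminorm f * L2_seminorm g)\<^sup>2"
    by (simp add: ennreal_power)
  then show "(LINT x|lborel. cmod (f x) * cmod (g x)) \<le> L2_seminorm f * L2_seminorm g"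
    by (rule power2_le_imp_le) (simp add: L2_seminorm_nonneg)
qed

lemma L2_seminorm_triangle:
  assumes "square_integrable f" "square_integrable g"
  shows "L2_seminorm (\<lambda>x. f x + g x) \<le> L2_seminorm f + L2_seminorm g"
proof -
  have i: "integrable lborel (\<lambda>x. (cmod (f x))\<^sup>2)" "integrable lborel (\<lambda>x. (cmod (g x))\<^sup>2)"
    using assms by (auto simp: square_integrable_def)
  note cs = L2_Cauchy_Schwarz[OF assms]
  have "(L2_seminorm (\<lambda>x. f x + g x))\<^sup>2
      \<le> (LINT x|lborel. (cmod (f x))\<^sup>2 + (cmod (g x))\<^sup>2 + 2 * (cmod (f x) * cmod (g x)))"
    unfolding L2_seminorm_sq
  proof (rule integral_mono)
    show "integrable lborel (\<lambda>x. (cmod (f x + g x))\<^sup>2)"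
      using square_integrable_add[OF assms] by (simp add: square_integrable_def)
    show "integrable lborel
        (\<lambda>x. (cmod (f x))\<^sup>2 + (cmod (g x))\<^sup>2 + 2 * (cmod (f x) * cmod (g x)))"
      using i cs(1) by auto
    show "(cmod (f x + g x))\<^sup>2 \<le> (cmod (f x))\<^sup>2 + (cmod (g x))\<^sup>2 + 2 * (cmod (f x) * cmod (g x))"
      for x
      using power_mono[OF norm_triangle_ineq[of "f x" "g x"], of 2] by (simp add: power2_sum)
  qed
  also have "\<dots> = (L2_seminorm f)\<^sup>2 + (L2_seminorm g)\<^sup>2
      + 2 * (LINT x|lborel. cmod (f x) * cmod (g x))"
    using i cs(1) by (simp add: L2_seminorm_sq)
  also have "\<dots> \<le> (L2_seminorm f + L2_seminorm g)\<^sup>2"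
    using cs(2) by (simp add: power2_sum)
  finally show ?thesis
    by (rule power2_le_imp_le) (simp add: L2_seminorm_nonneg)
qed

instantiation L2 :: (euclidean_space) real_normed_vector
begin

lift_definition zero_L2 :: "'a L2" is "\<lambda>x. 0" by (simp add: L2_rel_def)

lift_definition plus_L2 :: "'a L2 \<Rightarrow> 'a L2 \<Rightarrow> 'a L2" is "\<lambda>f g x. f x + g x"
  by (auto simp: L2_rel_def square_integrable_add elim: AE_mp)

lift_definition minus_L2 :: "'a L2 \<Rightarrow> 'a L2 \<Rightarrow> 'a L2" is "\<lambda>f g x. f x - g x"
  by (auto simp: L2_rel_def square_integrable_diff elim: AE_mp)

lift_definition uminus_L2 :: "'a L2 \<Rightarrow> 'a L2" is "\<lambda>f x. - f x"
  by (auto simp: L2_rel_def square_integrable_uminus elim: AE_mp)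

lift_definition scaleR_L2 :: "real \<Rightarrow> 'a L2 \<Rightarrow> 'a L2" is "\<lambda>r f x. complex_of_real r * f x"
  by (auto simp: L2_rel_def square_integrable_scale elim: AE_mp)

lift_definition norm_L2 :: "'a L2 \<Rightarrow> real" is L2_seminorm
  by (rule L2_seminorm_cong_AE)

definition sgn_L2 :: "'a L2 \<Rightarrow> 'a L2" where "sgn_L2 x = inverse (norm x) *\<^sub>R x"

definition dist_L2 :: "'a L2 \<Rightarrow> 'a L2 \<Rightarrow> real" where "dist_L2 x y = norm (x - y)"

definition uniformity_L2 :: "('a L2 \<times> 'a L2) filter" where
  "uniformity_L2 = (INF e\<in>{0 <..}. principal {(x, y). dist x y < e})"

definition open_L2 :: "'a L2 set \<Rightarrow> bool" where
  "open_L2 U = (\<forall>x\<in>U. eventually (\<lambda>(x', y). x' = x \<longrightarrow> y \<in> U) uniformity)"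

instance
proof
  fix u v w :: "'a L2" and a b :: real
  show "u + v + w = u + (v + w)"
    by transfer (auto simp: L2_rel_def algebra_simps intro!: square_integrable_add)
  show "u + v = v + u"
    by transfer (auto simp: L2_rel_def algebra_simps intro!: square_integrable_add)
  show "0 + u = u"
    by transfer (auto simp: L2_rel_def)
  show "- u + u = 0"
    by transfer (auto simp: L2_rel_def)
  show "u - v = u + - v"
    by transfer (auto simp: L2_rel_def intro!: square_integrable_diff)
  show "a *\<^sub>R (u + v) = a *\<^sub>R u + a *\<^sub>R v"
    by transfer (auto simp: L2_rel_def distrib_left distrib_right
        intro!: square_integrable_add square_integrable_scale)
  show "(a + b) *\<^sub>R u = a *\<^sub>R u + b *\<^sub>R u"
    by transfer (auto simp: L2_rel_def distrib_left distrib_right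
        intro!: square_integrable_add square_integrable_scale)
  show "a *\<^sub>R b *\<^sub>R u = (a * b) *\<^sub>R u"
    by transfer (auto simp: L2_rel_def mult.assoc intro!: square_integrable_scale)
  show "1 *\<^sub>R u = u"
    by transfer (auto simp: L2_rel_def)
  show "(norm u = 0) = (u = 0)"
    by transfer (auto simp: L2_rel_def L2_seminorm_zero_iff)
  show "norm (u + v) \<le> norm u + norm v"
    by transfer (auto simp: L2_rel_def L2_seminorm_triangle)
  show "norm (a *\<^sub>R u) = \<bar>a\<bar> * norm u"
    by transfer (simp add: L2_seminorm_scale)
qed (auto simp: sgn_L2_def dist_L2_def uniformity_L2_def open_L2_def)

end

lemma square_integrable_rep_L2: "square_integrable (rep_L2 u)"
  using Quotient_rep_reflp[OF Quotient_L2, of u] by (simp add: L2_rel_def)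

lemma L2_class_rep_L2 [simp]: "L2_class (rep_L2 u) = u"
  by (rule Quotient_abs_rep[OF Quotient_L2])

lemma norm_L2_class: "square_integrable f \<Longrightarrow> norm (L2_class f) = L2_seminorm f"
  by (rule norm_L2.abs_eq) (simp add: L2_rel_def)

lemma norm_diff_L2_class:
  assumes "square_integrable f" "square_integrable g"
  shows "norm (L2_class f - L2_class g) = L2_seminorm (\<lambda>x. f x - g x)"
  using assms by (simp add: minus_L2.abs_eq norm_L2_class square_integrable_diff L2_rel_def)

text \<open>Riesz--Fischer: a sequence with $\|f_{n+1} - f_n\|^2 \le 8^{-n}$ converges almost everywhere, and
  Fatou's lemma identifies the pointwise limit as the limit in the mean.\<close>

lemma L2_fast_Cauchy_AE_convergent:
  fixes f :: "nat \<Rightarrow> 'a::euclidean_space \<Rightarrow> complex"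
  assumes f: "\<And>n. square_integrable (f n)"
    and fast: "\<And>n. (L2_seminorm (\<lambda>x. f (Suc n) x - f n x))\<^sup>2 \<le> (1/8) ^ n"
  shows "AE x in lborel. convergent (\<lambda>n. f n x)"
proof -
  have [measurable]: "f n \<in> borel_measurable lborel" for n
    using f by (auto simp: square_integrable_def)
  define d where "d n x = 4 ^ n * (cmod (f (Suc n) x - f n x))\<^sup>2" for n x
  have d0: "0 \<le> d n x" for n x by (simp add: d_def)
  have [measurable]: "d n \<in> borel_measurable lborel" for n unfolding d_def by measurable
  have nn: "(\<integral>\<^sup>+x. ennreal (d n x) \<partial>lborel) \<le> ennreal ((1/2) ^ n)" for n
  proof -
    have "(\<integral>\<^sup>+x. ennreal (d n x) \<partial>lborel)
        = (\<integral>\<^sup>+x. ennreal (4 ^ n) * ennreal ((cmod (f (Suc n) x - f n x))\<^sup>2) \<partial>lborel)"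
      by (simp add: d_def ennreal_mult)
    also have "\<dots> = ennreal (4 ^ n) * (\<integral>\<^sup>+x. ennreal ((cmod (f (Suc n) x - f n x))\<^sup>2) \<partial>lborel)"
      by (rule nn_integral_cmult) measurable
    also have "\<dots> = ennreal (4 ^ n * (L2_seminorm (\<lambda>x. f (Suc n) x - f n x))\<^sup>2)"
      using f by (simp add: L2_seminorm_nn_integral square_integrable_diff ennreal_mult)
    also have "\<dots> \<le> ennreal (4 ^ n * (1/8) ^ n)"
      by (intro ennreal_leI mult_left_mono fast) auto
    also have "(4::real) ^ n * (1/8) ^ n = (1/2) ^ n"
      by (simp flip: power_mult_distrib)
    finally show ?thesis .
  qed
  have "(\<integral>\<^sup>+x. (\<Sum>n. ennreal (d n x)) \<partial>lborel) = (\<Sum>n. \<integral>\<^sup>+x. ennreal (d n x) \<partial>lborel)"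
    by (rule nn_integral_suminf) measurable
  also have "\<dots> \<le> (\<Sum>n. ennreal ((1/2) ^ n))"
    by (intro suminf_le nn) auto
  also have "\<dots> = ennreal (\<Sum>n. (1/2) ^ n)"
    by (rule suminf_ennreal2) (auto intro!: summable_geometric)
  also have "\<dots> < \<infinity>" by simp
  finally have "AE x in lborel. (\<Sum>n. ennreal (d n x)) \<noteq> \<infinity>"
    by (intro nn_integral_noteq_infinite) auto
  then show ?thesis
  proof eventually_elim
    fix x assume "(\<Sum>n. ennreal (d n x)) \<noteq> \<infinity>"
    then have "summable (\<lambda>n. d n x)"
      using d0 by (intro summable_suminf_not_top) auto
    then have "(\<lambda>n. d n x) \<longlonglongrightarrow> 0" by (rule summable_LIMSEQ_zero)
    then have "eventually (\<lambda>n. d n x < 1) sequentially"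
      by (rule order_tendstoD) simp
    then have ev: "eventually (\<lambda>n. norm (f (Suc n) x - f n x) \<le> (1/2) ^ n) sequentially"
    proof eventually_elim
      fix n assume "d n x < 1"
      moreover have "(2 ^ n * cmod (f (Suc n) x - f n x))\<^sup>2 = d n x"
        by (simp add: d_def power_mult_distrib power2_eq_square[of "2 ^ n"]
            flip: power_mult_distrib[of 2 2])
      ultimately have "(2 ^ n * cmod (f (Suc n) x - f n x))\<^sup>2 \<le> 1\<^sup>2"
        by simp
      then have "2 ^ n * cmod (f (Suc n) x - f n x) \<le> 1"
        by (rule power2_le_imp_le) simp
      then show "norm (f (Suc n) x - f n x) \<le> (1/2) ^ n"
        by (simp add: power_one_over field_simps)
    qed
    have "summable (\<lambda>n. f (Suc n) x - f n x)"
      by (rule summable_comparison_test_ev[OF ev]) (simp add: summable_geometric)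
    then have "convergent (\<lambda>n. \<Sum>i<n. f (Suc i) x - f i x)"
      by (simp add: summable_iff_convergent)
    then have "convergent (\<lambda>n. f n x - f 0 x)"
      by (simp add: sum_lessThan_telescope[of "\<lambda>i. f i x"])
    then have "convergent (\<lambda>n. (f n x - f 0 x) + f 0 x)"
      by (intro convergent_add convergent_const)
    then show "convergent (\<lambda>n. f n x)" by simp
  qed
qed

lemma L2_Fatou:
  fixes f :: "nat \<Rightarrow> 'a::euclidean_space \<Rightarrow> complex"
  assumes f: "\<And>n. square_integrable (f n)"
    and h [measurable]: "h \<in> borel_measurable lborel"
    and lim: "AE x in lborel. (\<lambda>n. f n x) \<longlonglongrightarrow> h x"
    and bd: "eventually (\<lambda>n. L2_seminorm (f n) \<le> e) sequentially"
  shows "square_integrable h" "L2_seminorm h \<le> e"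
proof -
  have [measurable]: "f n \<in> borel_measurable lborel" for n
    using f by (auto simp: square_integrable_def)
  have e0: "0 \<le> e"
    using eventually_happens'[OF sequentially_bot bd] L2_seminorm_nonneg order_trans by blast
  have "AE x in lborel. ennreal ((cmod (h x))\<^sup>2) = liminf (\<lambda>n. ennreal ((cmod (f n x))\<^sup>2))"
    using lim
  proof eventually_elim
    fix x assume "(\<lambda>n. f n x) \<longlonglongrightarrow> h x"
    then have "(\<lambda>n. ennreal ((cmod (f n x))\<^sup>2)) \<longlonglongrightarrow> ennreal ((cmod (h x))\<^sup>2)"
      by (intro tendsto_ennrealI tendsto_intros)
    then show "ennreal ((cmod (h x))\<^sup>2) = liminf (\<lambda>n. ennreal ((cmod (f n x))\<^sup>2))"
      by (intro lim_imp_Liminf[symmetric]) simp_all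
  qed
  then have "(\<integral>\<^sup>+x. ennreal ((cmod (h x))\<^sup>2) \<partial>lborel)
      = (\<integral>\<^sup>+x. liminf (\<lambda>n. ennreal ((cmod (f n x))\<^sup>2)) \<partial>lborel)"
    by (rule nn_integral_cong_AE)
  also have "\<dots> \<le> liminf (\<lambda>n. \<integral>\<^sup>+x. ennreal ((cmod (f n x))\<^sup>2) \<partial>lborel)"
    by (rule nn_integral_liminf) measurable
  also have "\<dots> = liminf (\<lambda>n. ennreal ((L2_seminorm (f n))\<^sup>2))"
    using f by (simp add: L2_seminorm_nn_integral)
  also have "\<dots> \<le> limsup (\<lambda>n. ennreal ((L2_seminorm (f n))\<^sup>2))"
    by (simp add: Liminf_le_Limsup)
  also have "\<dots> \<le> ennreal (e\<^sup>2)"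
    using bd by (intro Limsup_bounded)
      (auto elim!: eventually_mono intro!: ennreal_leI power_mono L2_seminorm_nonneg)
  finally have le: "(\<integral>\<^sup>+x. ennreal ((cmod (h x))\<^sup>2) \<partial>lborel) \<le> ennreal (e\<^sup>2)" .
  have "integrable lborel (\<lambda>x. (cmod (h x))\<^sup>2)"
    using le by (intro integrableI_bounded) (auto intro: le_less_trans)
  then show si: "square_integrable h" by (simp add: square_integrable_def)
  have "(L2_seminorm h)\<^sup>2 \<le> e\<^sup>2"
    using le unfolding L2_seminorm_nn_integral[OF si] by (simp add: e0)
  then show "L2_seminorm h \<le> e" using e0 by (rule power2_le_imp_le)
qed

instance L2 :: (euclidean_space) banach
proof
  fix X :: "nat \<Rightarrow> 'a L2"
  assume X: "Cauchy X"
  obtain r where r: "strict_mono r"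
    and rX: "\<And>n. norm (X (r (Suc n)) - X (r n)) < (1/8) ^ n"
  proof -
    have "\<exists>N. \<forall>m\<ge>N. \<forall>n\<ge>N. norm (X m - X n) < (1/8) ^ k" for k
      using X by (auto simp: Cauchy_iff)
    then obtain N where N: "\<And>k m n. m \<ge> N k \<Longrightarrow> n \<ge> N k \<Longrightarrow> norm (X m - X n) < (1/8) ^ k"
      by metis
    define r where "r = rec_nat (N 0) (\<lambda>n q. max (Suc q) (N (Suc n)))"
    have r0: "r 0 = N 0" and rS: "r (Suc n) = max (Suc (r n)) (N (Suc n))" for n
      by (simp_all add: r_def)
    have "N n \<le> r n" for n by (cases n) (simp_all add: r0 rS)
    moreover have "r n < r (Suc n)" for n by (simp add: rS)
    ultimately have "strict_mono r" "N n \<le> r n" "N n \<le> r (Suc n)" for n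
      by (auto simp: strict_mono_Suc_iff intro: order_trans[OF _ less_imp_le[of "r n" "r (Suc n)"]])
    then show ?thesis using N by (intro that[of r]) blast+
  qed
  define f where "f n = rep_L2 (X (r n))" for n
  have f: "square_integrable (f n)" for n by (simp add: f_def square_integrable_rep_L2)
  have fX: "X (r n) = L2_class (f n)" for n by (simp add: f_def)
  have nf: "norm (X (r m) - X (r n)) = L2_seminorm (\<lambda>x. f m x - f n x)" for m n
    unfolding fX by (rule norm_diff_L2_class[OF f f])
  have [measurable]: "f n \<in> borel_measurable lborel" for n
    using f by (auto simp: square_integrable_def)
  have "(L2_seminorm (\<lambda>x. f (Suc n) x - f n x))\<^sup>2 \<le> (1/8) ^ n" for n
  proof -
    have le: "L2_seminorm (\<lambda>x. f (Suc n) x - f n x) \<le> (1/8) ^ n"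
      using rX[of n] by (simp add: nf)
    also have "(1/8::real) ^ n \<le> 1" by (simp add: power_le_one)
    finally have "L2_seminorm (\<lambda>x. f (Suc n) x - f n x) * L2_seminorm (\<lambda>x. f (Suc n) x - f n x)
        \<le> (1/8) ^ n * 1"
      using le by (intro mult_mono) (auto simp: L2_seminorm_nonneg)
    then show ?thesis by (simp add: power2_eq_square)
  qed
  then have conv: "AE x in lborel. convergent (\<lambda>n. f n x)"
    by (rule L2_fast_Cauchy_AE_convergent[OF f])
  define h where "h x = lim (\<lambda>n. f n x)" for x
  have h [measurable]: "h \<in> borel_measurable lborel"
    unfolding h_def by measurable
  have lim: "AE x in lborel. (\<lambda>n. f n x) \<longlonglongrightarrow> h x"
    using conv by eventually_elim (simp add: h_def convergent_LIMSEQ_iff)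
  have XrC: "Cauchy (X \<circ> r)" by (rule Cauchy_subseq_Cauchy[OF X r])
  have key: "\<exists>N. \<forall>n\<ge>N. square_integrable (\<lambda>x. f n x - h x)
      \<and> L2_seminorm (\<lambda>x. f n x - h x) \<le> e" if "0 < e" for e
  proof -
    obtain N where N: "\<And>m n. m \<ge> N \<Longrightarrow> n \<ge> N \<Longrightarrow> norm (X (r m) - X (r n)) < e"
      using XrC \<open>0 < e\<close> unfolding Cauchy_iff o_def by blast
    have "square_integrable (\<lambda>x. f n x - h x) \<and> L2_seminorm (\<lambda>x. f n x - h x) \<le> e"
      if "n \<ge> N" for n
    proof -
      have a: "AE x in lborel. (\<lambda>m. f n x - f m x) \<longlonglongrightarrow> f n x - h x"
        using lim by eventually_elim (intro tendsto_intros)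
      have b: "eventually (\<lambda>m. L2_seminorm (\<lambda>x. f n x - f m x) \<le> e) sequentially"
        unfolding eventually_sequentially
        using N[OF \<open>n \<ge> N\<close>] by (auto simp: nf intro!: exI[of _ N] less_imp_le)
      have c: "(\<lambda>x. f n x - h x) \<in> borel_measurable lborel" by measurable
      show ?thesis
        using L2_Fatou[OF square_integrable_diff[OF f f] c a b] by simp
    qed
    then show ?thesis by blast
  qed
  have hs: "square_integrable h"
  proof -
    obtain N where "square_integrable (\<lambda>x. f N x - h x)" using key[of 1] by auto
    from square_integrable_diff[OF f[of N] this] show ?thesis by simp
  qed
  have "(\<lambda>n. X (r n)) \<longlonglongrightarrow> L2_class h"
  proof (rule LIMSEQ_I)
    fix e :: real assume "0 < e"
    then obtain N where "\<And>n. n \<ge> N \<Longrightarrow> L2_seminorm (\<lambda>x. f n x - h x) \<le> e / 2"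
      using key[of "e / 2"] by auto
    then show "\<exists>N. \<forall>n\<ge>N. norm (X (r n) - L2_class h) < e"
      using \<open>0 < e\<close> unfolding fX norm_diff_L2_class[OF f hs]
      by (intro exI[of _ N]) (fastforce intro: le_less_trans)
  qed
  then have "X \<longlonglongrightarrow> L2_class h"
    using Cauchy_converges_subseq[OF X r] by (simp add: o_def)
  then show "convergent X" by (auto simp: convergent_def)
qed

instantiation L2 :: (euclidean_space) complex_banach
begin

lift_definition scaleC_L2 :: "complex \<Rightarrow> 'a L2 \<Rightarrow> 'a L2" is "\<lambda>c f x. c * f x"
  by (auto simp: L2_rel_def square_integrable_scale elim: AE_mp)

instance
proof
  fix u v :: "'a L2" and c d :: complex and r :: real
  show "c *\<^sub>C (u + v) = c *\<^sub>C u + c *\<^sub>C v"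
    by transfer (auto simp: L2_rel_def distrib_left distrib_right
        intro!: square_integrable_add square_integrable_scale)
  show "(c + d) *\<^sub>C u = c *\<^sub>C u + d *\<^sub>C u"
    by transfer (auto simp: L2_rel_def distrib_left distrib_right
        intro!: square_integrable_add square_integrable_scale)
  show "c *\<^sub>C d *\<^sub>C u = (c * d) *\<^sub>C u"
    by transfer (auto simp: L2_rel_def mult.assoc intro!: square_integrable_scale)
  show "r *\<^sub>R u = complex_of_real r *\<^sub>C u"
    by transfer (auto simp: L2_rel_def intro!: square_integrable_scale)
  show "norm (c *\<^sub>C u) = cmod c * norm u"
    by transfer (simp add: L2_seminorm_scale)
qed

end


section \<open>Schwartz functions\<close>

primrec iterated_partial ::
  "'a::euclidean_space list \<Rightarrow> ('a \<Rightarrow> 'b::real_normed_vector) \<Rightarrow> 'a \<Rightarrow> 'b" where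
  "iterated_partial [] f = f"
| "iterated_partial (b # bs) f = (\<lambda>p. frechet_derivative (iterated_partial bs f) (at p) b)"

text \<open>All iterated partial derivatives are differentiable everywhere (which amounts to smoothness)
  and decay faster than every power of the norm.\<close>

definition schwartz_space :: "('a::euclidean_space \<Rightarrow> complex) set" where
  "schwartz_space = {f. \<forall>bs. set bs \<subseteq> Basis \<longrightarrow>
     (\<forall>p. iterated_partial bs f differentiable (at p)) \<and>
     (\<forall>k. bounded (range (\<lambda>p. norm p ^ k *\<^sub>R iterated_partial bs f p)))}"


section \<open>The sub-Laplacian on the Heisenberg group\<close>

text \<open>Points are $(y_1, y_2, \tau)$; Haar measure is \<^const>\<open>lborel\<close>.\<close>

type_synonym heisenberg = "real \<times> real \<times> real"

definition heis_X :: "(heisenberg \<Rightarrow> complex) \<Rightarrow> heisenberg \<Rightarrow> complex" where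
  "heis_X f = (\<lambda>(y1, y2, t). frechet_derivative f (at (y1, y2, t)) (1, 0, 0)
     - 2 * complex_of_real y2 * frechet_derivative f (at (y1, y2, t)) (0, 0, 1))"

definition heis_Y :: "(heisenberg \<Rightarrow> complex) \<Rightarrow> heisenberg \<Rightarrow> complex" where
  "heis_Y f = (\<lambda>(y1, y2, t). frechet_derivative f (at (y1, y2, t)) (0, 1, 0)
     + 2 * complex_of_real y1 * frechet_derivative f (at (y1, y2, t)) (0, 0, 1))"

definition sub_laplacian :: "(heisenberg \<Rightarrow> complex) \<Rightarrow> heisenberg \<Rightarrow> complex" where
  "sub_laplacian f = (\<lambda>p. - (heis_X (heis_X f) p + heis_Y (heis_Y f) p))"

definition sub_laplacian_op :: "heisenberg L2 unbounded_op" where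
  "sub_laplacian_op = {(L2_class f, L2_class (sub_laplacian f)) | f. f \<in> schwartz_space}"

definition sub_laplacian_closure :: "heisenberg L2 unbounded_op" where
  "sub_laplacian_closure = closure sub_laplacian_op"

end

theory Submission
  imports Defs
begin

text \<open>
  On the Schwartz space \<open>L = -(X\<^sup>2 + Y\<^sup>2)\<close> is symmetric and nonnegative, so by Hilbert space theory it
  suffices to show that \<open>L + 1\<close> has dense range, that the closure has no eigenvalue \<open>l \<ge> 0\<close>, and that
  every \<open>l \<ge> 0\<close> is an approximate eigenvalue.

  Dense range: if \<open>h\<close> is orthogonal to the range of \<open>L + 1\<close>, the convolution \<open>G\<close> of \<open>h\<close> with a Gaussian that
  is radial in \<open>z\<close> is a bounded classical solution of \<open>X\<^sup>2 G + Y\<^sup>2 G = G\<close>, because the left- and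
  right-invariant sub-Laplacians agree on radial functions. The maximum principle, with a barrier
  growing at infinity, gives \<open>G = 0\<close>; concentrating the Gaussian gives \<open>h = 0\<close>.

  Eigenvalues: an eigenfunction for \<open>l > 0\<close> is orthogonal to all its nontrivial dilates, against the
  strong continuity of dilations; one for \<open>l = 0\<close> is orthogonal to the range of \<open>X\<close> and therefore to
  everything, since the flow of \<open>X\<close> moves functions off to infinity.

  Approximate eigenvalues: a slowly cut-off plane wave
  \<open>exp (i \<eta> t - \<eta> |z|\<^sup>2 - \<delta>\<^sup>2 t\<^sup>2)\<close> is nearly an eigenfunction for \<open>4 \<eta>\<close>.
\<close>


section \<open>Closure properties of the Schwartz space\<close>

text \<open>The obstacle is that a vector orthogonal to a range is merely square integrable, so no
  differential equation can be applied to it pointwise. It is therefore only ever paired with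
  Schwartz functions, and every derivative is taken on the smooth side, as the derivative of a
  pairing along a flow. This creates a mismatch of sides: moving \<open>p\<close> along a
  left-invariant flow in \<open>k (hmult (- p) w)\<close> moves the argument of \<open>k\<close>
  along a right-invariant one, whereas orthogonality to the range speaks of left-invariant fields. A
  kernel radial in z is what reconciles the two. Only the real point -1 is treated by analysis.
  Surjectivity of \<open>T + 1\<close> together with symmetry makes the closure self-adjoint, and
  then a vector orthogonal to the range of \<open>T - l\<close> is an eigenvector for the conjugate
  of l. The value 4 \<eta> comes from a magnetic Laplacian: on functions exp (i \<eta> t) g(z) the
  operator acts on g as the planar Laplacian with field strength 4 \<eta>, whose lowest Landau level
  is 4 \<eta> with ground state exp (- \<eta> |z|^2). As \<eta> runs through the positive reals,
  this level alone sweeps out the open half-line.\<close>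

definition dirderiv :: "('a::euclidean_space \<Rightarrow> 'a) \<Rightarrow> ('a \<Rightarrow> complex) \<Rightarrow> 'a \<Rightarrow> complex" where
  "dirderiv V f = (\<lambda>p. frechet_derivative f (at p) (V p))"

lemma dirderiv_eq:
  assumes "\<And>p. (f has_derivative f' p) (at p)"
  shows "dirderiv V f = (\<lambda>p. f' p (V p))"
  using frechet_derivative_at[OF assms] by (simp add: dirderiv_def)

text \<open>\<open>iterated_partial\<close> applies the head of its list last, so an appended
  direction is differentiated first. This turns closure of the Schwartz space under partial
  derivatives into a mere reindexing of lists.\<close>

lemma iterated_partial_append:
  "iterated_partial (bs @ [b]) f = iterated_partial bs (dirderiv (\<lambda>_. b) f)"
  by (induction bs) (auto simp: dirderiv_def)

definition rapidly_decreasing :: "('a::euclidean_space \<Rightarrow> complex) \<Rightarrow> bool" where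
  "rapidly_decreasing f \<longleftrightarrow> (\<forall>k. \<exists>C. \<forall>x. norm x ^ k * cmod (f x) \<le> C)"

lemma bounded_range_iff_decay:
  "(\<forall>k. bounded (range (\<lambda>p. norm p ^ k *\<^sub>R f p))) \<longleftrightarrow> rapidly_decreasing f"
  by (auto simp: rapidly_decreasing_def bounded_iff abs_mult)

lemma rapidly_decreasing_one_plus:
  assumes "rapidly_decreasing f"
  obtains C where "0 \<le> C" "\<And>x. (1 + norm x) ^ k * cmod (f x) \<le> C"
proof -
  obtain C0 Ck where C: "\<And>x. norm x ^ 0 * cmod (f x) \<le> C0" "\<And>x. norm x ^ k * cmod (f x) \<le> Ck"
    using assms unfolding rapidly_decreasing_def by metis
  have p: "(1 + t) ^ k \<le> 2 ^ k * (1 + t ^ k)" if "0 \<le> t" for t :: real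
  proof (cases "t \<le> 1")
    case True
    then have "(1 + t) ^ k \<le> 2 ^ k" using that by (intro power_mono) auto
    also have "\<dots> \<le> 2 ^ k * (1 + t ^ k)" using that by simp
    finally show ?thesis .
  next
    case False
    then have "(1 + t) ^ k \<le> (2 * t) ^ k" using that by (intro power_mono) auto
    also have "\<dots> \<le> 2 ^ k * (1 + t ^ k)" by (simp add: power_mult_distrib)
    finally show ?thesis .
  qed
  have "(1 + norm x) ^ k * cmod (f x) \<le> 2 ^ k * (C0 + Ck)" for x
  proof -
    have "(1 + norm x) ^ k * cmod (f x) \<le> (2 ^ k * (1 + norm x ^ k)) * cmod (f x)"
      by (intro mult_right_mono p) auto
    also have "\<dots> = 2 ^ k * (norm x ^ 0 * cmod (f x) + norm x ^ k * cmod (f x))"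
      by (simp add: algebra_simps)
    also have "\<dots> \<le> 2 ^ k * (C0 + Ck)" by (intro mult_left_mono add_mono C) auto
    finally show ?thesis .
  qed
  moreover from this[of 0] have "0 \<le> 2 ^ k * (C0 + Ck)"
    by (rule order_trans[rotated]) simp
  ultimately show ?thesis using that by blast
qed

text \<open>Replaces formulas for iterated derivatives: it suffices to exhibit a family containing f
  and stable under first partials, since induction on the list then keeps every iterated partial
  inside it.\<close>

lemma schwartz_coinduct:
  assumes "f \<in> F"
    and "\<And>f p. f \<in> F \<Longrightarrow> f differentiable (at p)"
    and "\<And>f. f \<in> F \<Longrightarrow> rapidly_decreasing f"
    and "\<And>f b. f \<in> F \<Longrightarrow> b \<in> Basis \<Longrightarrow> dirderiv (\<lambda>_. b) f \<in> F"
  shows "f \<in> schwartz_space"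
proof -
  have "iterated_partial bs f \<in> F" if "set bs \<subseteq> Basis" for bs
    using that by (induction bs) (use assms in \<open>auto simp: dirderiv_def\<close>)
  then show ?thesis
    unfolding schwartz_space_def using assms(2,3) bounded_range_iff_decay by blast
qed

lemma schwartz_differentiable: "f \<in> schwartz_space \<Longrightarrow> f differentiable (at p)"
  and schwartz_rapidly_decreasing: "f \<in> schwartz_space \<Longrightarrow> rapidly_decreasing f"
proof -
  assume "f \<in> schwartz_space"
  from this[unfolded schwartz_space_def mem_Collect_eq bounded_range_iff_decay, THEN spec, of "[]"]
  show "f differentiable (at p)" "rapidly_decreasing f" by simp_all
qed

lemma schwartz_has_derivative:
  "f \<in> schwartz_space \<Longrightarrow> (f has_derivative frechet_derivative f (at p)) (at p)"
  using schwartz_differentiable frechet_derivative_works by blast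

lemma schwartz_partial:
  assumes "f \<in> schwartz_space" "b \<in> Basis"
  shows "dirderiv (\<lambda>_. b) f \<in> schwartz_space"
  unfolding schwartz_space_def
proof (intro CollectI allI impI)
  fix bs :: "'a list" assume "set bs \<subseteq> Basis"
  then have "set (bs @ [b]) \<subseteq> Basis" using assms by auto
  then have "(\<forall>p. iterated_partial (bs @ [b]) f differentiable at p) \<and>
         (\<forall>k. bounded (range (\<lambda>p. norm p ^ k *\<^sub>R iterated_partial (bs @ [b]) f p)))"
    using assms(1) unfolding schwartz_space_def by blast
  then show "(\<forall>p. iterated_partial bs (dirderiv (\<lambda>_. b) f) differentiable at p) \<and>
         (\<forall>k. bounded (range (\<lambda>p. norm p ^ k *\<^sub>R iterated_partial bs (dirderiv (\<lambda>_. b) f) p)))"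
    unfolding iterated_partial_append .
qed

lemma schwartz_continuous: "f \<in> schwartz_space \<Longrightarrow> continuous_on UNIV f"
  by (intro differentiable_imp_continuous_on) (simp add: differentiable_on_def schwartz_differentiable)

lemma continuous_on_schwartz_compose:
  "f \<in> schwartz_space \<Longrightarrow> continuous_on S g \<Longrightarrow> continuous_on S (\<lambda>x. f (g x))"
  by (rule continuous_on_compose2[OF schwartz_continuous]) auto

lemma schwartz_measurable: "f \<in> schwartz_space \<Longrightarrow> f \<in> borel_measurable borel"
  by (intro borel_measurable_continuous_onI schwartz_continuous)

lemma rapidly_decreasing_add:
  assumes "rapidly_decreasing f" "rapidly_decreasing g"
  shows "rapidly_decreasing (\<lambda>x. f x + g x)"
  unfolding rapidly_decreasing_def
proof
  fix k
  obtain A B where AB: "\<And>x. norm x ^ k * cmod (f x) \<le> A" "\<And>x. norm x ^ k * cmod (g x) \<le> B"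
    using assms unfolding rapidly_decreasing_def by metis
  have "norm x ^ k * cmod (f x + g x) \<le> A + B" for x
  proof -
    have "norm x ^ k * cmod (f x + g x) \<le> norm x ^ k * (cmod (f x) + cmod (g x))"
      by (intro mult_left_mono norm_triangle_ineq) auto
    then show ?thesis using AB[of x] by (simp add: distrib_left)
  qed
  then show "\<exists>C. \<forall>x. norm x ^ k * cmod (f x + g x) \<le> C" by blast
qed

lemma rapidly_decreasing_mult:
  assumes "rapidly_decreasing f"
  shows "rapidly_decreasing (\<lambda>x. (complex_of_real (x \<bullet> c) + d) * f x)"
  unfolding rapidly_decreasing_def
proof
  fix k
  obtain A B where AB: "\<And>x. norm x ^ k * cmod (f x) \<le> A" "\<And>x. norm x ^ Suc k * cmod (f x) \<le> B"
    using assms unfolding rapidly_decreasing_def by metis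
  have "norm x ^ k * cmod ((complex_of_real (x \<bullet> c) + d) * f x) \<le> norm c * B + cmod d * A" for x
  proof -
    have "cmod (complex_of_real (x \<bullet> c) + d) \<le> norm x * norm c + cmod d"
      by (rule order_trans[OF norm_triangle_ineq]) (simp add: Cauchy_Schwarz_ineq2)
    then have "norm x ^ k * cmod ((complex_of_real (x \<bullet> c) + d) * f x)
        \<le> norm x ^ k * ((norm x * norm c + cmod d) * cmod (f x))"
      by (intro mult_left_mono) (auto simp: norm_mult intro: mult_right_mono)
    also have "\<dots> = norm c * (norm x ^ Suc k * cmod (f x)) + cmod d * (norm x ^ k * cmod (f x))"
      by (simp add: algebra_simps)
    also have "\<dots> \<le> norm c * B + cmod d * A"
      by (intro add_mono mult_left_mono AB) auto
    finally show ?thesis .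
  qed
  then show "\<exists>C. \<forall>x. norm x ^ k * cmod ((complex_of_real (x \<bullet> c) + d) * f x) \<le> C" by blast
qed

lemma schwartz_add:
  assumes "f \<in> schwartz_space" "g \<in> schwartz_space"
  shows "(\<lambda>x. f x + g x) \<in> schwartz_space"
proof -
  define m where "m f g = (\<lambda>x. f x + g x)" for f g :: "'a \<Rightarrow> complex"
  let ?F = "{m f g | f g. f \<in> schwartz_space \<and> g \<in> schwartz_space}"
  have "m f g \<in> schwartz_space"
  proof (rule schwartz_coinduct[of _ ?F])
    show "m f g \<in> ?F" using assms by blast
  next
    fix h :: "'a \<Rightarrow> complex" and b p :: 'a assume "h \<in> ?F"
    then obtain f g where h: "h = m f g" and fg: "f \<in> schwartz_space" "g \<in> schwartz_space" by blast
    note D = has_derivative_add[OF fg[THEN schwartz_has_derivative]]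
    show "h differentiable (at p)" using D by (auto simp: h m_def differentiable_def)
    show "rapidly_decreasing h"
      unfolding h m_def by (intro rapidly_decreasing_add schwartz_rapidly_decreasing fg)
    assume b: "b \<in> Basis"
    have "dirderiv (\<lambda>_. b) h = m (dirderiv (\<lambda>_. b) f) (dirderiv (\<lambda>_. b) g)"
      unfolding h m_def dirderiv_eq[OF D] by (simp add: dirderiv_def)
    then show "dirderiv (\<lambda>_. b) h \<in> ?F" using fg[THEN schwartz_partial] b by blast
  qed
  then show ?thesis by (simp add: m_def)
qed

lemma schwartz_zero: "(\<lambda>x. 0) \<in> schwartz_space"
proof (rule schwartz_coinduct[of _ "{\<lambda>x. 0}"])
  fix f :: "'a \<Rightarrow> complex" and b :: 'a assume "f \<in> {\<lambda>x. 0}"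
  then show "dirderiv (\<lambda>_. b) f \<in> {\<lambda>x. 0}"
    using dirderiv_eq[OF has_derivative_const[of 0], of "\<lambda>_. b"] by auto
qed (auto simp: rapidly_decreasing_def)

lemma schwartz_cmult:
  assumes "f \<in> schwartz_space" shows "(\<lambda>x. d * f x) \<in> schwartz_space"
proof (rule schwartz_coinduct[of _ "(\<lambda>f x. d * f x) ` schwartz_space"])
  fix h :: "'a \<Rightarrow> complex" and b p :: 'a
  assume "h \<in> (\<lambda>f x. d * f x) ` schwartz_space"
  then obtain f where h: "h = (\<lambda>x. d * f x)" and f: "f \<in> schwartz_space" by blast
  note D = has_derivative_mult_right[OF schwartz_has_derivative[OF f], of d]
  show "h differentiable (at p)" using D by (auto simp: h differentiable_def)
  show "rapidly_decreasing h"
    using rapidly_decreasing_mult[OF schwartz_rapidly_decreasing[OF f], of 0 d] by (simp add: h)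
  assume b: "b \<in> Basis"
  have "dirderiv (\<lambda>_. b) h = (\<lambda>x. d * dirderiv (\<lambda>_. b) f x)"
    unfolding h dirderiv_eq[OF D] by (simp add: dirderiv_def)
  then show "dirderiv (\<lambda>_. b) h \<in> (\<lambda>f x. d * f x) ` schwartz_space"
    using schwartz_partial[OF f b] by blast
qed (use assms in blast)

lemma schwartz_affine_mult:
  assumes "f \<in> schwartz_space"
  shows "(\<lambda>x. (complex_of_real (x \<bullet> c) + d) * f x) \<in> schwartz_space"
proof -
  \<comment> \<open>The product rule leaves the form affine times f by a multiple of f itself; the
    extra summand g absorbs that term and makes the family stable.\<close>
  define m where "m f g = (\<lambda>x. (complex_of_real (x \<bullet> c) + d) * f x + g x)" for f g :: "'a \<Rightarrow> complex"
  let ?F = "{m f g | f g. f \<in> schwartz_space \<and> g \<in> schwartz_space}"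
  have "m f (\<lambda>x. 0) \<in> schwartz_space"
  proof (rule schwartz_coinduct[of _ ?F])
    show "m f (\<lambda>x. 0) \<in> ?F" using assms schwartz_zero by blast
  next
    fix h :: "'a \<Rightarrow> complex" and b p :: 'a assume "h \<in> ?F"
    then obtain f g where h: "h = m f g" and fg: "f \<in> schwartz_space" "g \<in> schwartz_space" by blast
    have D: "(h has_derivative (\<lambda>y. ((complex_of_real (x \<bullet> c) + d) * frechet_derivative f (at x) y
        + complex_of_real (y \<bullet> c) * f x) + frechet_derivative g (at x) y)) (at x)" for x
      unfolding h m_def by (rule derivative_eq_intros schwartz_has_derivative fg refl)+ simp
    show "h differentiable (at p)" using D by (auto simp: differentiable_def)
    show "rapidly_decreasing h"
      unfolding h m_def by (intro rapidly_decreasing_add rapidly_decreasing_mult schwartz_rapidly_decreasing fg)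
    assume b: "b \<in> Basis"
    have "dirderiv (\<lambda>_. b) h = m (dirderiv (\<lambda>_. b) f) (\<lambda>x. complex_of_real (b \<bullet> c) * f x + dirderiv (\<lambda>_. b) g x)"
      unfolding dirderiv_eq[OF D] by (auto simp: dirderiv_def m_def)
    moreover have "(\<lambda>x. complex_of_real (b \<bullet> c) * f x + dirderiv (\<lambda>_. b) g x) \<in> schwartz_space"
      by (intro schwartz_add schwartz_cmult fg schwartz_partial b)
    ultimately show "dirderiv (\<lambda>_. b) h \<in> ?F" using schwartz_partial[OF fg(1) b] by blast
  qed
  then show ?thesis by (simp add: m_def)
qed

lemma schwartz_sum: "(\<And>i. i \<in> I \<Longrightarrow> f i \<in> schwartz_space) \<Longrightarrow> (\<lambda>x. \<Sum>i\<in>I. f i x) \<in> schwartz_space"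
  by (induction I rule: infinite_finite_induct) (auto simp: schwartz_zero intro!: schwartz_add)

text \<open>Linearity of the Frechet derivative expands the derivative along V in the basis, giving
  a finite sum of partials with affine coefficients. Invariant fields on the Heisenberg group have
  exactly such coefficients.\<close>

lemma schwartz_dirderiv:
  assumes f: "f \<in> schwartz_space"
    and V: "\<And>b. b \<in> Basis \<Longrightarrow> \<exists>c d. \<forall>x. V x \<bullet> b = x \<bullet> c + d"
  shows "dirderiv V f \<in> schwartz_space"
proof -
  obtain c d where cd: "\<And>b x. b \<in> Basis \<Longrightarrow> V x \<bullet> b = x \<bullet> c b + d b" using V by metis
  have "dirderiv V f = (\<lambda>x. \<Sum>b\<in>Basis. (complex_of_real (x \<bullet> c b) + complex_of_real (d b)) * dirderiv (\<lambda>_. b) f x)"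
  proof
    fix x
    have lin: "linear (frechet_derivative f (at x))"
      using schwartz_differentiable[OF f] by (rule linear_frechet_derivative)
    have "dirderiv V f x = frechet_derivative f (at x) (\<Sum>b\<in>Basis. (V x \<bullet> b) *\<^sub>R b)"
      by (simp add: dirderiv_def euclidean_representation)
    also have "\<dots> = (\<Sum>b\<in>Basis. (V x \<bullet> b) *\<^sub>R frechet_derivative f (at x) b)"
      by (simp add: linear_sum[OF lin] linear_scale[OF lin])
    also have "\<dots> = (\<Sum>b\<in>Basis. (complex_of_real (x \<bullet> c b) + complex_of_real (d b)) * dirderiv (\<lambda>_. b) f x)"
      by (intro sum.cong) (auto simp: cd dirderiv_def scaleR_conv_of_real)
    finally show "dirderiv V f x = \<dots>" .
  qed
  then show ?thesis by (auto intro!: schwartz_sum schwartz_affine_mult schwartz_partial f)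
qed

text \<open>By the chain rule a partial derivative of the composite is the composite of a
  constant-coefficient derivative of f, so the composites form a stable family. Injectivity of B
  enters only through decay, by bounding B from below.\<close>

lemma schwartz_affine_compose:
  fixes f :: "'a::euclidean_space \<Rightarrow> complex"
  assumes f: "f \<in> schwartz_space" and B: "linear B" "inj B"
  shows "(\<lambda>x. f (a + B x)) \<in> schwartz_space"
proof (rule schwartz_coinduct[of _ "{\<lambda>x. f (a + B x) | f. f \<in> schwartz_space}"])
  show "(\<lambda>x. f (a + B x)) \<in> {\<lambda>x. f (a + B x) | f. f \<in> schwartz_space}" using f by blast
next
  have DB: "((\<lambda>x. a + B x) has_derivative B) (at p)" for p
    using has_derivative_add[OF has_derivative_const linear_imp_has_derivative[OF B(1)]] by simp
  note D = has_derivative_compose[OF DB schwartz_has_derivative]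
  {
    fix h p assume "h \<in> {\<lambda>x. f (a + B x) | f. f \<in> schwartz_space}"
    then show "h differentiable (at p)" using D by (auto simp: differentiable_def)
  next
    fix h b assume "h \<in> {\<lambda>x. f (a + B x) | f. f \<in> schwartz_space}"
    then obtain f where h: "h = (\<lambda>x. f (a + B x))" and f: "f \<in> schwartz_space" by blast
    have "dirderiv (\<lambda>_. b) h = (\<lambda>x. dirderiv (\<lambda>_. B b) f (a + B x))"
      unfolding h dirderiv_eq[OF D[OF f]] by (auto simp: dirderiv_def)
    moreover have "dirderiv (\<lambda>_. B b) f \<in> schwartz_space"
      by (rule schwartz_dirderiv[OF f]) (auto intro: exI[of _ 0])
    ultimately show "dirderiv (\<lambda>_. b) h \<in> {\<lambda>x. f (a + B x) | f. f \<in> schwartz_space}" by blast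
  next
    fix h assume "h \<in> {\<lambda>x. f (a + B x) | f. f \<in> schwartz_space}"
    then obtain f where h: "h = (\<lambda>x. f (a + B x))" and f: "f \<in> schwartz_space" by blast
    obtain e where e: "0 < e" "\<And>x. e * norm x \<le> norm (B x)"
      using linear_inj_bounded_below_pos[OF B] by blast
    define K where "K = max 1 (norm a) / e"
    \<comment> \<open>Powers of \<open>norm x\<close> are traded for powers of the norm of the point
      where f is evaluated.\<close>
    have g: "norm x \<le> K * (1 + norm (a + B x))" for x
    proof -
      have "e * norm x \<le> norm (B x)" by (rule e)
      also have "\<dots> \<le> norm a + norm (a + B x)"
        using norm_triangle_ineq4[of "a + B x" a] by simp
      also have "\<dots> \<le> max 1 (norm a) * (1 + norm (a + B x))"
        using mult_right_mono[of 1 "max 1 (norm a)" "norm (a + B x)"] by (simp add: distrib_left)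
      finally show ?thesis using e(1) by (simp add: K_def field_simps)
    qed
    have K0: "0 \<le> K" using e(1) by (simp add: K_def)
    show "rapidly_decreasing h" unfolding rapidly_decreasing_def
    proof
      fix k
      obtain C where C: "\<And>x. (1 + norm x) ^ k * cmod (f x) \<le> C"
        using rapidly_decreasing_one_plus[OF schwartz_rapidly_decreasing[OF f], of k] by blast
      have "norm x ^ k * cmod (h x) \<le> K ^ k * C" for x
      proof -
        have "norm x ^ k * cmod (h x) \<le> (K * (1 + norm (a + B x))) ^ k * cmod (h x)"
          by (intro mult_right_mono power_mono g) auto
        also have "\<dots> = K ^ k * ((1 + norm (a + B x)) ^ k * cmod (f (a + B x)))"
          by (simp add: h power_mult_distrib)
        also have "\<dots> \<le> K ^ k * C" using K0 by (intro mult_left_mono C) auto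
        finally show ?thesis .
      qed
      then show "\<exists>C. \<forall>x. norm x ^ k * cmod (h x) \<le> C" by blast
    qed
  }
qed

text \<open>These are the products of g with complex polynomials, built one affine factor at a time;
  c = 0 gives scalar multiples.\<close>

inductive_set polynomial_span :: "('a::euclidean_space \<Rightarrow> complex) \<Rightarrow> ('a \<Rightarrow> complex) set" for g where
  base: "g \<in> polynomial_span g"
| add: "f \<in> polynomial_span g \<Longrightarrow> f' \<in> polynomial_span g \<Longrightarrow> (\<lambda>x. f x + f' x) \<in> polynomial_span g"
| mult: "f \<in> polynomial_span g \<Longrightarrow> (\<lambda>x. (complex_of_real (x \<bullet> c) + d) * f x) \<in> polynomial_span g"

text \<open>At c = 0 this is the mollifier of the convolution argument; the phase c provides the
  oscillation in t of the approximate eigenfunctions.\<close>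

definition gauss :: "'a::euclidean_space \<Rightarrow> 'a \<Rightarrow> complex" where
  "gauss c x = exp (- complex_of_real (x \<bullet> x) + \<i> * complex_of_real (x \<bullet> c))"

lemma cmod_gauss: "cmod (gauss c x) = exp (- (norm x)\<^sup>2)"
  by (simp add: gauss_def norm_exp_eq_Re power2_norm_eq_inner)

text \<open>The inner products are arranged so that, for a fixed direction y, the factor is
  literally affine in x and matches the rule \<open>polynomial_span.mult\<close>.\<close>

lemma gauss_has_derivative:
  "(gauss c has_derivative (\<lambda>y. (complex_of_real (x \<bullet> (- 2 *\<^sub>R y)) + \<i> * complex_of_real (y \<bullet> c)) * gauss c x)) (at x)"
proof -
  have "((\<lambda>x. - complex_of_real (x \<bullet> x) + \<i> * complex_of_real (x \<bullet> c)) has_derivative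
      (\<lambda>y. complex_of_real (x \<bullet> (- 2 *\<^sub>R y)) + \<i> * complex_of_real (y \<bullet> c))) (at x)"
    by (auto intro!: derivative_eq_intros simp: inner_commute)
  from has_derivative_compose[OF this has_field_derivative_imp_has_derivative[OF DERIV_exp]]
  show ?thesis by (simp add: gauss_def[abs_def] mult.commute)
qed

lemma rapidly_decreasing_gauss: "rapidly_decreasing (gauss c)"
  unfolding rapidly_decreasing_def cmod_gauss
proof
  fix k
  have "norm (x::'a) ^ k * exp (- (norm x)\<^sup>2) \<le> 1 + real (Suc k) ^ Suc k" for x :: 'a
  proof -
    \<comment> \<open>The bound comes from (1 + t^2/n)^n \<le> exp (t^2) with n = k + 1. The shift
      by one keeps n positive at k = 0, and t^(2n) together with 1 dominates t^k.\<close>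
    define t where "t = norm x"
    have t: "0 \<le> t" by (simp add: t_def)
    have "(t\<^sup>2 / real (Suc k)) ^ Suc k \<le> (1 + t\<^sup>2 / real (Suc k)) ^ Suc k"
      by (intro power_mono) auto
    also have "\<dots> \<le> exp (t\<^sup>2)"
      by (rule exp_ge_one_plus_x_over_n_power_n) (use zero_le_power2[of t] in linarith)+
    finally have "(t\<^sup>2) ^ Suc k \<le> exp (t\<^sup>2) * real (Suc k) ^ Suc k"
      by (simp only: power_divide) (simp add: divide_le_eq)
    then have 1: "(t\<^sup>2) ^ Suc k * exp (- t\<^sup>2) \<le> real (Suc k) ^ Suc k"
      by (simp only: exp_minus) (simp add: field_simps)
    have "t ^ k \<le> 1 + (t\<^sup>2) ^ Suc k"
    proof (cases "t \<le> 1")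
      case True
      then have "t ^ k \<le> 1" using t by (simp add: power_le_one)
      moreover have "0 \<le> (t\<^sup>2) ^ Suc k" by (intro zero_le_power zero_le_power2)
      ultimately show ?thesis by linarith
    next
      case False
      then have "t ^ k \<le> t ^ (2 * Suc k)" by (intro power_increasing) auto
      then show ?thesis by (simp only: power_mult)
    qed
    then have "t ^ k * exp (- t\<^sup>2) \<le> (1 + (t\<^sup>2) ^ Suc k) * exp (- t\<^sup>2)"
      by (intro mult_right_mono) auto
    also have "\<dots> \<le> 1 + real (Suc k) ^ Suc k"
      using 1 by (simp only: distrib_right) (simp add: add_mono)
    finally show ?thesis by (simp add: t_def)
  qed
  then show "\<exists>C. \<forall>x::'a. norm x ^ k * exp (- (norm x)\<^sup>2) \<le> C" by blast
qed

lemma gauss_schwartz: "gauss c \<in> schwartz_space"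
proof (rule schwartz_coinduct[of _ "polynomial_span (gauss c)"])
  \<comment> \<open>An explicit derivative is carried through the induction, because the product
    rule needs both its formula and its membership in the span.\<close>
  have main: "(\<exists>f'. (\<forall>x. (f has_derivative f' x) (at x)) \<and> (\<forall>b. (\<lambda>x. f' x b) \<in> polynomial_span (gauss c)))
    \<and> rapidly_decreasing f"
    if "f \<in> polynomial_span (gauss c)" for f
    using that
  proof induction
    case base
    show ?case
    proof (intro conjI exI allI)
      show "(gauss c has_derivative (\<lambda>y. (complex_of_real (x \<bullet> (- 2 *\<^sub>R y)) + \<i> * complex_of_real (y \<bullet> c)) * gauss c x)) (at x)" for x
        by (rule gauss_has_derivative)
    qed (intro polynomial_span.intros rapidly_decreasing_gauss)+
  next
    case (add f g)
    then obtain f' g' where D: "\<forall>x. (f has_derivative f' x) (at x)" "\<forall>b. (\<lambda>x. f' x b) \<in> polynomial_span (gauss c)"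
      "\<forall>x. (g has_derivative g' x) (at x)" "\<forall>b. (\<lambda>x. g' x b) \<in> polynomial_span (gauss c)" by blast
    show ?case
    proof (intro conjI exI allI)
      show "((\<lambda>x. f x + g x) has_derivative (\<lambda>y. f' x y + g' x y)) (at x)" for x
        using D by (intro has_derivative_add) auto
    qed (use D add in \<open>auto intro!: polynomial_span.add rapidly_decreasing_add\<close>)
  next
    case (mult f a d)
    then obtain f' where D: "\<forall>x. (f has_derivative f' x) (at x)" "\<forall>b. (\<lambda>x. f' x b) \<in> polynomial_span (gauss c)" by blast
    show ?case
    proof (intro conjI exI allI)
      \<comment> \<open>The vanishing term \<open>x \<bullet> 0\<close> is kept on purpose: it
        presents the constant factor \<open>y \<bullet> a\<close> as an affine factor with c =
        0.\<close>
      show "((\<lambda>x. (complex_of_real (x \<bullet> a) + d) * f x) has_derivative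
          (\<lambda>y. (complex_of_real (x \<bullet> a) + d) * f' x y + (complex_of_real (x \<bullet> 0) + complex_of_real (y \<bullet> a)) * f x)) (at x)" for x
        by (rule derivative_eq_intros D(1)[rule_format] refl)+ simp
    qed (use D mult in \<open>auto intro!: polynomial_span.add polynomial_span.mult rapidly_decreasing_mult simp del: inner_zero_right\<close>)
  qed
  {
    fix f p assume "f \<in> polynomial_span (gauss c)"
    then show "f differentiable (at p)" "rapidly_decreasing f" using main[of f] by (auto simp: differentiable_def)
  next
    fix f b assume "f \<in> polynomial_span (gauss c)"
    then obtain f' where D: "\<And>x. (f has_derivative f' x) (at x)" "\<forall>b. (\<lambda>x. f' x b) \<in> polynomial_span (gauss c)"
      using main by blast
    show "dirderiv (\<lambda>_. b) f \<in> polynomial_span (gauss c)" using D(2) by (simp add: dirderiv_eq[OF D(1)])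
  }
qed (rule polynomial_span.base)


section \<open>Integrals against rapidly decreasing families\<close>

text \<open>The common majorant for all dominated convergence arguments; two powers per dimension
  suffice for integrability over the whole space.\<close>

definition decay :: "'a::euclidean_space \<Rightarrow> real" where
  "decay x = 1 / (1 + norm x) ^ (2 * DIM('a))"

lemma decay_nonneg: "0 \<le> decay x"
  by (simp add: decay_def)

lemma decay_le_one: "decay x \<le> 1"
proof -
  have "1 \<le> (1 + norm x) ^ (2 * DIM('a))" by (rule one_le_power) simp
  then show ?thesis unfolding decay_def by (intro divide_le_eq_1[THEN iffD2] disjI1) linarith
qed

lemma decay_measurable [measurable]: "decay \<in> borel_measurable borel"
  unfolding decay_def by measurable

lemma nn_integral_inverse_one_plus_square: "(\<integral>\<^sup>+x. ennreal (1 / (1 + x\<^sup>2)) \<partial>lborel) < \<infinity>"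
proof -
  have p: "(\<integral>\<^sup>+x. ennreal (1 / (1 + x\<^sup>2)) * indicator {0..} x \<partial>lborel) = ennreal (pi / 2 - arctan 0)"
    by (rule nn_integral_FTC_atLeast)
      (auto intro!: derivative_eq_intros tendsto_arctan_at_top simp: inverse_eq_divide)
  have "(\<integral>\<^sup>+x. ennreal (1 / (1 + x\<^sup>2)) * indicator {..0} x \<partial>lborel)
      = (\<integral>\<^sup>+x. ennreal (1 / (1 + x\<^sup>2)) * indicator {0..} x \<partial>lborel)"
    by (subst nn_integral_real_affine[of _ "-1" 0]) (auto intro!: nn_integral_cong split: split_indicator)
  then have n: "(\<integral>\<^sup>+x. ennreal (1 / (1 + x\<^sup>2)) * indicator {..0} x \<partial>lborel) = ennreal (pi / 2)"
    using p by simp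
  have "(\<integral>\<^sup>+x. ennreal (1 / (1 + x\<^sup>2)) \<partial>lborel)
      \<le> (\<integral>\<^sup>+x. ennreal (1 / (1 + x\<^sup>2)) * indicator {0..} x + ennreal (1 / (1 + x\<^sup>2)) * indicator {..0} x \<partial>lborel)"
    by (intro nn_integral_mono) (auto split: split_indicator)
  also have "\<dots> = ennreal (pi / 2) + ennreal (pi / 2)"
    by (subst nn_integral_add) (use p n in auto)
  also have "\<dots> < \<infinity>" by simp
  finally show ?thesis .
qed

text \<open>Each coordinate satisfies 1 + (x \<bullet> b)^2 \<le> (1 + norm x)^2, so
  \<open>decay\<close> lies below a product of one-dimensional functions 1 / (1 + s^2), each with
  finite integral by the arctangent.\<close>

lemma integrable_decay: "integrable lborel (decay :: 'a::euclidean_space \<Rightarrow> real)"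
proof (rule integrableI_bounded)
  have "decay x \<le> (\<Prod>b\<in>Basis. 1 / (1 + (x \<bullet> b)\<^sup>2))" for x :: 'a
  proof -
    have "(\<Prod>b\<in>Basis. 1 + (x \<bullet> b)\<^sup>2) \<le> (\<Prod>b\<in>(Basis::'a set). (1 + norm x)\<^sup>2)"
    proof (intro prod_mono conjI)
      fix b :: 'a assume "b \<in> Basis"
      then have "\<bar>x \<bullet> b\<bar> \<le> norm x" by (rule Basis_le_norm)
      then have "(x \<bullet> b)\<^sup>2 \<le> (norm x)\<^sup>2" by (metis abs_le_square_iff abs_norm_cancel)
      then show "1 + (x \<bullet> b)\<^sup>2 \<le> (1 + norm x)\<^sup>2" 
        using norm_ge_zero[of x] unfolding power2_sum by (simp del: norm_ge_zero)
    qed auto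
    also have "\<dots> = (1 + norm x) ^ (2 * DIM('a))" by (simp add: power_mult)
    finally have "1 / (1 + norm x) ^ (2 * DIM('a)) \<le> 1 / (\<Prod>b\<in>Basis. 1 + (x \<bullet> b)\<^sup>2)"
      by (intro divide_left_mono mult_pos_pos prod_pos zero_less_power add_pos_nonneg) auto
    then show ?thesis by (simp add: decay_def prod_dividef)
  qed
  then have "(\<integral>\<^sup>+x. ennreal (norm (decay (x::'a))) \<partial>lborel) \<le> (\<integral>\<^sup>+x. (\<Prod>b\<in>Basis. ennreal (1 / (1 + ((x::'a) \<bullet> b)\<^sup>2))) \<partial>lborel)"
    by (intro nn_integral_mono) (auto simp: decay_nonneg prod_ennreal intro!: ennreal_leI)
  also have "\<dots> = (\<Prod>b\<in>(Basis::'a set). (\<integral>\<^sup>+x. ennreal (1 / (1 + x\<^sup>2)) \<partial>lborel))"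
    by (rule nn_integral_lborel_prod) auto
  also have "\<dots> < \<infinity>"
    using nn_integral_inverse_one_plus_square by (simp add: power_less_top_ennreal)
  finally show "(\<integral>\<^sup>+x. ennreal (norm (decay (x::'a))) \<partial>lborel) < \<infinity>" .
qed simp

lemma square_integrable_decay: "square_integrable (\<lambda>x. complex_of_real (decay x))"
  unfolding square_integrable_def
proof
  show "integrable lborel (\<lambda>x::'a. (cmod (complex_of_real (decay x)))\<^sup>2)"
    by (rule Bochner_Integration.integrable_bound[OF integrable_decay])
      (auto simp: decay_nonneg power2_eq_square intro!: mult_left_le decay_le_one)
qed simp

lemma square_integrable_bound:
  assumes "square_integrable g" "f \<in> borel_measurable borel" "\<And>x. cmod (f x) \<le> cmod (g x)"
  shows "square_integrable f"
  unfolding square_integrable_def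
proof
  show "integrable lborel (\<lambda>x. (cmod (f x))\<^sup>2)"
    by (rule Bochner_Integration.integrable_bound[of _ "\<lambda>x. (cmod (g x))\<^sup>2"])
      (use assms in \<open>auto simp: square_integrable_def intro!: power_mono\<close>)
qed (use assms in simp)

lemma square_integrable_decay_bound:
  assumes "f \<in> borel_measurable borel" "\<And>x. cmod (f x) \<le> C * decay x"
  shows "square_integrable f"
  by (rule square_integrable_bound[OF square_integrable_scale[OF square_integrable_decay, of "complex_of_real C"] assms(1)])
    (auto simp: norm_mult decay_nonneg intro!: order_trans[OF assms(2)] mult_right_mono)

text \<open>One constant serves every y comparable to x. Flows, translations and dilations with
  parameters in a bounded range satisfy the comparison, so a whole family of transported copies of f
  gets a single majorant in x.\<close>

lemma schwartz_decay_bound: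
  fixes f :: "'a::euclidean_space \<Rightarrow> complex"
  assumes "f \<in> schwartz_space" "0 < K"
  obtains C where "0 \<le> C" "\<And>(x::'a) (y::'a). 1 + norm x \<le> K * (1 + norm y) \<Longrightarrow> cmod (f y) \<le> C * decay x"
proof -
  let ?N = "2 * DIM('a)"
  obtain C where C: "0 \<le> C" "\<And>x. (1 + norm x) ^ ?N * cmod (f x) \<le> C"
    using rapidly_decreasing_one_plus[OF schwartz_rapidly_decreasing[OF assms(1)], of ?N] by blast
  have bd: "cmod (f y) \<le> (K ^ ?N * C) * decay x" if "1 + norm x \<le> K * (1 + norm y)" for x y :: 'a
  proof -
    have "(1 + norm x) ^ ?N * cmod (f y) \<le> (K * (1 + norm y)) ^ ?N * cmod (f y)"
      by (intro mult_right_mono power_mono that) auto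
    also have "\<dots> = K ^ ?N * ((1 + norm y) ^ ?N * cmod (f y))" by (simp add: power_mult_distrib)
    also have "\<dots> \<le> K ^ ?N * C" using assms(2) by (intro mult_left_mono C) auto
    finally show ?thesis by (simp add: decay_def field_simps add_pos_nonneg)
  qed
  have "0 \<le> K ^ ?N * C" using C assms by simp
  then show ?thesis by (rule that) (rule bd)
qed

lemma schwartz_decay_bound':
  assumes "f \<in> schwartz_space"
  obtains C where "0 \<le> C" "\<And>x. cmod (f x) \<le> C * decay x"
  using schwartz_decay_bound[OF assms zero_less_one] by (metis mult_1 order_refl)

lemma schwartz_square_integrable: "f \<in> schwartz_space \<Longrightarrow> square_integrable f"
  using schwartz_decay_bound' square_integrable_decay_bound schwartz_measurable by metis

lemma square_integrable_mult_decay: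
  assumes "square_integrable h"
  shows "integrable lborel (\<lambda>x. cmod (h x) * decay x)"
  using L2_Cauchy_Schwarz(1)[OF assms square_integrable_decay] by (simp add: decay_nonneg)

text \<open>Dominated convergence with the majorant C |h| \<open>decay\<close>, which is integrable
  by Cauchy-Schwarz because \<open>decay\<close> is itself square integrable. The limit is tested on
  sequences, of which only a tail need lie within distance d.\<close>

lemma pairing_tendsto:
  fixes k :: "'p::metric_space \<Rightarrow> 'a::euclidean_space \<Rightarrow> complex"
  assumes h: "square_integrable h"
    and k [measurable]: "\<And>p. k p \<in> borel_measurable borel" and f [measurable]: "f \<in> borel_measurable borel"
    and lim: "\<And>x. ((\<lambda>p. k p x) \<longlongrightarrow> f x) (at p0)"
    and d: "0 < d" and bound: "\<And>p x. dist p p0 < d \<Longrightarrow> p \<noteq> p0 \<Longrightarrow> cmod (k p x) \<le> C * decay x"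
  shows "((\<lambda>p. LINT x|lborel. h x * k p x) \<longlongrightarrow> (LINT x|lborel. h x * f x)) (at p0)"
  unfolding tendsto_at_iff_sequentially o_def
proof (intro allI impI)
  fix X assume X: "\<forall>i. X i \<in> UNIV - {p0}" and Xl: "X \<longlonglongrightarrow> p0"
  have hm [measurable]: "h \<in> borel_measurable borel" using h by (simp add: square_integrable_def)
  obtain N where N: "\<And>n. n \<ge> N \<Longrightarrow> dist (X n) p0 < d"
    using tendstoD[OF Xl d] by (auto simp: eventually_sequentially)
  have "(\<lambda>n. LINT x|lborel. h x * k (X (n + N)) x) \<longlonglongrightarrow> (LINT x|lborel. h x * f x)"
  proof (rule integral_dominated_convergence)
    show "integrable lborel (\<lambda>x. C * (cmod (h x) * decay x))"
      by (intro integrable_mult_right square_integrable_mult_decay h)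
    show "AE x in lborel. cmod (h x * k (X (n + N)) x) \<le> C * (cmod (h x) * decay x)" for n
    proof (rule AE_I2)
      fix x
      have "cmod (k (X (n + N)) x) \<le> C * decay x" using N X by (intro bound) auto
      then have "cmod (h x) * cmod (k (X (n + N)) x) \<le> cmod (h x) * (C * decay x)"
        by (intro mult_left_mono) auto
      then show "cmod (h x * k (X (n + N)) x) \<le> C * (cmod (h x) * decay x)"
        by (simp add: norm_mult mult_ac)
    qed
    have "(\<lambda>n. k (X n) x) \<longlonglongrightarrow> f x" for x
      using lim[of x] X Xl unfolding tendsto_at_iff_sequentially o_def by blast
    then have "(\<lambda>n. k (X (n + N)) x) \<longlonglongrightarrow> f x" for x by (rule LIMSEQ_ignore_initial_segment)
    then show "AE x in lborel. (\<lambda>n. h x * k (X (n + N)) x) \<longlonglongrightarrow> h x * f x"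
      by (intro AE_I2 tendsto_intros)
  qed measurable
  then show "(\<lambda>n. LINT x|lborel. h x * k (X n) x) \<longlonglongrightarrow> (LINT x|lborel. h x * f x)"
    by (rule LIMSEQ_offset)
qed

lemma integrable_times_L2:
  fixes f g :: "'a::euclidean_space \<Rightarrow> complex"
  assumes "square_integrable f" "square_integrable g"
  shows "integrable lborel (\<lambda>p. f p * g p)"
  using L2_Cauchy_Schwarz(1)[OF assms] assms
  by (subst integrable_norm_iff[symmetric]) (auto simp: norm_mult square_integrable_def)

lemma pairing_integrable:
  assumes h: "square_integrable h" and k: "k \<in> borel_measurable borel" "\<And>x. cmod (k x) \<le> C * decay x"
  shows "integrable lborel (\<lambda>x. h x * k x)"
  by (rule integrable_times_L2[OF h square_integrable_decay_bound[OF k]])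

lemma has_vector_derivative_at_iff:
  "(f has_vector_derivative d) (at x) \<longleftrightarrow> ((\<lambda>y. (1 / (y - x)) *\<^sub>R (f y - f x)) \<longlongrightarrow> d) (at x)"
proof -
  have "norm ((f y - f x) - (y - x) *\<^sub>R d) / norm (y - x) = norm ((1 / (y - x)) *\<^sub>R (f y - f x) - d)"
    if "y \<noteq> x" for y
  proof -
    have "(1 / (y - x)) *\<^sub>R ((f y - f x) - (y - x) *\<^sub>R d) = (1 / (y - x)) *\<^sub>R (f y - f x) - d"
      using that by (simp add: scaleR_right_diff_distrib)
    then have "norm ((1 / (y - x)) *\<^sub>R (f y - f x) - d) = norm ((1 / (y - x)) *\<^sub>R ((f y - f x) - (y - x) *\<^sub>R d))"
      by simp
    then show ?thesis by (simp only: norm_scaleR) simp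
  qed
  then have "((\<lambda>y. norm ((f y - f x) - (y - x) *\<^sub>R d) / norm (y - x)) \<longlongrightarrow> 0) (at x) \<longleftrightarrow>
      ((\<lambda>y. norm ((1 / (y - x)) *\<^sub>R (f y - f x) - d)) \<longlongrightarrow> 0) (at x)"
    by (intro Lim_cong_within refl) auto
  then show ?thesis
    unfolding has_vector_derivative_def has_derivative_iff_norm
    by (simp add: bounded_linear_scaleR_left tendsto_norm_zero_iff LIM_zero_iff)
qed

text \<open>Differentiation under the integral sign: the mean value inequality on the unit ball
  around s0 bounds the difference quotients by the majorant of k', and
  \<open>pairing_tendsto\<close> passes to the limit.\<close>

lemma pairing_has_vector_derivative:
  fixes k k' :: "real \<Rightarrow> 'a::euclidean_space \<Rightarrow> complex"
  assumes h: "square_integrable h"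
    and k [measurable]: "\<And>s. k s \<in> borel_measurable borel" "\<And>s. k' s \<in> borel_measurable borel"
    and D: "\<And>s x. ((\<lambda>s. k s x) has_vector_derivative k' s x) (at s)"
    and bound: "\<And>s x. \<bar>s - s0\<bar> < 1 \<Longrightarrow> cmod (k s x) \<le> C * decay x"
      "\<And>s x. \<bar>s - s0\<bar> < 1 \<Longrightarrow> cmod (k' s x) \<le> C * decay x"
  shows "((\<lambda>s. LINT x|lborel. h x * k s x) has_vector_derivative (LINT x|lborel. h x * k' s0 x)) (at s0)"
proof -
  define q where "q s x = (1 / (s - s0)) *\<^sub>R (k s x - k s0 x)" for s x
  have [measurable]: "q s \<in> borel_measurable borel" for s unfolding q_def by measurable
  have qb: "cmod (q s x) \<le> C * decay x" if "dist s s0 < 1" "s \<noteq> s0" for s x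
  proof -
    have "norm (k s x - k s0 x) \<le> (C * decay x) * norm (s - s0)"
    proof (rule differentiable_bound[of "ball s0 1" "\<lambda>s. k s x" "\<lambda>s t. t *\<^sub>R k' s x"])
      show "((\<lambda>s. k s x) has_derivative (\<lambda>t. t *\<^sub>R k' s x)) (at s within ball s0 1)" for s
        using D[of x s] by (auto simp: has_vector_derivative_def intro: has_derivative_at_withinI)
      show "onorm (\<lambda>t. t *\<^sub>R k' s x) \<le> C * decay x" if "s \<in> ball s0 1" for s
        using that bound(2)[of s x] 
        by (intro onorm_le) (auto simp: dist_real_def abs_minus_commute mult.commute intro!: mult_left_mono)
    qed (use that in \<open>auto simp: dist_commute\<close>)
    then show ?thesis using that by (simp add: q_def divide_simps mult_ac del: scaleR_right_diff_distrib)
  qed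
  have "((\<lambda>s. LINT x|lborel. h x * q s x) \<longlongrightarrow> (LINT x|lborel. h x * k' s0 x)) (at s0)"
  proof (rule pairing_tendsto[OF h _ _ _ zero_less_one qb])
    fix x
    show "((\<lambda>s. q s x) \<longlongrightarrow> k' s0 x) (at s0)"
      using D[of x s0] unfolding q_def has_vector_derivative_at_iff .
  qed auto
  moreover have "\<forall>\<^sub>F s in at s0. (LINT x|lborel. h x * q s x)
      = (1 / (s - s0)) *\<^sub>R ((LINT x|lborel. h x * k s x) - (LINT x|lborel. h x * k s0 x))"
    unfolding eventually_at
  proof (intro exI[of _ 1] conjI ballI impI)
    fix s assume s: "s \<noteq> s0 \<and> dist s s0 < 1"
    have "integrable lborel (\<lambda>x. h x * k s x)" "integrable lborel (\<lambda>x. h x * k s0 x)"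
      using s by (auto intro!: pairing_integrable[OF h] bound simp: dist_real_def)
    then show "(LINT x|lborel. h x * q s x)
      = (1 / (s - s0)) *\<^sub>R ((LINT x|lborel. h x * k s x) - (LINT x|lborel. h x * k s0 x))"
      by (simp add: q_def right_diff_distrib flip: Bochner_Integration.integral_diff integral_scaleR_right)
  qed simp
  ultimately have "((\<lambda>s. (1 / (s - s0)) *\<^sub>R ((LINT x|lborel. h x * k s x) - (LINT x|lborel. h x * k s0 x)))
      \<longlongrightarrow> (LINT x|lborel. h x * k' s0 x)) (at s0)"
    by (rule Lim_transform_eventually)
  then show ?thesis by (simp only: has_vector_derivative_at_iff)
qed


section \<open>Affine maps of the Heisenberg group\<close>

text \<open>One triangular affine family containing left translations, flows of both kinds of
  invariant fields, dilations, and separate scalings of z and t. Its Jacobian is r^2 |s|, so changes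
  of variables are proved once for all of them.\<close>

definition haff :: "real \<Rightarrow> real \<Rightarrow> real \<Rightarrow> real \<Rightarrow> heisenberg \<Rightarrow> heisenberg \<Rightarrow> heisenberg" where
  "haff r s \<alpha> \<beta> c = (\<lambda>(x, y, t). c + (r * x, r * y, s * t + \<alpha> * x + \<beta> * y))"

lemma haff_measurable [measurable]: "haff r s \<alpha> \<beta> c \<in> borel_measurable borel"
proof -
  have "continuous_on UNIV (haff r s \<alpha> \<beta> c)"
    unfolding haff_def case_prod_beta by (intro continuous_intros)
  then show ?thesis by (rule borel_measurable_continuous_onI)
qed

lemma nn_integral_heisenberg:
  fixes f :: "heisenberg \<Rightarrow> ennreal"
  assumes f: "f \<in> borel_measurable borel"
  shows "(\<integral>\<^sup>+p. f p \<partial>lborel) = (\<integral>\<^sup>+x. \<integral>\<^sup>+y. \<integral>\<^sup>+t. f (x, y, t) \<partial>lborel \<partial>lborel \<partial>lborel)"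
proof -
  have [measurable]: "f \<in> borel_measurable (borel \<Otimes>\<^sub>M borel \<Otimes>\<^sub>M borel)" using f by (simp add: borel_prod)
  have [measurable]: "(\<lambda>q. f (x, q)) \<in> borel_measurable (borel \<Otimes>\<^sub>M borel)" for x by measurable
  have 1: "(\<integral>\<^sup>+q. f (x, q) \<partial>lborel) = (\<integral>\<^sup>+y. \<integral>\<^sup>+t. f (x, y, t) \<partial>lborel \<partial>lborel)" for x
    unfolding lborel_prod[symmetric, where 'a=real and 'b=real]
    by (rule lborel.nn_integral_fst[symmetric]) measurable
  have "(\<integral>\<^sup>+p. f p \<partial>lborel) = (\<integral>\<^sup>+p. f p \<partial>(lborel \<Otimes>\<^sub>M lborel))"
    by (simp add: lborel_prod)
  also have "\<dots> = (\<integral>\<^sup>+x. \<integral>\<^sup>+q. f (x, q) \<partial>lborel \<partial>lborel)"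
    by (rule lborel.nn_integral_fst[symmetric]) (use f in \<open>simp add: lborel_prod\<close>)
  finally show ?thesis by (simp only: 1)
qed

text \<open>Triangularity reduces the claim to one-dimensional affine substitutions: in the
  innermost integral x and y are fixed, and the shear is just a shift of t.\<close>

lemma nn_integral_haff:
  fixes f :: "heisenberg \<Rightarrow> ennreal"
  assumes f: "f \<in> borel_measurable borel" and rs: "r \<noteq> 0" "s \<noteq> 0"
  shows "(\<integral>\<^sup>+p. f p \<partial>lborel) = ennreal (r\<^sup>2 * \<bar>s\<bar>) * (\<integral>\<^sup>+p. f (haff r s \<alpha> \<beta> c p) \<partial>lborel)"
proof -
  obtain c1 c2 c3 where c: "c = (c1, c2, c3)" by (cases c)
  have fA: "(\<lambda>p. f (haff r s \<alpha> \<beta> c p)) \<in> borel_measurable borel"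
    using f by measurable
  have [measurable]: "f \<in> borel_measurable (borel \<Otimes>\<^sub>M borel \<Otimes>\<^sub>M borel)" using f by (simp add: borel_prod)
  have e: "haff r s \<alpha> \<beta> c (x, y, t) = (c1 + r * x, c2 + r * y, (c3 + \<alpha> * x + \<beta> * y) + s * t)" for x y t
    by (simp add: haff_def c)
  have "(\<integral>\<^sup>+p. f p \<partial>lborel) = (\<integral>\<^sup>+x. \<integral>\<^sup>+y. \<integral>\<^sup>+t. f (x, y, t) \<partial>lborel \<partial>lborel \<partial>lborel)"
    by (rule nn_integral_heisenberg[OF f])
  also have "\<dots> = ennreal \<bar>r\<bar> * (\<integral>\<^sup>+x. \<integral>\<^sup>+y. \<integral>\<^sup>+t. f (c1 + r * x, y, t) \<partial>lborel \<partial>lborel \<partial>lborel)"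
    by (rule nn_integral_real_affine) (use rs in auto)
  also have "\<dots> = ennreal \<bar>r\<bar> * (\<integral>\<^sup>+x. ennreal \<bar>r\<bar> *
      (\<integral>\<^sup>+y. \<integral>\<^sup>+t. f (c1 + r * x, c2 + r * y, t) \<partial>lborel \<partial>lborel) \<partial>lborel)"
    by (intro arg_cong2[where f="(*)"] refl nn_integral_cong nn_integral_real_affine) (use rs in auto)
  also have "\<dots> = ennreal \<bar>r\<bar> * (\<integral>\<^sup>+x. ennreal \<bar>r\<bar> *
      (\<integral>\<^sup>+y. ennreal \<bar>s\<bar> * (\<integral>\<^sup>+t. f (haff r s \<alpha> \<beta> c (x, y, t)) \<partial>lborel) \<partial>lborel) \<partial>lborel)"
    unfolding e
    by (intro arg_cong2[where f="(*)"] refl nn_integral_cong nn_integral_real_affine) (use rs in auto)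
  also have "\<dots> = ennreal \<bar>r\<bar> * (ennreal \<bar>r\<bar> * (ennreal \<bar>s\<bar> *
      (\<integral>\<^sup>+x. \<integral>\<^sup>+y. \<integral>\<^sup>+t. f (haff r s \<alpha> \<beta> c (x, y, t)) \<partial>lborel \<partial>lborel \<partial>lborel)))"
    unfolding e by (simp add: nn_integral_cmult)
  also have "\<dots> = ennreal (\<bar>r\<bar> * (\<bar>r\<bar> * \<bar>s\<bar>)) * (\<integral>\<^sup>+p. f (haff r s \<alpha> \<beta> c p) \<partial>lborel)"
    by (subst nn_integral_heisenberg[OF fA]) (simp add: ennreal_mult mult.assoc)
  also have "\<bar>r\<bar> * (\<bar>r\<bar> * \<bar>s\<bar>) = r\<^sup>2 * \<bar>s\<bar>" by (simp add: power2_eq_square)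
  finally show ?thesis .
qed

text \<open>The substitution rule stated as an identity of measures, so that it passes from
  nonnegative integrals to Bochner integrals and integrability.\<close>

lemma lborel_haff:
  assumes "r \<noteq> 0" "s \<noteq> 0"
  shows "lborel = density (distr lborel borel (haff r s \<alpha> \<beta> c)) (\<lambda>_. ennreal (r\<^sup>2 * \<bar>s\<bar>))"
proof (rule measure_eqI)
  fix A :: "heisenberg set" assume "A \<in> sets lborel"
  then have A[measurable]: "A \<in> sets borel" by simp
  have "emeasure lborel A = (\<integral>\<^sup>+p. indicator A p \<partial>lborel)" by simp
  also have "\<dots> = ennreal (r\<^sup>2 * \<bar>s\<bar>) * (\<integral>\<^sup>+p. indicator A (haff r s \<alpha> \<beta> c p) \<partial>lborel)"
    by (rule nn_integral_haff) (use assms in auto)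
  also have "(\<integral>\<^sup>+p. indicator A (haff r s \<alpha> \<beta> c p) \<partial>lborel) = (\<integral>\<^sup>+p. indicator A p \<partial>distr lborel borel (haff r s \<alpha> \<beta> c))"
    by (rule nn_integral_distr[symmetric]) auto
  also have "\<dots> = emeasure (distr lborel borel (haff r s \<alpha> \<beta> c)) A" by simp
  finally show "emeasure lborel A = emeasure (density (distr lborel borel (haff r s \<alpha> \<beta> c)) (\<lambda>_. ennreal (r\<^sup>2 * \<bar>s\<bar>))) A"
    by (simp add: emeasure_density_const)
qed simp

lemma
  fixes f :: "heisenberg \<Rightarrow> 'b::{banach, second_countable_topology}"
  assumes f[measurable]: "f \<in> borel_measurable borel" and rs: "r \<noteq> 0" "s \<noteq> 0"
  shows integral_haff: "(LINT p|lborel. f p) = (r\<^sup>2 * \<bar>s\<bar>) *\<^sub>R (LINT p|lborel. f (haff r s \<alpha> \<beta> c p))"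
    and integrable_haff: "integrable lborel (\<lambda>p. f (haff r s \<alpha> \<beta> c p)) \<longleftrightarrow> integrable lborel f"
proof -
  have "(LINT p|lborel. f p) = (LINT p|density (distr lborel borel (haff r s \<alpha> \<beta> c)) (\<lambda>_. ennreal (r\<^sup>2 * \<bar>s\<bar>)). f p)"
    by (subst lborel_haff[OF rs]) simp
  also have "\<dots> = (LINT p|distr lborel borel (haff r s \<alpha> \<beta> c). (r\<^sup>2 * \<bar>s\<bar>) *\<^sub>R f p)"
    by (rule integral_density) auto
  also have "\<dots> = (LINT p|lborel. (r\<^sup>2 * \<bar>s\<bar>) *\<^sub>R f (haff r s \<alpha> \<beta> c p))"
    by (rule integral_distr) auto
  finally show "(LINT p|lborel. f p) = (r\<^sup>2 * \<bar>s\<bar>) *\<^sub>R (LINT p|lborel. f (haff r s \<alpha> \<beta> c p))" by simp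
  have "integrable lborel f \<longleftrightarrow> integrable (density (distr lborel borel (haff r s \<alpha> \<beta> c)) (\<lambda>_. ennreal (r\<^sup>2 * \<bar>s\<bar>))) f"
    by (subst lborel_haff[OF rs]) simp
  also have "\<dots> \<longleftrightarrow> integrable (distr lborel borel (haff r s \<alpha> \<beta> c)) (\<lambda>p. (r\<^sup>2 * \<bar>s\<bar>) *\<^sub>R f p)"
    by (rule integrable_density) auto
  also have "\<dots> \<longleftrightarrow> integrable lborel (\<lambda>p. (r\<^sup>2 * \<bar>s\<bar>) *\<^sub>R f (haff r s \<alpha> \<beta> c p))"
    by (rule integrable_distr_eq) auto
  also have "\<dots> \<longleftrightarrow> integrable lborel (\<lambda>p. f (haff r s \<alpha> \<beta> c p))"
  proof
    assume "integrable lborel (\<lambda>p. (r\<^sup>2 * \<bar>s\<bar>) *\<^sub>R f (haff r s \<alpha> \<beta> c p))"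
    then have "integrable lborel (\<lambda>p. (1 / (r\<^sup>2 * \<bar>s\<bar>)) *\<^sub>R (r\<^sup>2 * \<bar>s\<bar>) *\<^sub>R f (haff r s \<alpha> \<beta> c p))"
      by (rule integrable_scaleR_right)
    then show "integrable lborel (\<lambda>p. f (haff r s \<alpha> \<beta> c p))" using rs by simp
  qed (rule integrable_scaleR_right)
  finally show "integrable lborel (\<lambda>p. f (haff r s \<alpha> \<beta> c p)) \<longleftrightarrow> integrable lborel f" by simp
qed

lemma square_integrable_haff:
  assumes "square_integrable f" "r \<noteq> 0" "s \<noteq> 0"
  shows "square_integrable (\<lambda>p. f (haff r s \<alpha> \<beta> c p))"
    and "L2_seminorm f = sqrt (r\<^sup>2 * \<bar>s\<bar>) * L2_seminorm (\<lambda>p. f (haff r s \<alpha> \<beta> c p))"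
proof -
  have [measurable]: "f \<in> borel_measurable borel" using assms by (simp add: square_integrable_def)
  note a = assms(2,3)
  show "square_integrable (\<lambda>p. f (haff r s \<alpha> \<beta> c p))"
    using assms(1) integrable_haff[of "\<lambda>p. (cmod (f p))\<^sup>2", OF _ a] unfolding square_integrable_def by simp
  show "L2_seminorm f = sqrt (r\<^sup>2 * \<bar>s\<bar>) * L2_seminorm (\<lambda>p. f (haff r s \<alpha> \<beta> c p))"
    unfolding L2_seminorm_def real_sqrt_mult[symmetric]
    by (subst integral_haff[OF _ a, of _ \<alpha> \<beta> c]) auto
qed

definition haff_linear :: "real \<Rightarrow> real \<Rightarrow> real \<Rightarrow> real \<Rightarrow> heisenberg \<Rightarrow> heisenberg" where
  "haff_linear r s \<alpha> \<beta> = (\<lambda>(x, y, t). (r * x, r * y, s * t + \<alpha> * x + \<beta> * y))"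

lemma haff_eq: "haff r s \<alpha> \<beta> c p = c + haff_linear r s \<alpha> \<beta> p"
  by (cases p) (simp add: haff_def haff_linear_def)

lemma linear_haff_linear: "linear (haff_linear r s \<alpha> \<beta>)"
  by (rule linearI) (auto simp: haff_linear_def algebra_simps)

lemma inj_haff_linear: "r \<noteq> 0 \<Longrightarrow> s \<noteq> 0 \<Longrightarrow> inj (haff_linear r s \<alpha> \<beta>)"
  by (rule injI) (auto simp: haff_linear_def)

lemma schwartz_haff:
  "f \<in> schwartz_space \<Longrightarrow> r \<noteq> 0 \<Longrightarrow> s \<noteq> 0 \<Longrightarrow> (\<lambda>p. f (haff r s \<alpha> \<beta> c p)) \<in> schwartz_space"
  unfolding haff_eq by (intro schwartz_affine_compose linear_haff_linear inj_haff_linear)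

lemma heis_norm_bounds:
  fixes x y t :: real
  shows "\<bar>x\<bar> \<le> norm (x, y, t)" "\<bar>y\<bar> \<le> norm (x, y, t)" "\<bar>t\<bar> \<le> norm (x, y, t)"
    "norm (x, y, t) \<le> \<bar>x\<bar> + \<bar>y\<bar> + \<bar>t\<bar>"
proof -
  have "\<bar>x\<bar> \<le> norm (x, y, t)" using norm_fst_le[of x "(y, t)"] by simp
  moreover have n: "norm (y, t) \<le> norm (x, y, t)" using norm_snd_le[of "(y, t)" x] by simp
  moreover have "\<bar>y\<bar> \<le> norm (y, t)" "\<bar>t\<bar> \<le> norm (y, t)" using norm_fst_le[of y t] norm_snd_le[of t y] by auto
  ultimately show "\<bar>x\<bar> \<le> norm (x, y, t)" "\<bar>y\<bar> \<le> norm (x, y, t)" "\<bar>t\<bar> \<le> norm (x, y, t)" by auto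
  show "norm (x, y, t) \<le> \<bar>x\<bar> + \<bar>y\<bar> + \<bar>t\<bar>"
    using norm_Pair_le[of x "(y, t)"] norm_Pair_le[of y t] by simp
qed


section \<open>Invariant vector fields and their flows\<close>

text \<open>For \<open>\<sigma> = 1\<close> these are the left-invariant fields \<open>a X + b Y\<close>, whose flow is multiplication by
  \<open>(s a, s b, 0)\<close> from the right; for \<open>\<sigma> = -1\<close> the right-invariant fields, whose flow is
  multiplication from the left.\<close>

definition hvec :: "real \<Rightarrow> real \<Rightarrow> real \<Rightarrow> heisenberg \<Rightarrow> heisenberg" where
  "hvec \<sigma> a b = (\<lambda>(x, y, t). (a, b, 2 * \<sigma> * (b * x - a * y)))"

definition hflow :: "real \<Rightarrow> real \<Rightarrow> real \<Rightarrow> real \<Rightarrow> heisenberg \<Rightarrow> heisenberg" where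
  "hflow \<sigma> a b s p = p + s *\<^sub>R hvec \<sigma> a b p"

definition hderiv :: "real \<Rightarrow> real \<Rightarrow> real \<Rightarrow> (heisenberg \<Rightarrow> complex) \<Rightarrow> heisenberg \<Rightarrow> complex" where
  "hderiv \<sigma> a b = dirderiv (hvec \<sigma> a b)"

lemma hflow_haff: "hflow \<sigma> a b s p = haff 1 1 (2 * \<sigma> * s * b) (- (2 * \<sigma> * s * a)) (s * a, s * b, 0) p"
  by (cases p) (simp add: hflow_def hvec_def haff_def algebra_simps)

text \<open>Moving along (a, b) leaves b x - a y unchanged, so the field is constant on its own
  integral curves. These are straight lines, which is why \<open>hflow\<close> is affine in the time
  s.\<close>

lemma hvec_hflow: "hvec \<sigma> a b (hflow \<sigma> a b s p) = hvec \<sigma> a b p"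
  by (cases p) (simp add: hflow_def hvec_def algebra_simps)

lemma hflow_inverse: "hflow \<sigma> a b s (hflow \<sigma> a b (- s) p) = p"
  using hvec_hflow[of \<sigma> a b "-s" p] by (simp add: hflow_def)

lemma hflow_0 [simp]: "hflow \<sigma> a b 0 p = p"
  by (simp add: hflow_def)

lemma hderiv_schwartz:
  assumes "f \<in> schwartz_space" shows "hderiv \<sigma> a b f \<in> schwartz_space"
  unfolding hderiv_def
proof (rule schwartz_dirderiv[OF assms])
  fix e :: heisenberg
  show "\<exists>c d. \<forall>p. hvec \<sigma> a b p \<bullet> e = p \<bullet> c + d"
    by (cases e, rule exI[of _ "(2 * \<sigma> * b * snd (snd e), - (2 * \<sigma> * a * snd (snd e)), 0)"],
        rule exI[of _ "a * fst e + b * fst (snd e)"]) (auto simp: hvec_def inner_prod_def algebra_simps)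
qed

lemma hflow_has_vector_derivative:
  assumes "f \<in> schwartz_space"
  shows "((\<lambda>s. f (hflow \<sigma> a b s p)) has_vector_derivative hderiv \<sigma> a b f (hflow \<sigma> a b s p)) (at s)"
proof -
  have "((\<lambda>s. hflow \<sigma> a b s p) has_vector_derivative hvec \<sigma> a b (hflow \<sigma> a b s p)) (at s)"
    unfolding hvec_hflow unfolding hflow_def by (auto intro!: derivative_eq_intros)
  then have "((\<lambda>s. hflow \<sigma> a b s p) has_derivative (\<lambda>u. u *\<^sub>R hvec \<sigma> a b (hflow \<sigma> a b s p))) (at s)"
    by (simp add: has_vector_derivative_def)
  from has_derivative_compose[OF this schwartz_has_derivative[OF assms]]
  show ?thesis
    by (simp add: has_vector_derivative_def hderiv_def dirderiv_def
        linear_scale[OF linear_frechet_derivative[OF schwartz_differentiable[OF assms]]])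
qed

lemma hvec_norm: "norm (hvec \<sigma> a b p) \<le> (\<bar>a\<bar> + \<bar>b\<bar>) * (1 + 2 * \<bar>\<sigma>\<bar>) * (1 + norm p)"
proof -
  obtain x y t where p: "p = (x, y, t)" by (cases p)
  have "\<bar>b * x - a * y\<bar> \<le> \<bar>b\<bar> * \<bar>x\<bar> + \<bar>a\<bar> * \<bar>y\<bar>" by (metis abs_mult abs_triangle_ineq4)
  also have "\<dots> \<le> \<bar>b\<bar> * norm p + \<bar>a\<bar> * norm p"
    unfolding p by (intro add_mono mult_left_mono heis_norm_bounds) auto
  also have "\<dots> = (\<bar>a\<bar> + \<bar>b\<bar>) * norm p" by (simp add: algebra_simps)
  finally have 1: "2 * \<bar>\<sigma>\<bar> * \<bar>b * x - a * y\<bar> \<le> 2 * \<bar>\<sigma>\<bar> * ((\<bar>a\<bar> + \<bar>b\<bar>) * norm p)"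
    by (intro mult_left_mono) auto
  have "norm (hvec \<sigma> a b p) \<le> \<bar>a\<bar> + \<bar>b\<bar> + 2 * \<bar>\<sigma>\<bar> * \<bar>b * x - a * y\<bar>"
    using heis_norm_bounds(4)[of a b "2 * \<sigma> * (b * x - a * y)"] by (simp add: hvec_def p abs_mult)
  also have "\<dots> \<le> (\<bar>a\<bar> + \<bar>b\<bar>) + 2 * \<bar>\<sigma>\<bar> * ((\<bar>a\<bar> + \<bar>b\<bar>) * norm p)" using 1 by simp
  also have "\<dots> \<le> (\<bar>a\<bar> + \<bar>b\<bar>) * (1 + 2 * \<bar>\<sigma>\<bar>) * (1 + norm p)"
    by (simp add: algebra_simps)
  finally show ?thesis .
qed

text \<open>Obtained by flowing back: p is reached from its image in time -s, and the field grows at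
  most linearly. It supplies the comparison required by \<open>schwartz_decay_bound\<close>.\<close>

lemma hflow_growth:
  assumes "\<bar>s\<bar> \<le> M"
  shows "1 + norm p \<le> (1 + M * ((\<bar>a\<bar> + \<bar>b\<bar>) * (1 + 2 * \<bar>\<sigma>\<bar>))) * (1 + norm (hflow \<sigma> a b s p))"
proof -
  let ?K = "(\<bar>a\<bar> + \<bar>b\<bar>) * (1 + 2 * \<bar>\<sigma>\<bar>)"
  define q where "q = hflow \<sigma> a b s p"
  have p: "p = q + (- s) *\<^sub>R hvec \<sigma> a b q"
    using hflow_inverse[of \<sigma> a b "-s" p] by (simp add: q_def hflow_def)
  have "norm p \<le> norm q + \<bar>s\<bar> * norm (hvec \<sigma> a b q)"
    using norm_triangle_ineq[of q "(- s) *\<^sub>R hvec \<sigma> a b q"] p by simp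
  also have "\<dots> \<le> norm q + M * (?K * (1 + norm q))"
    using assms by (intro add_mono mult_mono hvec_norm order_refl) auto
  finally show ?thesis by (simp add: q_def algebra_simps)
qed

lemma hflow_pairing:
  assumes h: "square_integrable h" and f: "f \<in> schwartz_space"
  shows "((\<lambda>s. LINT w|lborel. h w * f (hflow \<sigma> a b s w)) has_vector_derivative
      (LINT w|lborel. h w * hderiv \<sigma> a b f (hflow \<sigma> a b s0 w))) (at s0)"
proof -
  \<comment> \<open>The growth constant for times up to |s0| + 1, hence uniform over |s - s0| <
    1.\<close>
  let ?K = "1 + (\<bar>s0\<bar> + 1) * ((\<bar>a\<bar> + \<bar>b\<bar>) * (1 + 2 * \<bar>\<sigma>\<bar>))"
  have K: "0 < ?K" by (intro add_pos_nonneg) auto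
  obtain C1 where C1: "0 \<le> C1" "\<And>(p::heisenberg) q. 1 + norm p \<le> ?K * (1 + norm q) \<Longrightarrow> cmod (f q) \<le> C1 * decay p"
    using schwartz_decay_bound[OF f K] by blast
  obtain C2 where C2: "0 \<le> C2" "\<And>(p::heisenberg) q. 1 + norm p \<le> ?K * (1 + norm q) \<Longrightarrow> cmod (hderiv \<sigma> a b f q) \<le> C2 * decay p"
    using schwartz_decay_bound[OF hderiv_schwartz[OF f] K] by blast
  have C: "C1 * decay p \<le> (C1 + C2) * decay p" "C2 * decay p \<le> (C1 + C2) * decay p" for p :: heisenberg
    using C1(1) C2(1) by (auto intro!: mult_right_mono decay_nonneg)
  have m: "(\<lambda>p. g (hflow \<sigma> a b s p)) \<in> borel_measurable borel" if "g \<in> schwartz_space" for g s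
    using schwartz_measurable[OF that] unfolding hflow_haff by measurable
  show ?thesis
  proof (rule pairing_has_vector_derivative[OF h])
    fix s p assume "\<bar>s - s0\<bar> < 1"
    then have g: "1 + norm p \<le> ?K * (1 + norm (hflow \<sigma> a b s p))"
      by (intro hflow_growth) auto
    show "cmod (f (hflow \<sigma> a b s p)) \<le> (C1 + C2) * decay p"
      using C1(2)[OF g] C(1) by (rule order_trans)
    show "cmod (hderiv \<sigma> a b f (hflow \<sigma> a b s p)) \<le> (C1 + C2) * decay p"
      using C2(2)[OF g] C(2) by (rule order_trans)
  qed (intro m f hderiv_schwartz hflow_has_vector_derivative)+
qed

definition L2_pairing :: "(heisenberg \<Rightarrow> complex) \<Rightarrow> (heisenberg \<Rightarrow> complex) \<Rightarrow> complex" where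
  "L2_pairing f g = (LINT p|lborel. f p * cnj (g p))"

lemma square_integrable_cnj: "square_integrable f \<Longrightarrow> square_integrable (\<lambda>p. cnj (f p))"
  by (auto simp: square_integrable_def intro: borel_measurable_continuous_on[where f=cnj] continuous_on_cnj)

text \<open>The flow preserves Lebesgue measure, so transporting f by time s equals transporting g
  by time -s inside the pairing. Differentiating both expressions at s = 0 gives the claim.\<close>

lemma hderiv_antisymmetric:
  assumes f: "f \<in> schwartz_space" and g: "g \<in> schwartz_space"
  shows "L2_pairing (hderiv \<sigma> a b f) g = - L2_pairing f (hderiv \<sigma> a b g)"
proof -
  note sf = square_integrable_cnj[OF schwartz_square_integrable[OF f]]
  note sg = square_integrable_cnj[OF schwartz_square_integrable[OF g]]
  have [measurable]: "f \<in> borel_measurable borel" "g \<in> borel_measurable borel"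
    using f g by (auto intro: schwartz_measurable)
  have mcnj [measurable]: "cnj \<in> borel_measurable borel"
    by (intro borel_measurable_continuous_onI continuous_intros)
  have D1: "((\<lambda>s. LINT w|lborel. cnj (g w) * f (hflow \<sigma> a b s w)) has_vector_derivative L2_pairing (hderiv \<sigma> a b f) g) (at 0)"
    using hflow_pairing[OF sg f, of \<sigma> a b 0] by (simp add: L2_pairing_def mult.commute)
  have "((\<lambda>s. LINT w|lborel. cnj (f w) * g (hflow \<sigma> a b s w)) has_vector_derivative cnj (L2_pairing f (hderiv \<sigma> a b g))) (at 0)"
    using hflow_pairing[OF sf g, of \<sigma> a b 0] by (simp add: L2_pairing_def flip: Bochner_Integration.integral_cnj)
  then have "((\<lambda>s. LINT w|lborel. cnj (f w) * g (hflow \<sigma> a b s w)) has_vector_derivative cnj (L2_pairing f (hderiv \<sigma> a b g))) (at (- 0))"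
    by simp
  moreover have "((\<lambda>s::real. - s) has_vector_derivative - 1) (at 0)" by (auto intro!: derivative_eq_intros)
  ultimately have "((\<lambda>s. LINT w|lborel. cnj (f w) * g (hflow \<sigma> a b (- s) w)) has_vector_derivative (- 1) *\<^sub>R cnj (L2_pairing f (hderiv \<sigma> a b g))) (at 0)"
    using vector_diff_chain_at[of uminus "-1" 0] by (simp add: o_def)
  then have "((\<lambda>s. cnj (LINT w|lborel. cnj (f w) * g (hflow \<sigma> a b (- s) w))) has_vector_derivative cnj ((- 1) *\<^sub>R cnj (L2_pairing f (hderiv \<sigma> a b g)))) (at 0)"
    by (rule bounded_linear.has_vector_derivative[OF bounded_linear_cnj])
  moreover have "cnj (LINT w|lborel. cnj (f w) * g (hflow \<sigma> a b (- s) w)) = (LINT w|lborel. cnj (g w) * f (hflow \<sigma> a b s w))" for s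
  proof -
    have "(LINT w|lborel. cnj (g w) * f (hflow \<sigma> a b s w))
        = (LINT w|lborel. cnj (g (hflow \<sigma> a b (- s) w)) * f (hflow \<sigma> a b s (hflow \<sigma> a b (- s) w)))"
      unfolding hflow_haff by (subst integral_haff[where r=1 and s=1]) auto
    then show ?thesis
      by (simp add: hflow_inverse mult.commute flip: Bochner_Integration.integral_cnj)
  qed
  ultimately have "((\<lambda>s. LINT w|lborel. cnj (g w) * f (hflow \<sigma> a b s w)) has_vector_derivative - L2_pairing f (hderiv \<sigma> a b g)) (at 0)"
    by simp
  with D1 show ?thesis by (rule vector_derivative_unique_at)
qed

text \<open>The assumption B says that the map carries the field to k times itself: k = 1 for left
  translations and for the flow along its own field, k = r for dilations.\<close>

lemma hderiv_haff:
  assumes f: "f \<in> schwartz_space"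
    and B: "\<And>p. haff_linear r s \<alpha> \<beta> (hvec \<sigma> a b p) = k *\<^sub>R hvec \<sigma> a b (haff r s \<alpha> \<beta> c p)"
  shows "hderiv \<sigma> a b (\<lambda>p. f (haff r s \<alpha> \<beta> c p)) = (\<lambda>p. complex_of_real k * hderiv \<sigma> a b f (haff r s \<alpha> \<beta> c p))"
proof -
  have "(haff r s \<alpha> \<beta> c has_derivative haff_linear r s \<alpha> \<beta>) (at p)" for p
    unfolding haff_eq[abs_def]
    using has_derivative_add[OF has_derivative_const linear_imp_has_derivative[OF linear_haff_linear]] by simp
  note D = has_derivative_compose[OF this schwartz_has_derivative[OF f]]
  have "hderiv \<sigma> a b (\<lambda>p. f (haff r s \<alpha> \<beta> c p)) = (\<lambda>p. frechet_derivative f (at (haff r s \<alpha> \<beta> c p)) (k *\<^sub>R hvec \<sigma> a b (haff r s \<alpha> \<beta> c p)))"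
    unfolding hderiv_def dirderiv_eq[OF D] B ..
  then show ?thesis
    by (simp add: linear_scale[OF linear_frechet_derivative[OF schwartz_differentiable[OF f]]]
        hderiv_def dirderiv_def scaleR_conv_of_real)
qed

lemma hderiv_cmult:
  assumes "f \<in> schwartz_space" shows "hderiv \<sigma> a b (\<lambda>p. c * f p) = (\<lambda>p. c * hderiv \<sigma> a b f p)"
  unfolding hderiv_def dirderiv_eq[OF has_derivative_mult_right[OF schwartz_has_derivative[OF assms]]]
  by (simp add: dirderiv_def)

lemma hderiv_add:
  assumes "f \<in> schwartz_space" "g \<in> schwartz_space"
  shows "hderiv \<sigma> a b (\<lambda>p. f p + g p) = (\<lambda>p. hderiv \<sigma> a b f p + hderiv \<sigma> a b g p)"
  unfolding hderiv_def dirderiv_eq[OF has_derivative_add[OF assms[THEN schwartz_has_derivative]]]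
  by (simp add: dirderiv_def)

abbreviation "hX \<equiv> hderiv 1 1 0"
abbreviation "hY \<equiv> hderiv 1 0 1"

lemma heis_X_eq: assumes "f \<in> schwartz_space" shows "heis_X f = hX f"
proof
  fix p :: heisenberg
  obtain x y t where p: "p = (x, y, t)" by (cases p)
  note lin = linear_frechet_derivative[OF schwartz_differentiable[OF assms, of p]]
  have "hX f p = frechet_derivative f (at p) ((1, 0, 0) + (- 2 * y) *\<^sub>R (0, 0, 1))"
    by (simp add: hderiv_def dirderiv_def hvec_def p)
  then show "heis_X f p = hX f p"
    unfolding linear_add[OF lin] linear_scale[OF lin] by (simp add: heis_X_def p scaleR_conv_of_real)
qed

lemma heis_Y_eq: assumes "f \<in> schwartz_space" shows "heis_Y f = hY f"
proof
  fix p :: heisenberg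
  obtain x y t where p: "p = (x, y, t)" by (cases p)
  note lin = linear_frechet_derivative[OF schwartz_differentiable[OF assms, of p]]
  have "hY f p = frechet_derivative f (at p) ((0, 1, 0) + (2 * x) *\<^sub>R (0, 0, 1))"
    by (simp add: hderiv_def dirderiv_def hvec_def p)
  then show "heis_Y f p = hY f p"
    unfolding linear_add[OF lin] linear_scale[OF lin] by (simp add: heis_Y_def p scaleR_conv_of_real)
qed

lemma sub_laplacian_eq:
  assumes "f \<in> schwartz_space"
  shows "sub_laplacian f = (\<lambda>p. (- 1) * (hX (hX f) p + hY (hY f) p))"
  using assms by (simp add: sub_laplacian_def heis_X_eq heis_Y_eq hderiv_schwartz)

lemma sub_laplacian_schwartz: "f \<in> schwartz_space \<Longrightarrow> sub_laplacian f \<in> schwartz_space"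
  unfolding sub_laplacian_eq by (intro schwartz_cmult schwartz_add hderiv_schwartz)

lemma sub_laplacian_add:
  assumes "f \<in> schwartz_space" "g \<in> schwartz_space"
  shows "sub_laplacian (\<lambda>p. f p + g p) = (\<lambda>p. sub_laplacian f p + sub_laplacian g p)"
  using assms by (simp add: sub_laplacian_eq schwartz_add hderiv_add hderiv_schwartz algebra_simps)

lemma sub_laplacian_cmult:
  assumes "f \<in> schwartz_space"
  shows "sub_laplacian (\<lambda>p. c * f p) = (\<lambda>p. c * sub_laplacian f p)"
  using assms by (simp add: sub_laplacian_eq schwartz_cmult hderiv_cmult hderiv_schwartz algebra_simps)

lemma sub_laplacian_haff:
  assumes f: "f \<in> schwartz_space" and rs: "r \<noteq> 0" "s \<noteq> 0"
    and B: "\<And>a b p. haff_linear r s \<alpha> \<beta> (hvec 1 a b p) = k *\<^sub>R hvec 1 a b (haff r s \<alpha> \<beta> c p)"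
  shows "sub_laplacian (\<lambda>p. f (haff r s \<alpha> \<beta> c p)) = (\<lambda>p. complex_of_real (k\<^sup>2) * sub_laplacian f (haff r s \<alpha> \<beta> c p))"
proof -
  have 2: "hderiv 1 a b (hderiv 1 a b (\<lambda>p. f (haff r s \<alpha> \<beta> c p)))
      = (\<lambda>p. complex_of_real (k\<^sup>2) * hderiv 1 a b (hderiv 1 a b f) (haff r s \<alpha> \<beta> c p))" for a b
    using f rs
    by (simp add: hderiv_haff[OF _ B] hderiv_cmult schwartz_haff hderiv_schwartz power2_eq_square mult.assoc)
  show ?thesis using f rs by (simp add: sub_laplacian_eq schwartz_haff 2 algebra_simps)
qed


section \<open>Translations, dilations and Gaussians\<close>

text \<open>The group product, presented as an affine map of the right factor so that the results on
  \<open>haff\<close> apply to left translations. The inverse of p is -p.\<close>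

definition hmult :: "heisenberg \<Rightarrow> heisenberg \<Rightarrow> heisenberg" where
  "hmult p = haff 1 1 (- (2 * fst (snd p))) (2 * fst p) p"

lemma hmult_eq: "hmult (x, y, t) (x', y', t') = (x + x', y + y', t + t' + 2 * (x * y' - y * x'))"
  by (simp add: hmult_def haff_def algebra_simps)

lemma hmult_minus_cancel: "hmult p (hmult (- p) q) = q" "hmult (- p) (hmult p q) = q"
  by (cases p, cases q, simp add: hmult_eq algebra_simps)+

lemma hmult_cancel_right: "hmult (hmult p q) (- q) = p" "hmult (- hmult p q) p = - q"
  by (cases p, cases q, simp add: hmult_eq algebra_simps)+

text \<open>Inversion exchanges the sides: (p exp(sV))^{-1} w = exp(-sV) (p^{-1} w). A right
  multiplication of p thus becomes a left multiplication, which is the flow with \<sigma> = -1 and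
  reversed direction.\<close>

lemma hmult_hflow: "hmult (- hflow 1 a b s p) w = hflow (-1) (-a) (-b) s (hmult (- p) w)"
  by (cases p, cases w) (simp add: hmult_eq hflow_def hvec_def algebra_simps)

text \<open>Left invariance in the shape of assumption B of \<open>hderiv_haff\<close>, with the
  factor k = 1 written out.\<close>

lemma hmult_hvec:
  "haff_linear 1 1 (- (2 * fst (snd p))) (2 * fst p) (hvec 1 a b q)
    = 1 *\<^sub>R hvec 1 a b (haff 1 1 (- (2 * fst (snd p))) (2 * fst p) p q)"
  by (cases p, cases q) (simp add: hvec_def haff_def haff_linear_def algebra_simps)

lemma schwartz_hmult: "f \<in> schwartz_space \<Longrightarrow> (\<lambda>q. f (hmult p q)) \<in> schwartz_space"
  unfolding hmult_def by (rule schwartz_haff) auto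

lemma sub_laplacian_hmult:
  "f \<in> schwartz_space \<Longrightarrow> sub_laplacian (\<lambda>q. f (hmult p q)) = (\<lambda>q. sub_laplacian f (hmult p q))"
  unfolding hmult_def by (subst sub_laplacian_haff[OF _ _ _ hmult_hvec]) auto

text \<open>The only nonlinear part of the product is the bilinear term 2 (x y' - y x'). Applied to
  p and \<open>hmult (- p) w\<close>, the estimate lets kernel decay be converted into decay in
  w.\<close>

lemma hmult_norm: "1 + norm (hmult p q) \<le> 4 * ((1 + norm p) * (1 + norm q))"
proof -
  obtain x y t x' y' t' where pq: "p = (x, y, t)" "q = (x', y', t')" by (cases p, cases q)
  have "\<bar>x * y' - y * x'\<bar> \<le> \<bar>x\<bar> * \<bar>y'\<bar> + \<bar>y\<bar> * \<bar>x'\<bar>" by (metis abs_mult abs_triangle_ineq4)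
  also have "\<dots> \<le> norm p * norm q + norm p * norm q"
    unfolding pq by (intro add_mono mult_mono heis_norm_bounds) auto
  finally have e: "\<bar>x * y' - y * x'\<bar> \<le> 2 * (norm p * norm q)" by simp
  define z where "z = x * y' - y * x'"
  have "hmult p q = (p + q) + (0, 0, 2 * z)" by (simp add: pq hmult_eq z_def)
  then have "norm (hmult p q) \<le> norm (p + q) + norm (0::real, 0::real, 2 * z)"
    by (metis norm_triangle_ineq)
  also have "\<dots> \<le> norm p + norm q + 2 * \<bar>z\<bar>"
    using norm_triangle_ineq[of p q] heis_norm_bounds(4)[of 0 0 "2 * z"] by (simp add: abs_mult)
  finally have "norm (hmult p q) \<le> norm p + norm q + 4 * (norm p * norm q)" using e by (simp add: z_def)
  then show ?thesis using norm_ge_zero[of p] norm_ge_zero[of q] by (simp add: algebra_simps del: norm_ge_zero)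
qed

lemma continuous_on_hmult [continuous_intros]:
  "continuous_on S f \<Longrightarrow> continuous_on S g \<Longrightarrow> continuous_on S (\<lambda>x. hmult (f x) (g x))"
  unfolding hmult_def haff_def case_prod_beta by (intro continuous_intros)

section \<open>Parabolic dilations\<close>

definition hdil :: "real \<Rightarrow> heisenberg \<Rightarrow> heisenberg" where
  "hdil r = haff r (r\<^sup>2) 0 0 0"

lemma hdil_eq: "hdil r (x, y, t) = (r * x, r * y, r\<^sup>2 * t)"
  by (simp add: hdil_def haff_def zero_prod_def)

lemma continuous_on_hdil [continuous_intros]:
  "continuous_on S f \<Longrightarrow> continuous_on S (\<lambda>x. hdil r (f x))"
  unfolding hdil_def haff_def case_prod_beta by (intro continuous_intros)

text \<open>Horizontal fields are homogeneous of degree one because t scales quadratically; this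
  holds for either sign of \<sigma>, so left and right sub-Laplacians scale alike.\<close>

lemma hdil_hvec: "haff_linear r (r\<^sup>2) 0 0 (hvec \<sigma> a b q) = r *\<^sub>R hvec \<sigma> a b (haff r (r\<^sup>2) 0 0 0 q)"
  by (cases q) (simp add: hvec_def haff_def haff_linear_def zero_prod_def algebra_simps power2_eq_square)

lemma schwartz_hdil: "f \<in> schwartz_space \<Longrightarrow> r \<noteq> 0 \<Longrightarrow> (\<lambda>q. f (hdil r q)) \<in> schwartz_space"
  unfolding hdil_def by (rule schwartz_haff) auto

lemma hderiv_hdil:
  "f \<in> schwartz_space \<Longrightarrow> hderiv \<sigma> a b (\<lambda>q. f (hdil r q)) = (\<lambda>q. complex_of_real r * hderiv \<sigma> a b f (hdil r q))"
  unfolding hdil_def by (rule hderiv_haff[OF _ hdil_hvec])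

lemma sub_laplacian_hdil:
  "f \<in> schwartz_space \<Longrightarrow> r \<noteq> 0 \<Longrightarrow>
    sub_laplacian (\<lambda>q. f (hdil r q)) = (\<lambda>q. complex_of_real (r\<^sup>2) * sub_laplacian f (hdil r q))"
  unfolding hdil_def by (rule sub_laplacian_haff[OF _ _ _ hdil_hvec]) auto

lemma hdil_inverse: "r \<noteq> 0 \<Longrightarrow> hdil r (hdil (1 / r) q) = q"
  by (cases q) (simp add: hdil_eq power_divide)

lemma hdil_minus: "hdil r (- q) = - hdil r q"
  by (cases q) (simp add: hdil_eq)

lemma norm_hdil_le:
  assumes "0 \<le> r" "r \<le> 1" shows "norm (hdil r q) \<le> norm q"
proof -
  obtain x y t where q: "q = (x, y, t)" by (cases q)
  have r2: "r\<^sup>2 \<le> 1" "r\<^sup>2 * r\<^sup>2 \<le> 1" using assms by (auto simp: power_le_one mult_le_one)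
  have "(r * x)\<^sup>2 \<le> x\<^sup>2" "(r * y)\<^sup>2 \<le> y\<^sup>2" "(r\<^sup>2 * t)\<^sup>2 \<le> t\<^sup>2"
    using mult_right_mono[OF r2(1), of "x\<^sup>2"] mult_right_mono[OF r2(1), of "y\<^sup>2"] mult_right_mono[OF r2(2), of "t\<^sup>2"]
    by (auto simp: power_mult_distrib power2_eq_square[of "r\<^sup>2"])
  then show ?thesis by (simp add: q hdil_eq norm_Pair)
qed

text \<open>Covers two uses by one computation: \<alpha> = \<beta> = 1, \<eta> = 0 is the plain
  Gaussian, and \<alpha> = \<eta>, \<beta> = \<delta>^2 is the cut-off plane wave.\<close>

definition wave :: "real \<Rightarrow> real \<Rightarrow> real \<Rightarrow> heisenberg \<Rightarrow> complex" where
  "wave \<alpha> \<beta> \<eta> = (\<lambda>(x, y, t). exp (of_real (- (\<alpha> * (x\<^sup>2 + y\<^sup>2)) - \<beta> * t\<^sup>2) + \<i> * of_real (\<eta> * t)))"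

text \<open>For an exponential exp E, one derivative along V multiplies by Q = VE, and a second one
  gives the factor Q^2 + VQ.\<close>

lemma hderiv2_wave:
  "hderiv \<sigma> a b (hderiv \<sigma> a b (wave \<alpha> \<beta> \<eta>)) (x, y, t)
    = ((of_real (- 2 * \<alpha> * (a * x + b * y) - 4 * \<sigma> * \<beta> * t * (b * x - a * y)) + \<i> * of_real (2 * \<sigma> * \<eta> * (b * x - a * y)))\<^sup>2
      + of_real (- 2 * \<alpha> * (a\<^sup>2 + b\<^sup>2) - 8 * \<sigma>\<^sup>2 * \<beta> * (b * x - a * y)\<^sup>2)) * wave \<alpha> \<beta> \<eta> (x, y, t)"
proof -
  define D :: "heisenberg \<Rightarrow> heisenberg \<Rightarrow> complex"
    where "D p u = of_real (- 2 * \<alpha> * (fst p * fst u + fst (snd p) * fst (snd u))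
      - 2 * \<beta> * snd (snd p) * snd (snd u)) + \<i> * of_real (\<eta> * snd (snd u))" for p u
  define E :: "heisenberg \<Rightarrow> complex"
    where "E p = of_real (- (\<alpha> * ((fst p)\<^sup>2 + (fst (snd p))\<^sup>2)) - \<beta> * (snd (snd p))\<^sup>2) + \<i> * of_real (\<eta> * snd (snd p))" for p
  have w: "wave \<alpha> \<beta> \<eta> = (\<lambda>p. exp (E p))" by (auto simp: fun_eq_iff wave_def E_def)
  have q: "(E has_derivative D p) (at p)" for p
    unfolding E_def D_def by (auto intro!: derivative_eq_intros simp: algebra_simps)
  have Dw: "(wave \<alpha> \<beta> \<eta> has_derivative (\<lambda>u. D p u * wave \<alpha> \<beta> \<eta> p)) (at p)" for p
    unfolding w using has_derivative_compose[OF q has_field_derivative_imp_has_derivative[OF DERIV_exp]]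
    by (simp add: mult.commute)
  define Q where "Q p = D p (hvec \<sigma> a b p)" for p
  have h1: "hderiv \<sigma> a b (wave \<alpha> \<beta> \<eta>) = (\<lambda>p. Q p * wave \<alpha> \<beta> \<eta> p)"
    unfolding hderiv_def dirderiv_eq[OF Dw] Q_def ..
  define Q' :: "heisenberg \<Rightarrow> heisenberg \<Rightarrow> complex"
    where "Q' p u = of_real (- 2 * \<alpha> * (fst u * a + fst (snd u) * b)
      - 4 * \<sigma> * \<beta> * (snd (snd u) * (b * fst p - a * fst (snd p)) + snd (snd p) * (b * fst u - a * fst (snd u))))
      + \<i> * of_real (2 * \<sigma> * \<eta> * (b * fst u - a * fst (snd u)))" for p u
  have Qe: "Q = (\<lambda>p. of_real (- 2 * \<alpha> * (fst p * a + fst (snd p) * b)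
    - 4 * \<sigma> * \<beta> * (snd (snd p) * (b * fst p - a * fst (snd p)))) + \<i> * of_real (2 * \<sigma> * \<eta> * (b * fst p - a * fst (snd p))))"
    by (auto simp: Q_def D_def hvec_def fun_eq_iff algebra_simps)
  have "(Q has_derivative Q' p) (at p)" for p
    unfolding Qe Q'_def by (auto intro!: derivative_eq_intros simp: algebra_simps)
  from has_derivative_mult[OF this Dw]
  have "hderiv \<sigma> a b (\<lambda>p. Q p * wave \<alpha> \<beta> \<eta> p)
    = (\<lambda>p. Q p * (D p (hvec \<sigma> a b p) * wave \<alpha> \<beta> \<eta> p) + Q' p (hvec \<sigma> a b p) * wave \<alpha> \<beta> \<eta> p)"
    unfolding hderiv_def by (subst dirderiv_eq) auto
  then have "hderiv \<sigma> a b (hderiv \<sigma> a b (wave \<alpha> \<beta> \<eta>)) (x, y, t)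
    = ((Q (x, y, t))\<^sup>2 + Q' (x, y, t) (hvec \<sigma> a b (x, y, t))) * wave \<alpha> \<beta> \<eta> (x, y, t)"
    unfolding h1 Q_def[symmetric] by (simp add: Q_def algebra_simps power2_eq_square)
  also have "Q (x, y, t) = of_real (- 2 * \<alpha> * (a * x + b * y) - 4 * \<sigma> * \<beta> * t * (b * x - a * y)) + \<i> * of_real (2 * \<sigma> * \<eta> * (b * x - a * y))"
    by (simp add: Qe algebra_simps)
  also have "Q' (x, y, t) (hvec \<sigma> a b (x, y, t)) = of_real (- 2 * \<alpha> * (a\<^sup>2 + b\<^sup>2) - 8 * \<sigma>\<^sup>2 * \<beta> * (b * x - a * y)\<^sup>2)"
    by (simp add: Q'_def hvec_def algebra_simps power2_eq_square)
  finally show ?thesis .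
qed

lemma gauss_0_eq_wave: "gauss 0 = wave 1 1 0"
  by (rule ext) (auto simp: gauss_def wave_def inner_prod_def power2_eq_square algebra_simps)

text \<open>The directions are reversed to match \<open>hmult_hflow\<close>; the signs cancel in the
  squares.\<close>

definition right_laplacian :: "(heisenberg \<Rightarrow> complex) \<Rightarrow> heisenberg \<Rightarrow> complex" where
  "right_laplacian f p = - (hderiv (-1) (-1) 0 (hderiv (-1) (-1) 0 f) p + hderiv (-1) 0 (-1) (hderiv (-1) 0 (-1) f) p)"

text \<open>The left operator minus the right one is -8 \<partial>_t (x \<partial>_y - y
  \<partial>_x). The rotation field annihilates every function that depends on z through |z|
  alone.\<close>

lemma right_laplacian_gauss: "right_laplacian (gauss 0) p = sub_laplacian (gauss 0) p"
  unfolding sub_laplacian_eq[OF gauss_schwartz] right_laplacian_def unfolding gauss_0_eq_wave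
  by (cases p) (simp only: hderiv2_wave, simp add: algebra_simps power2_eq_square)

lemma right_laplacian_gauss_hdil:
  assumes r: "r \<noteq> 0"
  shows "right_laplacian (\<lambda>q. gauss 0 (hdil r q)) p = sub_laplacian (\<lambda>q. gauss 0 (hdil r q)) p"
proof -
  have 2: "hderiv \<sigma> a b (hderiv \<sigma> a b (\<lambda>q. gauss 0 (hdil r q))) p
      = of_real (r\<^sup>2) * hderiv \<sigma> a b (hderiv \<sigma> a b (gauss 0)) (hdil r p)" for \<sigma> a b
    using r by (simp add: hderiv_hdil gauss_schwartz hderiv_schwartz hderiv_cmult schwartz_hdil power2_eq_square)
  have "right_laplacian (\<lambda>q. gauss 0 (hdil r q)) p = of_real (r\<^sup>2) * right_laplacian (gauss 0) (hdil r p)"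
    unfolding right_laplacian_def 2 by (simp add: algebra_simps)
  then show ?thesis by (simp only: right_laplacian_gauss sub_laplacian_hdil[OF gauss_schwartz r])
qed


section \<open>The maximum principle\<close>

text \<open>Applied to restrictions to flow lines: differentiating a pairing twice along a flow
  provides exactly this regularity.\<close>

definition has_second_derivative :: "(real \<Rightarrow> real) \<Rightarrow> real \<Rightarrow> bool" where
  "has_second_derivative f D \<longleftrightarrow>
    (\<exists>f'. (\<forall>s. (f has_real_derivative f' s) (at s)) \<and> (f' has_real_derivative D) (at 0))"

lemma second_derivative_at_maximum:
  assumes "has_second_derivative f D" and max: "\<And>s. f s \<le> f 0"
  shows "D \<le> 0"
proof (rule ccontr)
  assume "\<not> D \<le> 0"
  obtain f' where f: "\<And>s. (f has_real_derivative f' s) (at s)" and f': "(f' has_real_derivative D) (at 0)"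
    using assms(1) by (auto simp: has_second_derivative_def)
  have "f' 0 = 0" by (rule DERIV_local_max[OF f, of 1]) (use max in auto)
  obtain d where d: "0 < d" and inc: "\<And>h. 0 < h \<Longrightarrow> h < d \<Longrightarrow> f' 0 < f' (0 + h)"
    using DERIV_pos_inc_right[OF f'] \<open>\<not> D \<le> 0\<close> by (metis not_le)
  have "\<exists>z>0. z < d / 2 \<and> f (d / 2) - f 0 = (d / 2 - 0) * f' z"
    using MVT2[of 0 "d / 2" f f'] d f by auto
  then obtain z where z: "0 < z" "z < d / 2" "f (d / 2) - f 0 = d / 2 * f' z" by auto
  then have "0 < f' z" using inc[of z] d \<open>f' 0 = 0\<close> by auto
  then have "f 0 < f (d / 2)" using z d by (smt (verit) mult_pos_pos half_gt_zero)
  then show False using max[of "d / 2"] by simp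
qed

text \<open>A shifted homogeneous gauge t^2 + |z|^4. Here (X^2 + Y^2) \<open>barrier\<close> is 24
  |z|^2, and the constant 144 = 12^2 makes this at most \<open>barrier\<close> by completing the
  square, so it is a supersolution for X^2 + Y^2 - 1.\<close>

definition barrier :: "heisenberg \<Rightarrow> real" where
  "barrier = (\<lambda>(x, y, t). t\<^sup>2 + (x\<^sup>2 + y\<^sup>2)\<^sup>2 + 144)"

lemma barrier_hflow:
  "has_second_derivative (\<lambda>s. barrier (hflow 1 1 0 s (x, y, t))) (12 * (x\<^sup>2 + y\<^sup>2))" (is ?X)
  "has_second_derivative (\<lambda>s. barrier (hflow 1 0 1 s (x, y, t))) (12 * (x\<^sup>2 + y\<^sup>2))" (is ?Y)
proof -
  let ?bx = "\<lambda>s. 2 * (t - 2 * s * y) * (- 2 * y) + 2 * ((x + s)\<^sup>2 + y\<^sup>2) * (2 * (x + s))"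
  let ?by = "\<lambda>s. 2 * (t + 2 * s * x) * (2 * x) + 2 * (x\<^sup>2 + (y + s)\<^sup>2) * (2 * (y + s))"
  note defs = barrier_def hflow_def hvec_def
  show ?X
    unfolding has_second_derivative_def
  proof (intro exI conjI allI)
    show "((\<lambda>s. barrier (hflow 1 1 0 s (x, y, t))) has_real_derivative ?bx s) (at s)" for s
      unfolding defs by (auto intro!: derivative_eq_intros simp: algebra_simps)
    show "(?bx has_real_derivative 12 * (x\<^sup>2 + y\<^sup>2)) (at 0)"
      by (auto intro!: derivative_eq_intros simp: power2_eq_square algebra_simps)
  qed
  show ?Y
    unfolding has_second_derivative_def
  proof (intro exI conjI allI)
    show "((\<lambda>s. barrier (hflow 1 0 1 s (x, y, t))) has_real_derivative ?by s) (at s)" for s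
      unfolding defs by (auto intro!: derivative_eq_intros simp: algebra_simps)
    show "(?by has_real_derivative 12 * (x\<^sup>2 + y\<^sup>2)) (at 0)"
      by (auto intro!: derivative_eq_intros simp: power2_eq_square algebra_simps)
  qed
qed

lemma has_second_derivative_diff_cmult:
  assumes "has_second_derivative f A" "has_second_derivative g B"
  shows "has_second_derivative (\<lambda>s. f s - e * g s) (A - e * B)"
proof -
  obtain f' g' where "\<And>s. (f has_real_derivative f' s) (at s)" "(f' has_real_derivative A) (at 0)"
    "\<And>s. (g has_real_derivative g' s) (at s)" "(g' has_real_derivative B) (at 0)"
    using assms by (auto simp: has_second_derivative_def)
  then show ?thesis
    unfolding has_second_derivative_def
    by (intro exI[of _ "\<lambda>s. f' s - e * g' s"] conjI allI DERIV_diff DERIV_cmult) auto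
qed

lemma barrier_ge:
  "norm p \<le> 3 * barrier p" "144 \<le> barrier p" "24 * ((fst p)\<^sup>2 + (fst (snd p))\<^sup>2) \<le> barrier p"
proof -
  obtain x y t where p: "p = (x, y, t)" by (cases p)
  define R where "R = x\<^sup>2 + y\<^sup>2"
  have b: "barrier p = t\<^sup>2 + R\<^sup>2 + 144" by (simp add: p barrier_def R_def)
  have "0 \<le> (R - 12)\<^sup>2" by simp
  then have "24 * R \<le> R\<^sup>2 + 144" by (simp add: power2_eq_square algebra_simps)
  have "(fst p)\<^sup>2 + (fst (snd p))\<^sup>2 = R" by (simp add: p R_def)
  moreover have "R\<^sup>2 + 144 \<le> barrier p" by (simp add: b)
  ultimately show "24 * ((fst p)\<^sup>2 + (fst (snd p))\<^sup>2) \<le> barrier p"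
    using \<open>24 * R \<le> R\<^sup>2 + 144\<close> by simp
  show "144 \<le> barrier p" by (simp add: b)
  have a: "\<bar>u\<bar> \<le> u\<^sup>2 + 1" for u :: real
    using zero_le_power2[of "\<bar>u\<bar> - 1"] zero_le_power2[of u] by (simp add: power2_eq_square algebra_simps abs_mult_self_eq)
  have "norm p \<le> (x\<^sup>2 + 1) + (y\<^sup>2 + 1) + (t\<^sup>2 + 1)"
    using heis_norm_bounds(4)[of x y t] a[of x] a[of y] a[of t] by (simp add: p)
  also have "\<dots> = R + t\<^sup>2 + 3" by (simp add: R_def)
  also have "\<dots> \<le> 3 * barrier p"
    using \<open>24 * R \<le> R\<^sup>2 + 144\<close> zero_le_power2[of t] zero_le_power2[of R] unfolding b by argo
  finally show "norm p \<le> 3 * barrier p" .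
qed

text \<open>Subtracting a small multiple of the barrier from a bounded subsolution forces the
  maximum to be attained. There both second derivatives are nonpositive, so g is at most the
  multiple of (X^2 + Y^2) \<open>barrier\<close>, hence of \<open>barrier\<close>, and the maximum
  cannot be positive.\<close>

lemma maximum_principle:
  fixes g :: "heisenberg \<Rightarrow> real"
  assumes cont: "continuous_on UNIV g" and bdd: "\<And>p. g p \<le> M"
    and D: "\<And>p. \<exists>A B. has_second_derivative (\<lambda>s. g (hflow 1 1 0 s p)) A
      \<and> has_second_derivative (\<lambda>s. g (hflow 1 0 1 s p)) B \<and> g p \<le> A + B"
  shows "g p0 \<le> 0"
proof (rule ccontr)
  assume "\<not> g p0 \<le> 0"
  then have g0: "0 < g p0" by simp
  \<comment> \<open>Half of g p0 survives the subtraction, so u p0 stays positive.\<close>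
  define e where "e = g p0 / (2 * barrier p0)"
  have b0: "0 < barrier p" for p using barrier_ge(2)[of p] by linarith
  have e: "0 < e" using g0 b0 by (simp add: e_def)
  define u where "u p = g p - e * barrier p" for p
  have u0: "0 < u p0" using g0 b0[of p0] by (simp add: u_def e_def field_simps)
  have "continuous_on UNIV barrier" unfolding barrier_def case_prod_beta by (intro continuous_intros)
  then have uc: "continuous_on UNIV u" unfolding u_def by (intro continuous_intros cont)
  \<comment> \<open>Outside this ball e \<open>barrier\<close> exceeds |M|, because
    \<open>norm p\<close> is at most three times the barrier; there u is negative.\<close>
  define R where "R = max (norm p0) (3 * \<bar>M\<bar> / e)"
  have "\<exists>q\<in>cball 0 R. \<forall>p\<in>cball 0 R. u p \<le> u q"
    by (rule continuous_attains_sup) (auto simp: R_def intro: continuous_on_subset[OF uc] le_max_iff_disj[THEN iffD2])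
  then obtain q where q: "\<And>p. p \<in> cball 0 R \<Longrightarrow> u p \<le> u q" by blast
  have uq: "0 < u q" using q[of p0] u0 by (auto simp: R_def)
  have max: "u p \<le> u q" for p
  proof (cases "p \<in> cball 0 R")
    case False
    then have "3 * \<bar>M\<bar> / e < norm p" by (simp add: R_def)
    also have "\<dots> \<le> 3 * barrier p" by (rule barrier_ge)
    finally have "\<bar>M\<bar> < e * barrier p" using e by (simp add: field_simps)
    then have "u p < 0" using bdd[of p] by (simp add: u_def)
    then show ?thesis using uq by simp
  qed (rule q)
  obtain x y t where qq: "q = (x, y, t)" by (cases q)
  let ?R = "12 * (x\<^sup>2 + y\<^sup>2)"
  obtain A B where g: "has_second_derivative (\<lambda>s. g (hflow 1 1 0 s q)) A"
     "has_second_derivative (\<lambda>s. g (hflow 1 0 1 s q)) B" "g q \<le> A + B"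
    using D[of q] by blast
  have "A - e * ?R \<le> 0"
    using has_second_derivative_diff_cmult[OF g(1) barrier_hflow(1)[of x y t, folded qq], of e]
    by (rule second_derivative_at_maximum) (use max in \<open>simp add: u_def\<close>)
  moreover have "B - e * ?R \<le> 0"
    using has_second_derivative_diff_cmult[OF g(2) barrier_hflow(2)[of x y t, folded qq], of e]
    by (rule second_derivative_at_maximum) (use max in \<open>simp add: u_def\<close>)
  ultimately have "g q \<le> e * (24 * ((fst q)\<^sup>2 + (fst (snd q))\<^sup>2))"
    using g(3) by (simp add: qq algebra_simps)
  also have "\<dots> \<le> e * barrier q" using e by (intro mult_left_mono barrier_ge) auto
  finally show False using uq by (simp add: u_def)
qed

section \<open>Convolutions of a vector orthogonal to the range of L + 1\<close>

lemma cmod_integral_le_L2: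
  assumes "square_integrable f" "square_integrable g"
  shows "cmod (LINT p|lborel. f p * g p) \<le> L2_seminorm f * L2_seminorm g"
proof -
  have "cmod (LINT p|lborel. f p * g p) \<le> (LINT p|lborel. cmod (f p) * cmod (g p))"
    using integral_norm_bound[of lborel "\<lambda>p. f p * g p"] by (simp add: norm_mult)
  then show ?thesis using L2_Cauchy_Schwarz(2)[OF assms] by simp
qed

text \<open>All derivatives of G fall on the kernel k, so G is twice differentiable along flows
  although h is only square integrable. Radiality lets the right-invariant derivatives thus produced
  be read as L applied to a translate of k, where \<open>ortho\<close> applies.\<close>

lemma convolution_vanishes:
  assumes h: "square_integrable h"
    and ortho: "\<And>f. f \<in> schwartz_space \<Longrightarrow> (LINT w|lborel. h w * (sub_laplacian f w + f w)) = 0"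
    and k: "k \<in> schwartz_space"
    and radial: "\<And>p. right_laplacian k p = sub_laplacian k p"
  shows "(LINT w|lborel. h w * k (hmult (- p) w)) = 0"
proof -
  define G where "G p = (LINT w|lborel. h w * k (hmult (- p) w))" for p
  note sk = schwartz_square_integrable
  have hm [measurable]: "h \<in> borel_measurable borel" using h by (simp add: square_integrable_def)
  have km [measurable]: "f \<in> borel_measurable borel" if "f \<in> schwartz_space" for f :: "heisenberg \<Rightarrow> complex"
    using that by (rule schwartz_measurable)
  have hp: "square_integrable (\<lambda>u. h (hmult p u))" "L2_seminorm (\<lambda>u. h (hmult p u)) = L2_seminorm h" for p
    using square_integrable_haff[OF h, of 1 1 "- (2 * fst (snd p))" "2 * fst p" p] by (auto simp: hmult_def)
  have transl: "(LINT w|lborel. h w * f (hmult (- p) w)) = (LINT u|lborel. h (hmult p u) * f u)"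
    if f: "f \<in> schwartz_space" for f p
  proof -
    have [measurable]: "f \<in> borel_measurable borel" using f by (rule schwartz_measurable)
    have [measurable]: "hmult q \<in> borel_measurable borel" for q unfolding hmult_def by measurable
    have "(LINT w|lborel. h w * f (hmult (- p) w)) = (LINT u|lborel. h (hmult p u) * f (hmult (- p) (hmult p u)))"
      unfolding hmult_def[of p] by (subst integral_haff[where r=1 and s=1]) auto
    then show ?thesis by (simp add: hmult_minus_cancel)
  qed
  define P where "P f p = (LINT u|lborel. h (hmult p u) * f u)" for f p
  \<comment> \<open>After the substitution w = p u the translation sits on h, and flowing p amounts
    to flowing the argument of k inside a pairing with a fixed function.\<close>
  have Gflow: "G (hflow 1 a b s p) = P (\<lambda>u. k (hflow (-1) (-a) (-b) s u)) p" for a b s p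
  proof -
    have "(\<lambda>q. k (hflow (-1) (-a) (-b) s q)) \<in> schwartz_space"
      unfolding hflow_haff by (rule schwartz_haff[OF k]) auto
    from transl[OF this, of p] show ?thesis by (simp add: G_def P_def hmult_hflow)
  qed
  have flow: "((\<lambda>s. P (\<lambda>u. f (hflow (-1) a b s u)) p) has_vector_derivative
      P (\<lambda>u. hderiv (-1) a b f (hflow (-1) a b s u)) p) (at s)" if "f \<in> schwartz_space" for f a b s p
    unfolding P_def by (rule hflow_pairing[OF hp(1) that])
  define Z where "Z a b = hderiv (-1) (-a) (-b) (hderiv (-1) (-a) (-b) k)" for a b
  \<comment> \<open>This is X^2 G + Y^2 G = G: \<open>radial\<close> exchanges the right Laplacian
    for L, left invariance moves L onto the translated kernel, and \<open>ortho\<close> replaces -L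
    by the identity under the pairing.\<close>
  have eq: "P (Z 1 0) p + P (Z 0 1) p = G p" for p
  proof -
    have "P (Z 1 0) p + P (Z 0 1) p = (LINT u|lborel. h (hmult p u) * Z 1 0 u + h (hmult p u) * Z 0 1 u)"
      unfolding P_def Z_def by (intro Bochner_Integration.integral_add[symmetric] integrable_times_L2 hp sk hderiv_schwartz k)
    also have "Z 1 0 u + Z 0 1 u = - sub_laplacian k u" for u
      unfolding radial[of u, symmetric] right_laplacian_def Z_def by simp
    then have "(LINT u|lborel. h (hmult p u) * Z 1 0 u + h (hmult p u) * Z 0 1 u)
        = (LINT u|lborel. h (hmult p u) * (- sub_laplacian k u))"
      by (simp only: distrib_left[symmetric])
    also have "\<dots> = - (LINT u|lborel. h (hmult p u) * sub_laplacian k u)" by simp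
    also have "(LINT u|lborel. h (hmult p u) * sub_laplacian k u) = (LINT w|lborel. h w * sub_laplacian k (hmult (- p) w))"
      by (rule transl[symmetric]) (intro sub_laplacian_schwartz k)
    also have "- \<dots> = G p"
    proof -
      have s: "(\<lambda>w. k (hmult (- p) w)) \<in> schwartz_space" by (intro schwartz_hmult k)
      have "0 = (LINT w|lborel. h w * sub_laplacian k (hmult (- p) w) + h w * k (hmult (- p) w))"
        using ortho[OF s] by (simp add: sub_laplacian_hmult[OF k] distrib_left)
      also have "\<dots> = (LINT w|lborel. h w * sub_laplacian k (hmult (- p) w)) + G p"
        unfolding G_def
        by (intro Bochner_Integration.integral_add integrable_times_L2 h sk schwartz_hmult[OF sub_laplacian_schwartz] k s)
      finally show ?thesis by (metis minus_unique)
    qed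
    finally show ?thesis by simp
  qed
  have Gb: "cmod (G p) \<le> L2_seminorm h * L2_seminorm k" for p
    using cmod_integral_le_L2[OF hp(1) sk[OF k], of p] by (simp add: G_def transl[OF k] hp(2))
  have Gc: "continuous_on UNIV G"
  proof (rule continuous_at_imp_continuous_on, rule ballI)
    fix p0 :: heisenberg
    \<comment> \<open>The 4 is from \<open>hmult_norm\<close>, and 2 + \<open>norm p0\<close> bounds
      1 + \<open>norm p\<close> for p within distance 1 of p0.\<close>
    let ?K = "4 * (2 + norm p0)"
    have K: "0 < ?K" by (intro mult_pos_pos add_pos_nonneg) auto
    obtain C where C: "\<And>(p::heisenberg) q. 1 + norm p \<le> ?K * (1 + norm q) \<Longrightarrow> cmod (k q) \<le> C * decay p"
      using schwartz_decay_bound[OF k K] by blast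
    have "(G \<longlongrightarrow> G p0) (at p0)"
      unfolding G_def
    proof (rule pairing_tendsto[OF h _ _ _ zero_less_one])
      show "(\<lambda>w. k (hmult (- p) w)) \<in> borel_measurable borel" for p
        by (intro schwartz_measurable schwartz_hmult k)
      then show "(\<lambda>w. k (hmult (- p0) w)) \<in> borel_measurable borel" .
      show "((\<lambda>p. k (hmult (- p) w)) \<longlongrightarrow> k (hmult (- p0) w)) (at p0)" for w
      proof -
        have "continuous_on UNIV (\<lambda>p. k (hmult (- p) w))"
          by (intro continuous_on_schwartz_compose[OF k] continuous_intros)
        then show ?thesis unfolding continuous_on_def by blast
      qed
      fix p w assume "dist p p0 < 1"
      then have "norm p \<le> 1 + norm p0" using norm_triangle_ineq2[of p p0] by (simp add: dist_norm)
      then have "4 * ((1 + norm p) * (1 + norm (hmult (- p) w))) \<le> 4 * ((2 + norm p0) * (1 + norm (hmult (- p) w)))"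
        by (intro mult_left_mono mult_right_mono) auto
      with hmult_norm[of p "hmult (- p) w"] have "1 + norm w \<le> 4 * ((2 + norm p0) * (1 + norm (hmult (- p) w)))"
        unfolding hmult_minus_cancel by (rule order_trans)
      then have "1 + norm w \<le> ?K * (1 + norm (hmult (- p) w))" by (simp only: mult.assoc)
      then show "cmod (k (hmult (- p) w)) \<le> C * decay w" by (rule C)
    qed
    then show "isCont G p0" by (simp add: isCont_def)
  qed
  \<comment> \<open>The maximum principle is for real functions; the phases 1, -1, i and -i then pin
    down both the real and the imaginary part.\<close>
  have Re0: "Re (c * G p) \<le> 0" if c: "cmod c = 1" for c p
  proof (rule maximum_principle[where g = "\<lambda>p. Re (c * G p)" and M = "L2_seminorm h * L2_seminorm k"])
    show "continuous_on UNIV (\<lambda>p. Re (c * G p))" by (intro continuous_intros Gc)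
    show "Re (c * G p) \<le> L2_seminorm h * L2_seminorm k" for p
      using complex_Re_le_cmod[of "c * G p"] Gb[of p] c by (simp add: norm_mult)
    have bl: "bounded_linear (\<lambda>z. Re (c * z))"
      by (rule bounded_linear_compose[OF bounded_linear_Re bounded_linear_mult_right])
    fix p
    have "has_second_derivative (\<lambda>s. Re (c * G (hflow 1 a b s p))) (Re (c * P (Z a b) p))" for a b
      unfolding has_second_derivative_def Gflow Z_def has_real_derivative_iff_has_vector_derivative
      using bounded_linear.has_vector_derivative[OF bl flow[OF k]]
        bounded_linear.has_vector_derivative[OF bl flow[OF hderiv_schwartz[OF k], of "-1" "-a" "-b" "-a" "-b" p 0]]
      by (intro exI[of _ "\<lambda>s. Re (c * P (\<lambda>u. hderiv (-1) (-a) (-b) k (hflow (-1) (-a) (-b) s u)) p)"]) simp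
    moreover have "Re (c * G p) = Re (c * P (Z 1 0) p) + Re (c * P (Z 0 1) p)"
      by (subst eq[symmetric]) (simp only: distrib_left plus_complex.sel)
    ultimately show "\<exists>A B. has_second_derivative (\<lambda>s. Re (c * G (hflow 1 1 0 s p))) A
      \<and> has_second_derivative (\<lambda>s. Re (c * G (hflow 1 0 1 s p))) B \<and> Re (c * G p) \<le> A + B"
      by (metis order_refl)
  qed
  have "Re (G p) = 0" using Re0[of 1 p] Re0[of "-1" p] by simp
  moreover have "Im (G p) = 0" using Re0[of "\<i>" p] Re0[of "-\<i>" p] by simp
  ultimately show ?thesis by (simp add: complex_eq_iff G_def)
qed


section \<open>Gaussian translates are total\<close>

text \<open>In both uses u is the integration variable, while w is the argument of h. The factor at
  u pays for two powers of order N, one kept as \<open>decay u\<close> and one spent, together with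
  the factor at v, on producing \<open>decay w\<close>.\<close>

lemma gauss_decay:
  obtains C where "0 \<le> C" "\<And>(u::heisenberg) (v::heisenberg) (w::heisenberg). 1 + norm w \<le> 4 * ((1 + norm u) * (1 + norm v)) \<Longrightarrow>
    cmod (gauss 0 u) * cmod (gauss 0 v) \<le> C * (decay u * decay w)"
proof -
  define N where "N = 2 * DIM(heisenberg)"
  obtain A where A: "0 \<le> A" "\<And>x::heisenberg. (1 + norm x) ^ (N + N) * cmod (gauss 0 x) \<le> A"
    using rapidly_decreasing_one_plus[OF rapidly_decreasing_gauss, of "N + N"] by blast
  obtain B where B: "0 \<le> B" "\<And>x::heisenberg. (1 + norm x) ^ N * cmod (gauss 0 x) \<le> B"
    using rapidly_decreasing_one_plus[OF rapidly_decreasing_gauss, of N] by blast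
  have "cmod (gauss 0 u) * cmod (gauss 0 v) \<le> (4 ^ N * A * B) * (decay u * decay w)"
    if le: "1 + norm w \<le> 4 * ((1 + norm u) * (1 + norm v))" for u v w :: heisenberg
  proof -
    have p: "0 < (1 + norm z) ^ N" for z :: heisenberg by (intro zero_less_power add_pos_nonneg) auto
    have "(1 + norm u) ^ N * (1 + norm w) ^ N * (cmod (gauss 0 u) * cmod (gauss 0 v))
        \<le> (1 + norm u) ^ N * (4 * ((1 + norm u) * (1 + norm v))) ^ N * (cmod (gauss 0 u) * cmod (gauss 0 v))"
      by (intro mult_right_mono mult_left_mono power_mono le) auto
    also have "\<dots> = 4 ^ N * ((1 + norm u) ^ (N + N) * cmod (gauss 0 u)) * ((1 + norm v) ^ N * cmod (gauss 0 v))"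
      by (simp only: power_mult_distrib power_add mult_ac)
    also have "\<dots> \<le> 4 ^ N * A * B"
      using A(1) by (intro mult_mono mult_left_mono A B) auto
    finally have "cmod (gauss 0 u) * cmod (gauss 0 v) \<le> (4 ^ N * A * B) / ((1 + norm u) ^ N * (1 + norm w) ^ N)"
      using p[of u] p[of w] by (simp add: pos_le_divide_eq mult_ac)
    then show ?thesis by (simp add: decay_def N_def)
  qed
  moreover have "0 \<le> 4 ^ N * A * B" using A(1) B(1) by simp
  ultimately show ?thesis using that by blast
qed

lemma integral_gauss_pos: "(LINT u|lborel. gauss 0 (u::heisenberg)) \<noteq> 0"
proof
  have i: "integrable lborel (\<lambda>u::heisenberg. exp (- (norm u)\<^sup>2))"
  proof -
    obtain C where C: "\<And>x::heisenberg. cmod (gauss 0 x) \<le> C * decay x"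
      using schwartz_decay_bound'[OF gauss_schwartz] by blast
    show ?thesis
      by (rule Bochner_Integration.integrable_bound[OF integrable_mult_right[OF integrable_decay, of C]])
        (use order_trans[OF C[unfolded cmod_gauss] abs_ge_self] in \<open>simp_all add: AE_I2\<close>)
  qed
  have g: "gauss 0 u = complex_of_real (exp (- (norm u)\<^sup>2))" for u :: heisenberg
    by (simp add: gauss_def power2_norm_eq_inner flip: exp_of_real)
  assume "(LINT u|lborel. gauss 0 (u::heisenberg)) = 0"
  then have "(LINT u|lborel. exp (- (norm (u::heisenberg))\<^sup>2)) = 0" by (simp add: g)
  then have "AE u in lborel. exp (- (norm (u::heisenberg))\<^sup>2) = 0"
    using integral_nonneg_eq_0_iff_AE[OF i] by simp
  then have "AE u::heisenberg in lborel. False" by simp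
  then show False by (simp add: eventually_False ae_filter_eq_bot_iff emeasure_lborel_UNIV)
qed

lemma integrable_product_lborel:
  fixes a b :: "heisenberg \<Rightarrow> real"
  assumes "integrable lborel a" "integrable lborel b"
  shows "integrable (lborel \<Otimes>\<^sub>M lborel) (\<lambda>(p, w). a p * b w)"
proof (rule lborel_pair.Fubini_integrable)
  have [measurable]: "a \<in> borel_measurable borel" "b \<in> borel_measurable borel" using assms by auto
  show "(\<lambda>(p, w). a p * b w) \<in> borel_measurable (lborel \<Otimes>\<^sub>M lborel)" by measurable
  show "integrable lborel (\<lambda>x. LINT y|lborel. norm (case (x, y) of (p, w) \<Rightarrow> a p * b w))"
    using assms by (simp add: abs_mult)
  show "AE x in lborel. integrable lborel (\<lambda>y. case (x, y) of (p, w) \<Rightarrow> a p * b w)"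
    using assms by simp
qed

lemma continuous_pair_measurable:
  fixes f :: "heisenberg \<Rightarrow> heisenberg \<Rightarrow> complex"
  assumes "continuous_on UNIV (\<lambda>(p, w). f p w)"
  shows "(\<lambda>(p, w). f p w) \<in> borel_measurable (borel \<Otimes>\<^sub>M borel)"
  using borel_measurable_continuous_onI[OF assms] by (simp add: borel_prod)

text \<open>The kernels \<open>n\<^sup>4 gauss 0 \<circ> hdil n\<close> are an approximate identity for convolution.\<close>

lemma continuous_test_vanishes:
  fixes e :: "heisenberg \<Rightarrow> complex"
  assumes h: "square_integrable h"
    and zero: "\<And>p r. 1 \<le> r \<Longrightarrow> (LINT w|lborel. h w * gauss 0 (hdil r (hmult (- p) w))) = 0"
    and ec: "continuous_on UNIV e" and eb: "\<And>p. cmod (e p) \<le> 1"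
  shows "(LINT w|lborel. h w * (e w * gauss 0 w)) = 0"
proof -
  obtain C where C0: "0 \<le> C" and C: "\<And>(u::heisenberg) (v::heisenberg) (w::heisenberg). 1 + norm w \<le> 4 * ((1 + norm u) * (1 + norm v)) \<Longrightarrow>
    cmod (gauss 0 u) * cmod (gauss 0 v) \<le> C * (decay u * decay w)"
    using gauss_decay by blast
  define f where "f p = e p * gauss 0 p" for p
  have fg: "cmod (f p) \<le> cmod (gauss 0 p)" for p
    using mult_right_mono[OF eb[of p], of "cmod (gauss 0 p)"] by (simp add: f_def norm_mult)
  have gc: "continuous_on UNIV (gauss 0 :: heisenberg \<Rightarrow> complex)" by (rule schwartz_continuous[OF gauss_schwartz])
  have fc: "continuous_on UNIV f" unfolding f_def by (intro continuous_intros ec gc)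
  have hm [measurable]: "h \<in> borel_measurable borel" using h by (simp add: square_integrable_def)
  have [measurable]: "f \<in> borel_measurable borel" "(gauss 0 :: heisenberg \<Rightarrow> complex) \<in> borel_measurable borel"
    using fc gc by (auto intro: borel_measurable_continuous_onI)
  have hd: "integrable lborel (\<lambda>w. cmod (h w) * decay w)" by (rule square_integrable_mult_decay[OF h])
  \<comment> \<open>By p = w \<open>hdil (1 / r) u\<close> this is r^4 times the integral of f p
    against the kernel dilated by r; in this form the limit r \<rightarrow> \<infinity> is pointwise
    in u under a fixed majorant.\<close>
  define F where "F r w = (LINT u|lborel. f (hmult w (hdil (1 / r) u)) * gauss 0 u)" for r w
  have Fb: "cmod (f (hmult w (hdil (1 / r) u)) * gauss 0 u) \<le> (C * decay w) * decay u" if r: "1 \<le> r" for r w u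
  proof -
    let ?q = "hdil (1 / r) u"
    have "1 + norm w \<le> 4 * ((1 + norm (hmult w ?q)) * (1 + norm ?q))"
      using hmult_norm[of "hmult w ?q" "- ?q"] by (simp add: hmult_cancel_right)
    also have "\<dots> \<le> 4 * ((1 + norm (hmult w ?q)) * (1 + norm u))"
      using norm_hdil_le[of "1 / r" u] r by (intro mult_left_mono) auto
    finally have "cmod (gauss 0 u) * cmod (gauss 0 (hmult w ?q)) \<le> C * (decay u * decay w)"
      by (intro C) (simp add: mult.commute)
    then have "cmod (f (hmult w ?q)) * cmod (gauss 0 u) \<le> C * (decay u * decay w)"
      by (rule order_trans[rotated]) (simp add: mult.commute mult_left_mono fg)
    then show ?thesis by (simp add: norm_mult mult_ac)
  qed
  note fcomp = continuous_on_compose2[OF fc _ subset_UNIV] and gcomp = continuous_on_schwartz_compose[OF gauss_schwartz]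
  have cont3: "continuous_on UNIV (\<lambda>(w, u). f (hmult w (hdil (1 / r) u)) * gauss 0 u)" for r
    unfolding case_prod_beta by (intro continuous_intros fcomp gcomp)
  have Fm [measurable]: "F r \<in> borel_measurable borel" for r
    unfolding F_def
    using sigma_finite_measure.borel_measurable_lebesgue_integral[OF sigma_finite_lborel, of "\<lambda>w u. f (hmult w (hdil (1 / r) u)) * gauss 0 u" borel]
      continuous_pair_measurable[OF cont3, of r] by simp
  have FC: "cmod (F r w) \<le> (C * (LINT u|lborel. decay (u::heisenberg))) * decay w" if r: "1 \<le> r" for r w
  proof -
    have "cmod (F r w) \<le> (LINT u|lborel. cmod (f (hmult w (hdil (1 / r) u)) * gauss 0 u))"
      unfolding F_def by (rule integral_norm_bound)
    also have "\<dots> \<le> (LINT u|lborel. (C * decay w) * decay (u::heisenberg))"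
    proof (rule integral_mono')
      show "integrable lborel (\<lambda>u::heisenberg. (C * decay w) * decay u)" by (intro integrable_mult_right integrable_decay)
    qed (use Fb[OF r] C0 in \<open>auto simp: decay_nonneg\<close>)
    finally show ?thesis by (simp add: mult_ac)
  qed
  \<comment> \<open>By Fubini, integrating over w first leaves the pairings of h with translated
    kernels, which vanish by \<open>zero\<close>.\<close>
  have hF: "(LINT w|lborel. h w * F r w) = 0" if r: "1 \<le> r" for r
  proof -
    have r0: "r \<noteq> 0" using r by simp
    define k where "k p w = f p * (h w * gauss 0 (hdil r (hmult (- p) w)))" for p w
    have "continuous_on UNIV (\<lambda>(p, w). f p * gauss 0 (hdil r (hmult (- p) w)))"
      unfolding case_prod_beta by (intro continuous_intros fcomp gcomp)
    from continuous_pair_measurable[OF this]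
    have m1: "(\<lambda>(p, w). f p * gauss 0 (hdil r (hmult (- p) w))) \<in> borel_measurable (borel \<Otimes>\<^sub>M borel)" .
    have m2: "(\<lambda>(p, w). h w) \<in> borel_measurable (borel \<Otimes>\<^sub>M borel)" by measurable
    have km: "case_prod k \<in> borel_measurable (lborel \<Otimes>\<^sub>M lborel)"
    proof -
      have "measurable (lborel \<Otimes>\<^sub>M lborel) (borel :: complex measure) = measurable (borel \<Otimes>\<^sub>M borel :: (heisenberg \<times> heisenberg) measure) borel"
        by (intro measurable_cong_sets sets_pair_measure_cong) auto
      moreover have "case_prod k = (\<lambda>z. (case z of (p, w) \<Rightarrow> f p * gauss 0 (hdil r (hmult (- p) w))) * (case z of (p, w) \<Rightarrow> h w))"
        by (rule ext) (simp only: k_def split_beta mult_ac)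
      ultimately show ?thesis
        using borel_measurable_times[OF m1 m2] by simp
    qed
    have "integrable (lborel \<Otimes>\<^sub>M lborel) (case_prod k)"
    proof (rule Bochner_Integration.integrable_bound[OF integrable_product_lborel[OF integrable_mult_right[OF integrable_decay] hd] km])
      show "AE x in lborel \<Otimes>\<^sub>M lborel. norm (case_prod k x) \<le> norm (case x of (p, w) \<Rightarrow> C * decay p * (cmod (h w) * decay w))"
      proof (rule AE_I2)
        fix z :: "heisenberg \<times> heisenberg"
        obtain p w where z: "z = (p, w)" by (cases z)
        let ?v = "hmult (- p) w"
        \<comment> \<open>For r \<ge> 1 the dilation only increases the norm, which makes the
          majorant uniform in r.\<close>
        have "norm ?v \<le> norm (hdil r ?v)"
          using norm_hdil_le[of "1 / r" "hdil r ?v"] hdil_inverse[of "1 / r" ?v] r by simp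
        then have "4 * ((1 + norm p) * (1 + norm ?v)) \<le> 4 * ((1 + norm p) * (1 + norm (hdil r ?v)))"
          by (intro mult_left_mono) auto
        with hmult_norm[of p ?v] have "1 + norm w \<le> 4 * ((1 + norm p) * (1 + norm (hdil r ?v)))"
          unfolding hmult_minus_cancel by (rule order_trans)
        then have "cmod (gauss 0 p) * cmod (gauss 0 (hdil r ?v)) \<le> C * (decay p * decay w)" by (rule C)
        then have "cmod (f p) * cmod (gauss 0 (hdil r ?v)) \<le> C * (decay p * decay w)"
          by (rule order_trans[rotated]) (simp add: mult_right_mono fg)
        then have "cmod (h w) * (cmod (f p) * cmod (gauss 0 (hdil r ?v))) \<le> cmod (h w) * (C * (decay p * decay w))"
          by (intro mult_left_mono) auto
        then have "norm (k p w) \<le> norm (C * decay p * (cmod (h w) * decay w))"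
          using C0 decay_nonneg[of p] decay_nonneg[of w] by (simp add: k_def norm_mult mult_ac)
        then show "norm (case_prod k z) \<le> norm (case z of (p, w) \<Rightarrow> C * decay p * (cmod (h w) * decay w))"
          by (simp add: z)
      qed
    qed
    then have "(LINT w|lborel. LINT p|lborel. k p w) = (LINT p|lborel. LINT w|lborel. k p w)"
      by (rule lborel_pair.Fubini_integral)
    also have "\<dots> = 0" by (simp add: k_def zero[OF r])
    finally have 0: "(LINT w|lborel. LINT p|lborel. k p w) = 0" .
    have "(LINT p|lborel. k p w) = complex_of_real ((1 / r)\<^sup>2 * (1 / r)\<^sup>2) * (h w * F r w)" for w
    proof -
      define a where "a p = f p * gauss 0 (hdil r (hmult (- p) w))" for p
      have "continuous_on UNIV a"
        unfolding a_def by (intro continuous_intros fcomp gcomp)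
      then have am: "a \<in> borel_measurable borel" by (rule borel_measurable_continuous_onI)
      have am': "(\<lambda>q. a (hmult w q)) \<in> borel_measurable borel"
        using am unfolding hmult_def by measurable
      have "(LINT p|lborel. a p) = (LINT q|lborel. a (hmult w q))"
        unfolding hmult_def using integral_haff[OF am, of 1 1] by simp
      also have "\<dots> = ((1 / r)\<^sup>2 * \<bar>(1 / r)\<^sup>2\<bar>) *\<^sub>R (LINT u|lborel. a (hmult w (hdil (1 / r) u)))"
        unfolding hdil_def using integral_haff[OF am', of "1 / r" "(1 / r)\<^sup>2" 0 0 0] r0 by simp
      also have "(LINT u|lborel. a (hmult w (hdil (1 / r) u))) = F r w"
      proof -
        \<comment> \<open>Evenness is used because (w q)^{-1} w = -q.\<close>
        have "gauss 0 (- u) = gauss 0 u" for u :: heisenberg by (simp add: gauss_def)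
        then show ?thesis
          by (simp add: F_def a_def hmult_cancel_right hdil_minus hdil_inverse[OF r0])
      qed
      finally have "(LINT p|lborel. a p) = ((1 / r)\<^sup>2 * (1 / r)\<^sup>2) *\<^sub>R F r w" by simp
      moreover have "(LINT p|lborel. k p w) = h w * (LINT p|lborel. a p)"
        by (simp add: k_def a_def mult.left_commute flip: integral_mult_right_zero)
      ultimately show ?thesis by (simp add: scaleR_conv_of_real)
    qed
    then show ?thesis using 0 r0 by simp
  qed
  have lim: "(\<lambda>n. F (real (Suc n)) w) \<longlonglongrightarrow> f w * (LINT u|lborel. gauss 0 (u::heisenberg))" for w
  proof -
    have "(\<lambda>n. F (real (Suc n)) w) \<longlonglongrightarrow> (LINT u|lborel. f w * gauss 0 (u::heisenberg))"
      unfolding F_def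
    proof (rule integral_dominated_convergence)
      show "integrable lborel (\<lambda>u::heisenberg. (C * decay w) * decay u)" by (intro integrable_mult_right integrable_decay)
      show "AE u in lborel. cmod (f (hmult w (hdil (1 / real (Suc n)) u)) * gauss 0 u) \<le> C * decay w * decay u" for n
        by (rule AE_I2) (rule Fb, simp)
      show "AE u in lborel. (\<lambda>n. f (hmult w (hdil (1 / real (Suc n)) u)) * gauss 0 u) \<longlonglongrightarrow> f w * gauss 0 u"
      proof (rule AE_I2)
        fix u :: heisenberg
        obtain x y t where u: "u = (x, y, t)" by (cases u)
        have i: "(\<lambda>n. 1 / real (Suc n)) \<longlonglongrightarrow> 0" by (rule LIMSEQ_Suc[OF lim_1_over_n])
        have "(\<lambda>n. hdil (1 / real (Suc n)) u) \<longlonglongrightarrow> (0 * x, 0 * y, 0\<^sup>2 * t)"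
          unfolding u hdil_eq by (intro tendsto_intros i)
        moreover have "continuous_on UNIV (\<lambda>q. f (hmult w q))" by (intro continuous_intros fcomp)
        then have "isCont (\<lambda>q. f (hmult w q)) (0, 0, 0)" by (simp add: continuous_on_eq_continuous_at)
        ultimately have "(\<lambda>n. f (hmult w (hdil (1 / real (Suc n)) u))) \<longlonglongrightarrow> f (hmult w (0, 0, 0))"
          by (intro isCont_tendsto_compose[of "(0, 0, 0)" "\<lambda>q. f (hmult w q)"]) auto
        moreover have "hmult w (0, 0, 0) = w" by (cases w) (simp add: hmult_eq)
        ultimately show "(\<lambda>n. f (hmult w (hdil (1 / real (Suc n)) u)) * gauss 0 u) \<longlonglongrightarrow> f w * gauss 0 u"
          by (intro tendsto_intros) simp
      qed
      show "(\<lambda>u. f (hmult w (hdil (1 / real (Suc n)) u)) * gauss 0 u) \<in> borel_measurable lborel" for n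
      proof -
        have "continuous_on UNIV (\<lambda>u. f (hmult w (hdil (1 / real (Suc n)) u)) * gauss 0 u)"
          by (intro continuous_intros fcomp gcomp)
        then show ?thesis by (auto intro: borel_measurable_continuous_onI)
      qed
    qed measurable
    then show ?thesis by simp
  qed
  let ?c = "LINT u|lborel. gauss 0 (u::heisenberg)"
  have "(\<lambda>n. LINT w|lborel. h w * F (real (Suc n)) w) \<longlonglongrightarrow> (LINT w|lborel. h w * (f w * ?c))"
  proof (rule integral_dominated_convergence)
    show "integrable lborel (\<lambda>w. (C * (LINT u|lborel. decay (u::heisenberg))) * (cmod (h w) * decay w))"
      by (intro integrable_mult_right hd)
    show "AE w in lborel. norm (h w * F (real (Suc n)) w) \<le> (C * (LINT u|lborel. decay (u::heisenberg))) * (cmod (h w) * decay w)" for n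
    proof (rule AE_I2)
      fix w
      have "cmod (h w) * cmod (F (real (Suc n)) w) \<le> cmod (h w) * ((C * (LINT u|lborel. decay (u::heisenberg))) * decay w)"
        by (intro mult_left_mono FC) auto
      then show "norm (h w * F (real (Suc n)) w) \<le> (C * (LINT u|lborel. decay (u::heisenberg))) * (cmod (h w) * decay w)"
        by (simp add: norm_mult mult_ac)
    qed
    show "AE w in lborel. (\<lambda>n. h w * F (real (Suc n)) w) \<longlonglongrightarrow> h w * (f w * ?c)"
      by (intro AE_I2 tendsto_intros lim)
  qed measurable
  moreover have "(\<lambda>n. LINT w|lborel. h w * F (real (Suc n)) w) = (\<lambda>n. 0)"
    by (rule ext, rule hF) simp
  ultimately have "(\<lambda>n. 0) \<longlonglongrightarrow> (LINT w|lborel. h w * (f w * ?c))" by (simp only:)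
  then have "(LINT w|lborel. h w * (f w * ?c)) = 0" by (simp only: LIMSEQ_const_iff)
  then have "(LINT w|lborel. (h w * f w) * ?c) = 0" by (simp only: mult.assoc)
  then have "(LINT w|lborel. h w * f w) * ?c = 0" by simp
  then show ?thesis using integral_gauss_pos by (simp add: f_def)
qed

text \<open>Multiplying h by the Gaussian makes it integrable, so its integral over any Borel set
  exists. Bounded continuous tests reach open sets by monotone approximation of indicators, a Dynkin
  argument reaches all Borel sets, and a density with vanishing set integrals is zero almost
  everywhere.\<close>

lemma gaussian_translates_total:
  assumes h: "square_integrable h"
    and zero: "\<And>p r. 1 \<le> r \<Longrightarrow> (LINT w|lborel. h w * gauss 0 (hdil r (hmult (- p) w))) = 0"
  shows "AE w in lborel. h w = 0"
proof -
  define h1 where "h1 w = h w * gauss 0 w" for w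
  have hm [measurable]: "h \<in> borel_measurable borel" using h by (simp add: square_integrable_def)
  have gm [measurable]: "(gauss 0 :: heisenberg \<Rightarrow> complex) \<in> borel_measurable borel"
    by (rule schwartz_measurable[OF gauss_schwartz])
  obtain C where C: "\<And>x::heisenberg. cmod (gauss 0 x) \<le> C * decay x"
    using schwartz_decay_bound'[OF gauss_schwartz] by blast
  have i1: "integrable lborel h1" unfolding h1_def by (rule pairing_integrable[OF h gm C])
  have [measurable]: "h1 \<in> borel_measurable borel" using i1 by auto
  have test: "(LINT w|lborel. complex_of_real (e w) * h1 w) = 0"
    if "continuous_on UNIV e" "\<And>w. \<bar>e w\<bar> \<le> 1" for e :: "heisenberg \<Rightarrow> real"
    using continuous_test_vanishes[OF h zero, of "\<lambda>w. complex_of_real (e w)"] that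
    by (simp add: h1_def continuous_on_of_real mult_ac)
  have op: "set_lebesgue_integral lborel U h1 = 0" if U: "open U" for U
  proof (cases "U = UNIV")
    case True
    then show ?thesis using test[of "\<lambda>_. 1"] by (simp add: set_lebesgue_integral_def)
  next
    case False
    \<comment> \<open>These increase to the indicator of U. The case U = \<open>UNIV\<close> was
      split off because \<open>infdist\<close> to the empty set is 0 by convention.\<close>
    define e where "e n w = min 1 (real n * infdist w (- U))" for n w
    have ec: "continuous_on UNIV (e n)" for n unfolding e_def by (intro continuous_intros)
    have [measurable]: "e n \<in> borel_measurable borel" for n using ec by (rule borel_measurable_continuous_onI)
    have [measurable]: "U \<in> sets borel" using U by simp
    have "(\<lambda>n. LINT w|lborel. e n w *\<^sub>R h1 w) \<longlonglongrightarrow> (LINT w|lborel. indicator U w *\<^sub>R h1 w)"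
    proof (rule integral_dominated_convergence)
      show "integrable lborel (\<lambda>w. cmod (h1 w))" using i1 by simp
      have "\<bar>e n w\<bar> \<le> 1" for n w by (auto simp: e_def infdist_nonneg)
      then show "AE w in lborel. cmod (e n w *\<^sub>R h1 w) \<le> cmod (h1 w)" for n
        by (intro AE_I2) (simp add: mult_left_le_one_le)
      show "AE w in lborel. (\<lambda>n. e n w *\<^sub>R h1 w) \<longlonglongrightarrow> indicator U w *\<^sub>R h1 w"
      proof (rule AE_I2)
        fix w
        have "(\<lambda>n. e n w) \<longlonglongrightarrow> indicator U w"
        proof (cases "w \<in> U")
          case True
          have "- U \<noteq> {}" using \<open>U \<noteq> UNIV\<close> by blast
          then have "infdist w (- U) \<noteq> 0"
            using True U in_closed_iff_infdist_zero[of "- U" w] by (simp add: closed_Compl)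
          then have pos: "0 < infdist w (- U)" using infdist_nonneg[of w "- U"] by simp
          obtain N :: nat where N: "1 / infdist w (- U) < real N" using reals_Archimedean2 by blast
          have "e n w = 1" if "n \<ge> N" for n
          proof -
            have "1 / infdist w (- U) \<le> real n" using N that by simp
            then show ?thesis using pos by (simp add: e_def field_simps)
          qed
          then have "eventually (\<lambda>n. e n w = 1) sequentially" by (auto simp: eventually_sequentially)
          then show ?thesis using True by (simp add: tendsto_eventually)
        next
          case False
          then have "e n w = 0" for n by (simp add: e_def)
          then show ?thesis using False by simp
        qed
        then show "(\<lambda>n. e n w *\<^sub>R h1 w) \<longlonglongrightarrow> indicator U w *\<^sub>R h1 w" by (intro tendsto_intros)
      qed
    qed measurable
    moreover have "(LINT w|lborel. e n w *\<^sub>R h1 w) = 0" for n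
      using test[OF ec, of n] by (simp add: e_def infdist_nonneg scaleR_conv_of_real)
    ultimately show ?thesis using LIMSEQ_unique[OF _ tendsto_const] by (simp add: set_lebesgue_integral_def)
  qed
  have si: "set_integrable lborel A h1" if "A \<in> sets borel" for A
    unfolding set_integrable_def using i1 that by (intro integrable_mult_indicator) auto
  have "set_lebesgue_integral lborel A h1 = 0" if A: "A \<in> sets lborel" for A
  proof -
    have "Int_stable {S::heisenberg set. open S}" "{S::heisenberg set. open S} \<subseteq> Pow UNIV"
      "A \<in> sigma_sets UNIV {S. open S}" using A by (auto simp: borel_def Int_stable_def)
    then show ?thesis
    proof (induction rule: sigma_sets_induct_disjoint)
      case (basic A) then show ?case by (simp add: op)
    next
      case empty show ?case by (simp add: set_lebesgue_integral_def)
    next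
      case (compl A)
      then have Ab: "A \<in> sets borel" by (simp add: borel_def)
      have "set_lebesgue_integral lborel (A \<union> (UNIV - A)) h1
          = set_lebesgue_integral lborel A h1 + set_lebesgue_integral lborel (UNIV - A) h1"
        by (rule set_integral_Un) (use Ab in \<open>auto intro!: si\<close>)
      moreover have "A \<union> (UNIV - A) = UNIV" by auto
      ultimately show ?case using compl op[of UNIV] by simp
    next
      case (union A)
      then have Ab: "A i \<in> sets lborel" for i by (auto simp: borel_def)
      have "set_lebesgue_integral lborel (\<Union>i. A i) h1 = (\<Sum>i. set_lebesgue_integral lborel (A i) h1)"
        by (rule lebesgue_integral_countable_add) (use union Ab in \<open>auto intro!: si simp: disjoint_family_on_def\<close>)
      then show ?case using union by simp
    qed
  qed
  then have "AE w in lborel. h1 w = 0" by (intro sigma_finite_measure.density_zero[OF sigma_finite_lborel i1])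
  then show ?thesis
    by eventually_elim (simp add: h1_def gauss_def)
qed


section \<open>Nonnegative symmetric operators on a complex Hilbert space\<close>

text \<open>The product is linear in its first argument. \<open>ip_self\<close> ties it to the norm
  of the class, which supplies completeness and makes the space a Hilbert space.\<close>

locale hilbert_product =
  fixes ip :: "'a::complex_banach \<Rightarrow> 'a \<Rightarrow> complex"
  assumes ip_add_left: "ip (x + y) z = ip x z + ip y z"
    and ip_scaleC_left: "ip (c *\<^sub>C x) z = c * ip x z"
    and ip_commute: "ip y x = cnj (ip x y)"
    and ip_self: "ip x x = complex_of_real ((norm x)\<^sup>2)"
    and ip_le_norm: "cmod (ip x y) \<le> norm x * norm y"
begin

lemma ip_add_right: "ip x (y + z) = ip x y + ip x z"
  by (metis ip_commute ip_add_left complex_cnj_add)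

lemma ip_scaleC_right: "ip x (c *\<^sub>C z) = cnj c * ip x z"
  by (metis ip_commute ip_scaleC_left complex_cnj_mult)

sublocale bounded_bilinear ip
proof
  show "\<exists>K. \<forall>a b. norm (ip a b) \<le> norm a * norm b * K"
    using ip_le_norm by (intro exI[of _ 1]) simp
qed (auto simp: ip_add_left ip_add_right scaleR_scaleC ip_scaleC_left ip_scaleC_right scaleR_conv_of_real)

lemma norm_diff_sq: "(norm (x - y))\<^sup>2 = (norm x)\<^sup>2 - 2 * Re (ip x y) + (norm y)\<^sup>2"
proof -
  have "complex_of_real ((norm (x - y))\<^sup>2) = ip x x - ip x y - ip y x + ip y y"
    by (simp only: ip_self[symmetric] diff_left diff_right) simp
  also have "\<dots> = ip x x - (ip x y + cnj (ip x y)) + ip y y"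
    by (simp add: ip_commute[of x y])
  also have "\<dots> = complex_of_real ((norm x)\<^sup>2 - 2 * Re (ip x y) + (norm y)\<^sup>2)"
    by (simp only: ip_self complex_add_cnj of_real_add of_real_diff)
  finally show ?thesis by (simp only: of_real_eq_iff)
qed

lemma norm_add_sq: "(norm (x + y))\<^sup>2 = (norm x)\<^sup>2 + 2 * Re (ip x y) + (norm y)\<^sup>2"
  using norm_diff_sq[of x "-y"] by (simp add: minus_right)

lemma parallelogram:
  fixes x y :: 'a
  shows "(norm (x + y))\<^sup>2 + (norm (x - y))\<^sup>2 = 2 * (norm x)\<^sup>2 + 2 * (norm y)\<^sup>2"
  unfolding norm_add_sq norm_diff_sq by simp

section \<open>Projection onto closed complex subspaces\<close>

definition complex_subspace :: "'a set \<Rightarrow> bool" where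
  "complex_subspace M \<longleftrightarrow> 0 \<in> M \<and> (\<forall>x\<in>M. \<forall>y\<in>M. x + y \<in> M) \<and> (\<forall>c. \<forall>x\<in>M. c *\<^sub>C x \<in> M)"

lemma bounded_linear_scaleC: "bounded_linear (\<lambda>x::'a. c *\<^sub>C x)"
proof
  show "\<exists>K. \<forall>x::'a. norm (c *\<^sub>C x) \<le> norm x * K"
    by (intro exI[of _ "cmod c"]) (simp add: norm_scaleC)
qed (auto simp: scaleC_add_right scaleR_scaleC scaleC_scaleC mult.commute)

lemma scaleC_diff_right: "c *\<^sub>C (x - y) = c *\<^sub>C x - c *\<^sub>C (y :: 'a)"
  by (rule linear_diff[OF bounded_linear.linear[OF bounded_linear_scaleC]])

lemma complex_subspace_closure:
  assumes "complex_subspace M" shows "complex_subspace (closure M)"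
  unfolding complex_subspace_def
proof (intro conjI ballI allI)
  show "0 \<in> closure M" using assms closure_subset by (auto simp: complex_subspace_def)
next
  fix x y assume "x \<in> closure M" "y \<in> closure M"
  then obtain f g where "\<forall>n. f n \<in> M" "f \<longlonglongrightarrow> x" "\<forall>n. g n \<in> M" "g \<longlonglongrightarrow> y"
    by (auto simp: closure_sequential)
  then show "x + y \<in> closure M"
    using assms unfolding closure_sequential complex_subspace_def
    by (intro exI[of _ "\<lambda>n. f n + g n"]) (auto intro!: tendsto_intros)
next
  fix c x assume "x \<in> closure M"
  then obtain f where "\<forall>n. f n \<in> M" "f \<longlonglongrightarrow> x"
    by (auto simp: closure_sequential)
  then show "c *\<^sub>C x \<in> closure M"
    using assms unfolding closure_sequential complex_subspace_def
    by (intro exI[of _ "\<lambda>n. c *\<^sub>C f n"]) (auto intro!: bounded_linear.tendsto[OF bounded_linear_scaleC])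
qed

text \<open>The vector h is x minus its nearest point in M. A minimizing sequence is Cauchy by the
  parallelogram law, and minimality gives orthogonality.\<close>

lemma orthogonal_closed_complex_subspace:
  assumes cl: "closed M" and sub: "complex_subspace M" and x: "x \<notin> M"
  obtains h where "h \<noteq> 0" "\<And>m. m \<in> M \<Longrightarrow> ip h m = 0"
proof -
  have ne: "M \<noteq> {}" using sub by (auto simp: complex_subspace_def)
  define d where "d = infdist x M"
  have d0: "0 \<le> d" by (simp add: d_def infdist_nonneg)
  have dle: "d \<le> norm (x - m)" if "m \<in> M" for m
    using infdist_le[OF that, of x] by (simp add: d_def dist_norm)
  have "\<exists>m\<in>M. norm (x - m) < d + 1 / real (Suc n)" for n
  proof -
    have "infdist x M < d + 1 / real (Suc n)" by (simp add: d_def)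
    then show ?thesis
      unfolding infdist_notempty[OF ne] dist_norm
      by (subst (asm) cINF_less_iff) (use ne in \<open>auto intro!: bdd_belowI[of _ 0]\<close>)
  qed
  then obtain m where m: "\<And>n. m n \<in> M" and md: "\<And>n. norm (x - m n) < d + 1 / real (Suc n)"
    by metis
  \<comment> \<open>The midpoint of a and b lies in M, hence is no closer to x than d; the
    parallelogram law turns this into closeness of near-minimizers.\<close>
  have key: "(norm (a - b))\<^sup>2 \<le> 2 * ((norm (x - a))\<^sup>2 - d\<^sup>2) + 2 * ((norm (x - b))\<^sup>2 - d\<^sup>2)"
    if "a \<in> M" "b \<in> M" for a b
  proof -
    have "(1/2) *\<^sub>R (a + b) \<in> M" using sub that by (auto simp: complex_subspace_def scaleR_scaleC)
    then have "d \<le> norm (x - (1/2) *\<^sub>R (a + b))" by (rule dle)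
    then have "d\<^sup>2 \<le> (norm (x - (1/2) *\<^sub>R (a + b)))\<^sup>2" using d0 by (simp add: power_mono)
    moreover have "(x - a) + (x - b) = 2 *\<^sub>R (x - (1/2) *\<^sub>R (a + b))"
      by (simp add: algebra_simps scaleR_2)
    then have "(norm ((x - a) + (x - b)))\<^sup>2 = 4 * (norm (x - (1/2) *\<^sub>R (a + b)))\<^sup>2"
      by (simp add: power_mult_distrib)
    moreover have "norm ((x - a) - (x - b)) = norm (a - b)"
      by (simp add: norm_minus_commute)
    ultimately show ?thesis
      using parallelogram[of "x - a" "x - b"] by simp
  qed
  have lim: "(\<lambda>n. (d + 1 / real (Suc n))\<^sup>2 - d\<^sup>2) \<longlonglongrightarrow> (d + 0)\<^sup>2 - d\<^sup>2"
    by (intro tendsto_intros LIMSEQ_Suc[OF lim_1_over_n])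
  have "Cauchy m"
  proof (rule CauchyI)
    fix e :: real assume "0 < e"
    then have "0 < e\<^sup>2 / 4" by simp
    then have "eventually (\<lambda>n. (d + 1 / real (Suc n))\<^sup>2 - d\<^sup>2 < e\<^sup>2 / 4) sequentially"
      using order_tendstoD(2)[OF lim, of "e\<^sup>2/4"] by simp
    then obtain N where N: "\<And>n. n \<ge> N \<Longrightarrow> (d + 1 / real (Suc n))\<^sup>2 - d\<^sup>2 < e\<^sup>2 / 4"
      by (auto simp: eventually_sequentially)
    have N2: "(norm (x - m n))\<^sup>2 - d\<^sup>2 < e\<^sup>2 / 4" if "n \<ge> N" for n
      using N[OF that] power_strict_mono[OF md[of n], of 2] by simp
    show "\<exists>N. \<forall>k\<ge>N. \<forall>n\<ge>N. norm (m k - m n) < e"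
    proof (intro exI[of _ N] allI impI)
      fix k n assume "N \<le> k" "N \<le> n"
      then have "(norm (m k - m n))\<^sup>2 < e\<^sup>2" using key[OF m[of k] m[of n]] N2[of k] N2[of n] by simp
      then show "norm (m k - m n) < e" using \<open>0 < e\<close> by (simp add: power_less_imp_less_base)
    qed
  qed
  then obtain p where p: "m \<longlonglongrightarrow> p" using Cauchy_convergent convergent_def by blast
  have pM: "p \<in> M" using closed_sequentially[OF cl _ p] m by blast
  have "norm (x - p) \<le> d + 0"
  proof (rule LIMSEQ_le)
    show "(\<lambda>n. norm (x - m n)) \<longlonglongrightarrow> norm (x - p)" by (intro tendsto_intros p)
    show "(\<lambda>n. d + 1 / real (Suc n)) \<longlonglongrightarrow> d + 0" by (intro tendsto_intros LIMSEQ_Suc[OF lim_1_over_n])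
    show "\<exists>N. \<forall>n\<ge>N. norm (x - m n) \<le> d + 1 / real (Suc n)" using md less_imp_le by blast
  qed
  define h where "h = x - p"
  have hd: "norm h \<le> d" using \<open>norm (x - p) \<le> d + 0\<close> by (simp add: h_def)
  have "ip h y = 0" if y: "y \<in> M" for y
  proof (cases "y = 0")
    case False
    \<comment> \<open>The coefficient of the projection of h onto y. Minimality then reads 2 q \<le>
      q with q = |\<open>ip h y\<close>|^2 / |y|^2.\<close>
    define c where "c = ip h y / complex_of_real ((norm y)\<^sup>2)"
    have "p + c *\<^sub>C y \<in> M" using sub pM y by (auto simp: complex_subspace_def)
    from dle[OF this] have "norm h \<le> norm (h - c *\<^sub>C y)" using hd by (simp add: h_def diff_diff_add)
    then have "(norm h)\<^sup>2 \<le> (norm (h - c *\<^sub>C y))\<^sup>2" by (simp add: power_mono)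
    then have "2 * Re (cnj c * ip h y) \<le> (cmod c * norm y)\<^sup>2"
      by (simp add: norm_diff_sq ip_scaleC_right norm_scaleC)
    moreover have "cnj c * ip h y = complex_of_real ((cmod (ip h y))\<^sup>2 / (norm y)\<^sup>2)"
      by (simp only: c_def complex_cnj_divide complex_cnj_complex_of_real of_real_divide
            complex_norm_square) (simp add: mult.commute)
    moreover have "(cmod c * norm y)\<^sup>2 = (cmod (ip h y))\<^sup>2 / (norm y)\<^sup>2"
      using False by (simp add: c_def norm_divide norm_mult norm_power power2_eq_square divide_simps)
    ultimately have "(cmod (ip h y))\<^sup>2 / (norm y)\<^sup>2 \<le> 0" by simp
    then show ?thesis using False by (simp add: divide_le_0_iff)
  qed (simp add: zero_right)
  moreover have "h \<noteq> 0" using pM x by (auto simp: h_def)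
  ultimately show ?thesis using that by blast
qed

lemma closure_eq_UNIV_if_orthogonal:
  assumes "complex_subspace M" and "\<And>h. (\<And>m. m \<in> M \<Longrightarrow> ip h m = 0) \<Longrightarrow> h = 0"
  shows "closure M = UNIV"
proof (rule ccontr)
  assume "closure M \<noteq> UNIV"
  then obtain x where "x \<notin> closure M" by blast
  from orthogonal_closed_complex_subspace[OF closed_closure complex_subspace_closure[OF assms(1)] this]
  obtain h where "h \<noteq> 0" "\<And>m. m \<in> closure M \<Longrightarrow> ip h m = 0" by blast
  then show False using assms(2)[of h] closure_subset[of M] by blast
qed

text \<open>Sokal's argument: moving from \<open>x\<close> to one of \<open>x \<plusminus> r y / \<parallel>y\<parallel>\<close> makes the functional
  \<open>ip \<cdot> y\<close> at least \<open>r \<parallel>y\<parallel>\<close>, so an iteration with radii \<open>3\<^sup>-\<^sup>n\<close> produces a point at which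
  functionals of norm \<open>4\<^sup>n\<close> are unbounded.\<close>

lemma uniform_boundedness:
  assumes pb: "\<And>x. \<exists>K. \<forall>y\<in>Y. cmod (ip x y) \<le> K"
  shows "\<exists>K. \<forall>y\<in>Y. norm y \<le> K"
proof (rule ccontr)
  assume "\<not> ?thesis"
  then have "\<exists>y\<in>Y. 4 ^ n < norm y" for n :: nat by (meson not_le)
  then obtain y where y: "\<And>n. y n \<in> Y" and yn: "\<And>n. 4 ^ n < norm (y n)" by metis
  have ex: "\<exists>z. norm (z - x) \<le> r \<and> r * norm v \<le> cmod (ip z v)" if "0 < r" for x v and r :: real
  proof (cases "v = 0")
    case True then show ?thesis using that by (intro exI[of _ x]) auto
  next
    case False
    define w where "w = (r / norm v) *\<^sub>R v"
    have nw: "norm w = r" using False that by (simp add: w_def)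
    have "ip w v = complex_of_real (r * norm v)"
      using False by (simp add: w_def scaleR_left ip_self scaleR_conv_of_real power2_eq_square)
    then have "2 * (r * norm v) = cmod (ip (x + w) v - ip (x - w) v)"
      using that by (simp add: add_left diff_left flip: mult_2) (simp add: norm_mult)
    also have "\<dots> \<le> cmod (ip (x + w) v) + cmod (ip (x - w) v)" by (rule norm_triangle_ineq4)
    finally have "r * norm v \<le> cmod (ip (x + w) v) \<or> r * norm v \<le> cmod (ip (x - w) v)" by linarith
    then show ?thesis
    proof
      assume "r * norm v \<le> cmod (ip (x + w) v)"
      then show ?thesis using nw by (intro exI[of _ "x + w"]) simp
    next
      assume "r * norm v \<le> cmod (ip (x - w) v)"
      then show ?thesis using nw by (intro exI[of _ "x - w"]) simp
    qed
  qed
  define nxt where "nxt x n = (SOME z. norm (z - x) \<le> (1/3)^n \<and> (1/3)^n * norm (y n) \<le> cmod (ip z (y n)))" for x n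
  have nxt: "norm (nxt x n - x) \<le> (1/3)^n" "(1/3)^n * norm (y n) \<le> cmod (ip (nxt x n) (y n))" for x n
    using someI_ex[OF ex[of "(1/3)^n" x "y n"]] unfolding nxt_def by auto
  define X where "X = rec_nat 0 (\<lambda>n x. nxt x n)"
  have X0: "X 0 = 0" by (simp add: X_def)
  have XS: "X (Suc n) = nxt (X n) n" for n by (simp add: X_def)
  have step: "norm (X (Suc n) - X n) \<le> (1/3)^n" for n using nxt(1) by (simp add: XS)
  have big: "(1/3)^n * norm (y n) \<le> cmod (ip (X (Suc n)) (y n))" for n using nxt(2) by (simp add: XS)
  \<comment> \<open>\<open>X (Suc n)\<close> is the point chosen for \<open>y n\<close>. The later
    steps sum to at most half of (1/3)^n, so half of the gain at \<open>y n\<close> survives in the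
    limit.\<close>
  have dist: "norm (X (Suc n + k) - X (Suc n)) \<le> (1/2) * (1/3)^n * (1 - (1/3)^k)" for n k
  proof (induction k)
    case (Suc k)
    have "norm (X (Suc n + Suc k) - X (Suc n))
        \<le> norm (X (Suc (Suc n + k)) - X (Suc n + k)) + norm (X (Suc n + k) - X (Suc n))"
      using norm_triangle_ineq[of "X (Suc (Suc n + k)) - X (Suc n + k)" "X (Suc n + k) - X (Suc n)"] by simp
    also have "\<dots> \<le> (1/3)^(Suc n + k) + (1/2) * (1/3)^n * (1 - (1/3)^k)"
      by (intro add_mono step Suc.IH)
    also have "\<dots> = (1/2) * (1/3)^n * (1 - (1/3)^Suc k)"
      by (simp add: power_add field_simps)
    finally show ?case .
  qed simp
  have dist': "norm (X (Suc n + k) - X (Suc n)) \<le> (1/2) * (1/3)^n" for n k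
    by (rule order_trans[OF dist]) (simp add: mult_left_le)
  have "summable (\<lambda>n. X (Suc n) - X n)"
    by (rule summable_comparison_test[of _ "\<lambda>n. (1/3)^n"]) (use step in \<open>auto simp: summable_geometric\<close>)
  then have "convergent (\<lambda>n. \<Sum>i<n. X (Suc i) - X i)" by (simp add: summable_iff_convergent)
  then have "convergent X"
    using X0 by (simp only: sum_lessThan_telescope diff_zero)
  then obtain x where x: "X \<longlonglongrightarrow> x" by (auto simp: convergent_def)
  have xd: "norm (x - X (Suc n)) \<le> (1/2) * (1/3)^n" for n
  proof (rule tendsto_upperbound)
    show "(\<lambda>k. norm (X (Suc n + k) - X (Suc n))) \<longlonglongrightarrow> norm (x - X (Suc n))"
      using LIMSEQ_ignore_initial_segment[OF x, of "Suc n"]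
      by (intro tendsto_intros) (simp add: add.commute)
  qed (use dist' in auto)
  obtain K where K: "\<And>v. v \<in> Y \<Longrightarrow> cmod (ip x v) \<le> K" using pb by blast
  \<comment> \<open>The norms grow faster than 4^n while the radii shrink like 3^(-n), leaving an
    unbounded factor (4/3)^n.\<close>
  have "(1/2) * (4/3)^n \<le> K" for n
  proof -
    have "(1/3)^n * norm (y n) \<le> cmod (ip (X (Suc n)) (y n))" by (rule big)
    also have "ip (X (Suc n)) (y n) = ip x (y n) - ip (x - X (Suc n)) (y n)" by (simp add: diff_left)
    also have "cmod \<dots> \<le> cmod (ip x (y n)) + cmod (ip (x - X (Suc n)) (y n))" by (rule norm_triangle_ineq4)
    also have "\<dots> \<le> K + (1/2) * (1/3)^n * norm (y n)"
      by (intro add_mono K y order_trans[OF ip_le_norm] mult_right_mono xd) simp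
    finally have "(1/2) * ((1/3)^n * norm (y n)) \<le> K" by simp
    moreover have "(4/3::real)^n \<le> (1/3)^n * norm (y n)"
      using yn[of n] by (simp add: power_divide divide_right_mono)
    ultimately show ?thesis by simp
  qed
  moreover obtain n where "2 * K < (4/3::real)^n" using real_arch_pow[of "4/3" "2 * K"] by auto
  moreover have "(1/2) * (4/3)^n = ((4/3)^n) / (2::real)" by simp
  ultimately show False by (metis less_divide_eq_numeral1(1) mult.commute not_le)
qed

end

text \<open>\<open>domain_total\<close> is density of the domain, in dual form.
  \<open>range_total\<close> is density of the range of \<open>T0 + 1\<close>, which for a
  nonnegative symmetric operator is the criterion for essential self-adjointness.\<close>

locale positive_symmetric = hilbert_product +
  fixes T0 :: "'a unbounded_op"
  assumes T0_zero: "(0, 0) \<in> T0"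
    and T0_add: "(u, v) \<in> T0 \<Longrightarrow> (u', v') \<in> T0 \<Longrightarrow> (u + u', v + v') \<in> T0"
    and T0_scaleC: "(u, v) \<in> T0 \<Longrightarrow> (c *\<^sub>C u, c *\<^sub>C v) \<in> T0"
    and T0_sym: "(u, v) \<in> T0 \<Longrightarrow> (u', v') \<in> T0 \<Longrightarrow> ip v u' = ip u v'"
    and T0_pos: "(u, v) \<in> T0 \<Longrightarrow> 0 \<le> Re (ip v u)"
    and domain_total: "(\<And>u v. (u, v) \<in> T0 \<Longrightarrow> ip h u = 0) \<Longrightarrow> h = 0"
    and range_total: "(\<And>u v. (u, v) \<in> T0 \<Longrightarrow> ip h (v + u) = 0) \<Longrightarrow> h = 0"
begin

definition T where "T = closure T0"

lemma T_sequential: "p \<in> T \<longleftrightarrow> (\<exists>f g. (\<forall>n. (f n, g n) \<in> T0) \<and> f \<longlonglongrightarrow> fst p \<and> g \<longlonglongrightarrow> snd p)"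
proof
  assume "p \<in> T"
  then obtain x where "\<forall>n. x n \<in> T0" "x \<longlonglongrightarrow> p" by (auto simp: T_def closure_sequential)
  then show "\<exists>f g. (\<forall>n. (f n, g n) \<in> T0) \<and> f \<longlonglongrightarrow> fst p \<and> g \<longlonglongrightarrow> snd p"
    by (intro exI[of _ "\<lambda>n. fst (x n)"] exI[of _ "\<lambda>n. snd (x n)"]) (auto intro!: tendsto_intros)
next
  assume "\<exists>f g. (\<forall>n. (f n, g n) \<in> T0) \<and> f \<longlonglongrightarrow> fst p \<and> g \<longlonglongrightarrow> snd p"
  then obtain f g where "\<forall>n. (f n, g n) \<in> T0" "f \<longlonglongrightarrow> fst p" "g \<longlonglongrightarrow> snd p" by blast
  then show "p \<in> T" unfolding T_def closure_sequential
    by (intro exI[of _ "\<lambda>n. (f n, g n)"]) (auto intro: tendsto_Pair[of f "fst p" _ g "snd p", simplified])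
qed

lemma T0_subset: "T0 \<subseteq> T" by (simp add: T_def closure_subset)

lemma T_add: "(u, v) \<in> T \<Longrightarrow> (u', v') \<in> T \<Longrightarrow> (u + u', v + v') \<in> T"
  unfolding T_sequential fst_conv snd_conv
  by (elim exE conjE, rule_tac x="\<lambda>n. f n + fa n" in exI, rule_tac x="\<lambda>n. g n + ga n" in exI)
    (auto intro!: tendsto_intros T0_add)

lemma T_scaleC: "(u, v) \<in> T \<Longrightarrow> (c *\<^sub>C u, c *\<^sub>C v) \<in> T"
  unfolding T_sequential fst_conv snd_conv
  by (elim exE conjE, rule_tac x="\<lambda>n. c *\<^sub>C f n" in exI, rule_tac x="\<lambda>n. c *\<^sub>C g n" in exI)
    (auto intro!: bounded_linear.tendsto[OF bounded_linear_scaleC] T0_scaleC)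

lemma T_diff: "(u, v) \<in> T \<Longrightarrow> (u', v') \<in> T \<Longrightarrow> (u - u', v - v') \<in> T"
proof -
  assume a: "(u, v) \<in> T" "(u', v') \<in> T"
  have m: "(-1) *\<^sub>C x = - x" for x :: 'a
    using scaleR_scaleC[of "-1" x] by simp
  show ?thesis using T_add[OF a(1) T_scaleC[OF a(2), of "-1"]] by (simp add: m)
qed

lemma T_sym:
  assumes "(u, v) \<in> T" "(u', v') \<in> T"
  shows "ip v u' = ip u v'"
proof -
  obtain f g f' g' where fg: "\<And>n. (f n, g n) \<in> T0" "f \<longlonglongrightarrow> u" "g \<longlonglongrightarrow> v"
    "\<And>n. (f' n, g' n) \<in> T0" "f' \<longlonglongrightarrow> u'" "g' \<longlonglongrightarrow> v'"
    using assms by (auto simp: T_sequential)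
  have "(\<lambda>n. ip (g n) (f' n)) \<longlonglongrightarrow> ip v u'" by (intro tendsto fg)
  moreover have "(\<lambda>n. ip (f n) (g' n)) \<longlonglongrightarrow> ip u v'" by (intro tendsto fg)
  moreover have "ip (g n) (f' n) = ip (f n) (g' n)" for n by (intro T0_sym fg)
  ultimately show ?thesis using LIMSEQ_unique by auto
qed

lemma T_pos:
  assumes "(u, v) \<in> T" shows "ip v u = complex_of_real (Re (ip v u))" "0 \<le> Re (ip v u)"
proof -
  obtain f g where fg: "\<And>n. (f n, g n) \<in> T0" "f \<longlonglongrightarrow> u" "g \<longlonglongrightarrow> v"
    using assms by (auto simp: T_sequential)
  have "(\<lambda>n. Re (ip (g n) (f n))) \<longlonglongrightarrow> Re (ip v u)" by (intro tendsto_intros tendsto fg)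
  then show "0 \<le> Re (ip v u)" by (rule LIMSEQ_le_const) (use T0_pos fg(1) in blast)
  have "ip v u = cnj (ip v u)" using T_sym[OF assms assms] ip_commute[of u v] by simp
  then show "ip v u = complex_of_real (Re (ip v u))"
    by (metis Reals_cnj_iff complex_is_Real_iff of_real_Re)
qed

text \<open>Symmetric densely defined operators are closable: if (0, w) lies in the closed graph,
  symmetry makes w orthogonal to the dense domain.\<close>

lemma T_single_valued:
  assumes "(u, v) \<in> T" "(u, v') \<in> T" shows "v = v'"
proof -
  have "(0, v - v') \<in> T" using T_diff[OF assms] by simp
  then have "ip (v - v') u' = 0" if "(u', w) \<in> T0" for u' w
    using T_sym[of 0 "v - v'" u' w] T0_subset that by (auto simp: zero_left)
  then have "v - v' = 0" by (rule domain_total)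
  then show ?thesis by simp
qed

lemma op_apply_T: "(u, v) \<in> T \<Longrightarrow> op_apply T u = v"
  unfolding op_apply_def by (rule the_equality) (auto dest: T_single_valued)

lemma op_shift_T: "(u, v) \<in> T \<Longrightarrow> op_shift T l u = v - l *\<^sub>C u"
  by (simp add: op_shift_def op_apply_T)

abbreviation ran :: "complex \<Rightarrow> 'a set" where
  "ran l \<equiv> {v - l *\<^sub>C u | u v. (u, v) \<in> T}"

lemma op_shift_image: "op_shift T l ` Domain T = ran l"
  by (force simp: op_shift_T Domain_iff image_iff)

lemma complex_subspace_range: "complex_subspace (ran l)"
  unfolding complex_subspace_def
proof (intro conjI ballI allI)
  have "(0, 0) \<in> T" using T0_zero T0_subset by blast
  moreover have "(0::'a) = 0 - l *\<^sub>C 0" using norm_scaleC[of l "0::'a"] by simp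
  ultimately show "0 \<in> ran l" by blast
next
  fix x y assume "x \<in> ran l" "y \<in> ran l"
  then obtain u v u' v' where "x = v - l *\<^sub>C u" "(u, v) \<in> T" "y = v' - l *\<^sub>C u'" "(u', v') \<in> T" by blast
  then have "x + y = (v + v') - l *\<^sub>C (u + u')" "(u + u', v + v') \<in> T"
    by (auto simp: scaleC_add_right T_add)
  then show "x + y \<in> ran l" by blast
next
  fix c x assume "x \<in> ran l"
  then obtain u v where "x = v - l *\<^sub>C u" "(u, v) \<in> T" by blast
  then have "c *\<^sub>C x = c *\<^sub>C v - l *\<^sub>C (c *\<^sub>C u)" "(c *\<^sub>C u, c *\<^sub>C v) \<in> T"
    by (auto simp: scaleC_diff_right scaleC_scaleC T_scaleC mult.commute)
  then show "c *\<^sub>C x \<in> ran l" by blast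
qed

text \<open>Pairing (T - l) u with u gives q - l |u|^2 with q real and nonnegative. Its modulus is
  at least -Re l times |u|^2 in the left half-plane and at least |Im l| times |u|^2
  elsewhere.\<close>

lemma lower_bound:
  assumes l: "l \<notin> complex_of_real ` {0..}"
  obtains d where "0 < d" "\<And>u v. (u, v) \<in> T \<Longrightarrow> d * norm u \<le> norm (v - l *\<^sub>C u)"
proof -
  define d where "d = (if Re l < 0 then - Re l else \<bar>Im l\<bar>)"
  have "l \<in> complex_of_real ` {0..}" if "Im l = 0" "0 \<le> Re l"
    using that by (intro image_eqI[of _ _ "Re l"]) (auto simp: complex_eq_iff)
  then have d: "0 < d" using l by (auto simp: d_def)
  have b: "d * n \<le> cmod (complex_of_real q - l * complex_of_real n)" if "0 \<le> q" "0 \<le> n" for q n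
  proof (cases "Re l < 0")
    case True
    have "q - Re l * n \<le> cmod (complex_of_real q - l * complex_of_real n)"
      using complex_Re_le_cmod[of "complex_of_real q - l * complex_of_real n"] by simp
    then show ?thesis using True that by (simp add: d_def)
  next
    case False
    then show ?thesis using abs_Im_le_cmod[of "complex_of_real q - l * complex_of_real n"] that
      by (simp add: d_def abs_mult)
  qed
  have "d * norm u \<le> norm (v - l *\<^sub>C u)" if uv: "(u, v) \<in> T" for u v
  proof (cases "u = 0")
    case False
    have "d * (norm u)\<^sup>2 \<le> cmod (ip v u - l * complex_of_real ((norm u)\<^sup>2))"
      using b[OF T_pos(2)[OF uv], of "(norm u)\<^sup>2"] T_pos(1)[OF uv] by simp
    also have "\<dots> = cmod (ip (v - l *\<^sub>C u) u)" by (simp add: diff_left ip_scaleC_left ip_self)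
    also have "\<dots> \<le> norm (v - l *\<^sub>C u) * norm u" by (rule ip_le_norm)
    finally show ?thesis using False by (simp add: power2_eq_square)
  qed simp
  then show ?thesis using that d by blast
qed

text \<open>The lower bound turns convergence of images into convergence of preimages, and the graph
  of T is closed.\<close>

lemma closed_range:
  assumes l: "l \<notin> complex_of_real ` {0..}"
  shows "closed (ran l)"
  unfolding closed_sequential_limits
proof (intro allI impI, elim conjE)
  fix w x assume w: "\<forall>n. w n \<in> ran l" and wx: "w \<longlonglongrightarrow> x"
  obtain d where d: "0 < d" and lb: "\<And>u v. (u, v) \<in> T \<Longrightarrow> d * norm u \<le> norm (v - l *\<^sub>C u)"
    using lower_bound[OF l] by blast
  have "\<forall>n. \<exists>u v. w n = v - l *\<^sub>C u \<and> (u, v) \<in> T" using w by blast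
  then obtain u v where uv: "\<And>n. w n = v n - l *\<^sub>C u n" "\<And>n. (u n, v n) \<in> T" by metis
  note lin = bounded_linear_scaleC[of l]
  have "Cauchy u"
  proof (rule CauchyI)
    fix e :: real assume "0 < e"
    have "Cauchy w" using wx by (rule LIMSEQ_imp_Cauchy)
    then obtain N where N: "\<forall>m\<ge>N. \<forall>n\<ge>N. norm (w m - w n) < d * e"
      using CauchyD[of w "d * e"] d \<open>0 < e\<close> by auto
    have "norm (u m - u n) < e" if "m \<ge> N" "n \<ge> N" for m n
    proof -
      have "d * norm (u m - u n) \<le> norm ((v m - v n) - l *\<^sub>C (u m - u n))"
        by (intro lb T_diff uv)
      also have "\<dots> = norm (w m - w n)"
        by (simp add: uv(1) linear_diff[OF bounded_linear.linear[OF lin]] algebra_simps)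
      also have "\<dots> < d * e" using N that by blast
      finally show ?thesis using d by simp
    qed
    then show "\<exists>N. \<forall>m\<ge>N. \<forall>n\<ge>N. norm (u m - u n) < e" by blast
  qed
  then obtain a where a: "u \<longlonglongrightarrow> a" using Cauchy_convergent convergent_def by blast
  have "(\<lambda>n. w n + l *\<^sub>C u n) \<longlonglongrightarrow> x + l *\<^sub>C a"
    by (intro tendsto_intros wx bounded_linear.tendsto[OF lin] a)
  then have "v \<longlonglongrightarrow> x + l *\<^sub>C a" by (simp add: uv(1))
  then have "(\<lambda>n. (u n, v n)) \<longlonglongrightarrow> (a, x + l *\<^sub>C a)" using a by (intro tendsto_Pair)
  then have "(a, x + l *\<^sub>C a) \<in> T" using uv(2) closed_sequentially[of T "\<lambda>n. (u n, v n)"] by (simp add: T_def)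
  moreover have "x = (x + l *\<^sub>C a) - l *\<^sub>C a" by simp
  ultimately show "x \<in> ran l" by blast
qed

lemma minus_one: "(-1::complex) *\<^sub>C x = - x" for x :: 'a
  using scaleR_scaleC[of "-1" x] by simp

text \<open>The shift by -1 has closed range by \<open>closed_range\<close> and dense range by
  \<open>range_total\<close>.\<close>

lemma range_plus_one: "\<exists>u v. (u, v) \<in> T \<and> w = v + u"
proof -
  have "(-1::complex) \<notin> complex_of_real ` {0..}" by (auto simp: complex_eq_iff)
  note cl = closed_range[OF this]
  have "closure (ran (-1)) = UNIV"
  proof (rule closure_eq_UNIV_if_orthogonal[OF complex_subspace_range])
    fix h assume h: "\<And>m. m \<in> ran (-1) \<Longrightarrow> ip h m = 0"
    show "h = 0"
    proof (rule range_total)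
      fix u v assume "(u, v) \<in> T0"
      then have "(u, v) \<in> T" using T0_subset by blast
      then show "ip h (v + u) = 0" by (intro h) (auto simp: minus_one)
    qed
  qed
  then have "w \<in> ran (-1)" using cl by auto
  then show ?thesis by (auto simp: minus_one)
qed

text \<open>Self-adjointness in the form that is used later. Surjectivity gives u with (T + 1) u =
  (1 + \<open>cnj l\<close>) h; symmetry shows that h - u is orthogonal to the range of T + 1, that
  is, to everything, so h = u lies in the domain.\<close>

lemma orthogonal_range_eigenvector:
  assumes h: "\<And>u v. (u, v) \<in> T \<Longrightarrow> ip h (v - l *\<^sub>C u) = 0"
  shows "(h, cnj l *\<^sub>C h) \<in> T"
proof -
  obtain u v where uv: "(u, v) \<in> T" and e: "(1 + cnj l) *\<^sub>C h = v + u" using range_plus_one by blast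
  have "ip (h - u) w = 0" for w
  proof -
    obtain a b where ab: "(a, b) \<in> T" and w: "w = b + a" using range_plus_one by blast
    have "ip h b = cnj l * ip h a" using h[OF ab] by (simp add: diff_right ip_scaleC_right)
    moreover have "ip v a = ip u b" by (rule T_sym[OF uv ab])
    moreover have "(1 + cnj l) * ip h a = ip v a + ip u a"
      by (metis e ip_scaleC_left ip_add_left)
    ultimately show ?thesis by (simp add: w diff_left add_right algebra_simps)
  qed
  from this[of "h - u"] have "h = u" by (simp add: ip_self)
  moreover have "v = cnj l *\<^sub>C h"
    using e \<open>h = u\<close> scaleR_scaleC[of 1 h] by (simp add: scaleC_add_left algebra_simps)
  ultimately show ?thesis using uv by simp
qed

text \<open>A vector orthogonal to the range would be an eigenvector for the conjugate of l, which
  the lower bound excludes as well. Dense and closed range give surjectivity, and the bound at l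
  itself gives injectivity.\<close>

lemma resolvent_outside:
  assumes l: "l \<notin> complex_of_real ` {0..}"
  shows "l \<in> resolvent_set T"
proof -
  have inj: "inj_on (op_shift T l) (Domain T)"
  proof (rule inj_onI)
    fix u u' assume "u \<in> Domain T" "u' \<in> Domain T" and eq: "op_shift T l u = op_shift T l u'"
    then obtain v v' where uv: "(u, v) \<in> T" "(u', v') \<in> T" by blast
    obtain d where d: "0 < d" and lb: "\<And>u v. (u, v) \<in> T \<Longrightarrow> d * norm u \<le> norm (v - l *\<^sub>C u)"
      using lower_bound[OF l] by blast
    have "d * norm (u - u') \<le> norm ((v - v') - l *\<^sub>C (u - u'))" by (intro lb T_diff uv)
    also have "(v - v') - l *\<^sub>C (u - u') = op_shift T l u - op_shift T l u'"
      by (simp add: op_shift_T[OF uv(1)] op_shift_T[OF uv(2)]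
          scaleC_diff_right)
    finally have "d * norm (u - u') \<le> 0" using eq by simp
    then show "u = u'" using d by (simp add: mult_le_0_iff)
  qed
  have "closure (ran l) = UNIV"
  proof (rule closure_eq_UNIV_if_orthogonal[OF complex_subspace_range])
    fix h assume "\<And>m. m \<in> ran l \<Longrightarrow> ip h m = 0"
    then have hT: "(h, cnj l *\<^sub>C h) \<in> T" by (intro orthogonal_range_eigenvector) blast
    have "cnj l \<notin> complex_of_real ` {0..}" using l by (auto simp: complex_eq_iff image_iff)
    from lower_bound[OF this] obtain d where
      d: "0 < d" and lb: "\<And>u v. (u, v) \<in> T \<Longrightarrow> d * norm u \<le> norm (v - cnj l *\<^sub>C u)" by blast
    then show "h = 0" using lb[OF hT] by (simp add: mult_le_0_iff)
  qed
  then have "op_shift T l ` Domain T = UNIV"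
    using closed_range[OF l] by (simp add: op_shift_image)
  then show ?thesis using inj by (simp add: resolvent_set_def bij_betw_def)
qed

lemma weyl_unbounded:
  assumes weyl: "\<And>e. 0 < e \<Longrightarrow> \<exists>u v. (u, v) \<in> T \<and> u \<noteq> 0 \<and> norm (v - l *\<^sub>C u) \<le> e * norm u"
    and K: "\<And>u v. (u, v) \<in> T \<Longrightarrow> norm u \<le> K * norm (v - l *\<^sub>C u)"
  shows False
proof -
  define e where "e = 1 / (\<bar>K\<bar> + 1)"
  have "0 < e" by (simp add: e_def add_pos_nonneg)
  then obtain u v where uv: "(u, v) \<in> T" "u \<noteq> 0" and le: "norm (v - l *\<^sub>C u) \<le> e * norm u"
    using weyl by blast
  have "norm u \<le> K * norm (v - l *\<^sub>C u)" by (rule K[OF uv(1)])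
  also have "\<dots> \<le> \<bar>K\<bar> * (e * norm u)" by (intro mult_mono le) auto
  also have "\<dots> < norm u" using uv by (simp add: e_def divide_less_eq)
  finally show False by simp
qed

text \<open>The Hellinger--Toeplitz argument: an everywhere defined symmetric inverse is bounded.\<close>

lemma not_resolvent:
  assumes weyl: "\<And>e. 0 < e \<Longrightarrow> \<exists>u v. (u, v) \<in> T \<and> u \<noteq> 0 \<and> norm (v - complex_of_real l *\<^sub>C u) \<le> e * norm u"
  shows "complex_of_real l \<notin> resolvent_set T"
proof
  assume "complex_of_real l \<in> resolvent_set T"
  then have "op_shift T (complex_of_real l) ` Domain T = UNIV"
    by (simp add: resolvent_set_def bij_betw_def)
  then have "\<exists>u v. (u, v) \<in> T \<and> w = v - complex_of_real l *\<^sub>C u" for w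
    unfolding op_shift_image by blast
  then obtain A B where AB: "\<And>w. (A w, B w) \<in> T" "\<And>w. w = B w - complex_of_real l *\<^sub>C A w" by metis
  \<comment> \<open>The preimages of unit vectors under T - l; bounding Y bounds the inverse. If the
    image is 0, division by zero contributes only the vector 0.\<close>
  define Y where "Y = {(1 / norm (v - complex_of_real l *\<^sub>C u)) *\<^sub>R u | u v. (u, v) \<in> T}"
  have "\<exists>K. \<forall>y\<in>Y. norm y \<le> K"
  proof (rule uniform_boundedness)
    fix x
    show "\<exists>K. \<forall>y\<in>Y. cmod (ip x y) \<le> K"
    proof (intro exI ballI)
      fix y assume "y \<in> Y"
      then obtain u v where uv: "(u, v) \<in> T" and y: "y = (1 / norm (v - complex_of_real l *\<^sub>C u)) *\<^sub>R u"
        by (auto simp: Y_def)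
      let ?w = "v - complex_of_real l *\<^sub>C u"
      \<comment> \<open>Writing x as (T - l) (A x) and moving T - l across by symmetry, with l real,
        makes the pairing with u depend on u only through its image.\<close>
      have "ip x u = ip (B x) u - complex_of_real l * ip (A x) u"
        using arg_cong[OF AB(2)[of x], of "\<lambda>z. ip z u"] by (simp add: diff_left ip_scaleC_left)
      also have "\<dots> = ip (A x) ?w"
        using T_sym[OF AB(1)[of x] uv] by (simp add: diff_right ip_scaleC_right)
      finally have "cmod (ip x y) = (1 / norm ?w) * cmod (ip (A x) ?w)"
        by (simp add: y scaleR_right norm_mult)
      also have "\<dots> \<le> (1 / norm ?w) * (norm (A x) * norm ?w)"
        by (intro mult_left_mono ip_le_norm) simp
      \<comment> \<open>An inequality because the quotient is 0 when the image vanishes.\<close>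
      also have "\<dots> \<le> norm (A x)" by simp
      finally show "cmod (ip x y) \<le> norm (A x)" .
    qed
  qed
  then obtain K where K: "\<And>y. y \<in> Y \<Longrightarrow> norm y \<le> K" by blast
  let ?l = "complex_of_real l"
  have inj: "inj_on (op_shift T ?l) (Domain T)" and T00: "(0, 0) \<in> T"
    using \<open>?l \<in> resolvent_set T\<close> T0_zero T0_subset by (auto simp: resolvent_set_def bij_betw_def)
  have "norm u \<le> K * norm (v - ?l *\<^sub>C u)" if uv: "(u, v) \<in> T" for u v
  proof (cases "v - ?l *\<^sub>C u = 0")
    case True
    have "op_shift T ?l u = op_shift T ?l 0"
      using True linear_0[OF bounded_linear.linear[OF bounded_linear_scaleC]]
      by (simp add: op_shift_T[OF uv] op_shift_T[OF T00])
    then have "u = 0" using inj uv T00 by (meson DomainI inj_onD)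
    then show ?thesis using True by simp
  next
    case False
    have "(1 / norm (v - ?l *\<^sub>C u)) *\<^sub>R u \<in> Y" using uv by (auto simp: Y_def)
    from K[OF this] show ?thesis using False by (simp add: divide_le_eq)
  qed
  then show False using weyl_unbounded[OF weyl] by blast
qed

theorem spectrum_nonneg_axis:
  assumes noeig: "\<And>l u. 0 \<le> l \<Longrightarrow> (u, complex_of_real l *\<^sub>C u) \<in> T \<Longrightarrow> u = 0"
    and weyl: "\<And>l e. 0 \<le> l \<Longrightarrow> 0 < e \<Longrightarrow>
      \<exists>u v. (u, v) \<in> T \<and> u \<noteq> 0 \<and> norm (v - complex_of_real l *\<^sub>C u) \<le> e * norm u"
  shows "op_spectrum T = complex_of_real ` {0..}" "op_continuous_spectrum T = complex_of_real ` {0..}"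
proof -
  show "op_spectrum T = complex_of_real ` {0..}"
  proof (intro set_eqI iffI)
    fix l assume "l \<in> op_spectrum T"
    then show "l \<in> complex_of_real ` {0..}" using resolvent_outside by (auto simp: op_spectrum_def)
  next
    fix l assume "l \<in> complex_of_real ` {0..}"
    then obtain r where r: "l = complex_of_real r" "0 \<le> r" by auto
    show "l \<in> op_spectrum T"
      using not_resolvent[OF weyl[OF r(2)]] by (simp add: r(1) op_spectrum_def)
  qed
  \<comment> \<open>Off the half-line the inverse is bounded by 1 / d, so the unboundedness clause
    fails.\<close>
  have out: "l \<notin> op_continuous_spectrum T" if l: "l \<notin> complex_of_real ` {0..}" for l
  proof -
    obtain d where d: "0 < d" and lb: "\<And>u v. (u, v) \<in> T \<Longrightarrow> d * norm u \<le> norm (v - l *\<^sub>C u)"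
      using lower_bound[OF l] by blast
    have "norm (inv_into (Domain T) (op_shift T l) w) \<le> (1 / d) * norm w"
      if w: "w \<in> op_shift T l ` Domain T" for w
    proof -
      let ?u = "inv_into (Domain T) (op_shift T l) w"
      have "?u \<in> Domain T" using w by (rule inv_into_into)
      then obtain v where v: "(?u, v) \<in> T" by blast
      have "w = v - l *\<^sub>C ?u" using f_inv_into_f[OF w] op_shift_T[OF v] by simp
      with lb[OF v] have "d * norm ?u \<le> norm w" by metis
      then show ?thesis using d by (simp add: field_simps)
    qed
    then show ?thesis unfolding op_continuous_spectrum_def by blast
  qed
  have inn: "complex_of_real l \<in> op_continuous_spectrum T" if l: "0 \<le> l" for l
    unfolding op_continuous_spectrum_def
  proof (intro CollectI conjI)
    let ?l = "complex_of_real l"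
    show inj: "inj_on (op_shift T ?l) (Domain T)"
    proof (rule inj_onI)
      fix u u' assume "u \<in> Domain T" "u' \<in> Domain T" and eq: "op_shift T ?l u = op_shift T ?l u'"
      then obtain v v' where uv: "(u, v) \<in> T" "(u', v') \<in> T" by blast
      have "v - v' = ?l *\<^sub>C (u - u')"
        using eq by (simp add: op_shift_T[OF uv(1)] op_shift_T[OF uv(2)] scaleC_diff_right
            algebra_simps)
      then show "u = u'" using noeig[OF l, of "u - u'"] T_diff[OF uv] by simp
    qed
    show "closure (op_shift T ?l ` Domain T) = UNIV"
      unfolding op_shift_image
    proof (rule closure_eq_UNIV_if_orthogonal[OF complex_subspace_range])
      \<comment> \<open>Since l is its own conjugate, a vector orthogonal to the range would be an
        eigenvector for l.\<close>
      fix h assume "\<And>m. m \<in> ran ?l \<Longrightarrow> ip h m = 0"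
      then have "(h, cnj ?l *\<^sub>C h) \<in> T" by (intro orthogonal_range_eigenvector) blast
      then show "h = 0" using noeig[OF l] by simp
    qed
    show "\<not> (\<exists>K. \<forall>w\<in>op_shift T ?l ` Domain T. norm (inv_into (Domain T) (op_shift T ?l) w) \<le> K * norm w)"
    proof
      assume "\<exists>K. \<forall>w\<in>op_shift T ?l ` Domain T. norm (inv_into (Domain T) (op_shift T ?l) w) \<le> K * norm w"
      then obtain K where K: "\<And>w. w \<in> op_shift T ?l ` Domain T \<Longrightarrow>
        norm (inv_into (Domain T) (op_shift T ?l) w) \<le> K * norm w" by blast
      have "norm u \<le> K * norm (v - ?l *\<^sub>C u)" if uv: "(u, v) \<in> T" for u v
      proof -
        have "u \<in> Domain T" using uv by blast
        then show ?thesis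
          using K[OF imageI, of u] inv_into_f_f[OF inj, of u] by (simp add: op_shift_T[OF uv])
      qed
      then show False using weyl_unbounded[OF weyl[OF l]] by blast
    qed
  qed
  show "op_continuous_spectrum T = complex_of_real ` {0..}"
    using out inn by (auto intro: ccontr)
qed

end


section \<open>The sub-Laplacian as a nonnegative symmetric operator\<close>

lemma L2_seminorm_cnj: "L2_seminorm (\<lambda>p. cnj (f p)) = L2_seminorm f"
  by (simp add: L2_seminorm_def)

lemma L2_pairing_bound: "square_integrable f \<Longrightarrow> square_integrable g \<Longrightarrow> cmod (L2_pairing f g) \<le> L2_seminorm f * L2_seminorm g"
  unfolding L2_pairing_def by (metis cmod_integral_le_L2 square_integrable_cnj L2_seminorm_cnj)

lemma L2_pairing_commute: "L2_pairing g f = cnj (L2_pairing f g)"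
  unfolding L2_pairing_def by (simp add: mult.commute flip: Bochner_Integration.integral_cnj)

lemma L2_pairing_add_left:
  assumes "square_integrable f" "square_integrable g" "square_integrable k"
  shows "L2_pairing (\<lambda>p. f p + g p) k = L2_pairing f k + L2_pairing g k"
  unfolding L2_pairing_def distrib_right
  by (intro Bochner_Integration.integral_add integrable_times_L2 assms square_integrable_cnj)

lemma L2_pairing_cmult_left: "L2_pairing (\<lambda>p. c * f p) g = c * L2_pairing f g"
  unfolding L2_pairing_def by (simp add: mult.assoc)

lemma L2_pairing_cmult_right: "L2_pairing f (\<lambda>p. c * g p) = cnj c * L2_pairing f g"
  using L2_pairing_cmult_left[of c g f] by (metis L2_pairing_commute complex_cnj_mult)

lemma L2_pairing_diff_left:
  assumes "square_integrable f" "square_integrable g" "square_integrable k"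
  shows "L2_pairing (\<lambda>p. f p - g p) k = L2_pairing f k - L2_pairing g k"
  using L2_pairing_add_left[OF assms(1) square_integrable_scale[OF assms(2), of "-1"] assms(3)] L2_pairing_cmult_left[of "-1" g k] by simp

lemma L2_pairing_diff_right:
  assumes "square_integrable f" "square_integrable g" "square_integrable k"
  shows "L2_pairing k (\<lambda>p. f p - g p) = L2_pairing k f - L2_pairing k g"
  using L2_pairing_diff_left[OF assms] by (metis L2_pairing_commute complex_cnj_diff)

lemma L2_pairing_self: "L2_pairing f f = complex_of_real ((L2_seminorm f)\<^sup>2)"
proof -
  have "L2_pairing f f = (LINT p|lborel. complex_of_real ((cmod (f p))\<^sup>2))"
    unfolding L2_pairing_def by (simp only: complex_norm_square)
  then show ?thesis by (simp only: integral_complex_of_real L2_seminorm_sq)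
qed

lift_definition L2_inner :: "heisenberg L2 \<Rightarrow> heisenberg L2 \<Rightarrow> complex" is L2_pairing
proof -
  fix f f' g g' :: "heisenberg \<Rightarrow> complex"
  assume a: "L2_rel f f'" "L2_rel g g'"
  then have "AE p in lborel. f p = f' p" "AE p in lborel. g p = g' p" by (auto simp: L2_rel_def)
  then have ae: "AE p in lborel. f p * cnj (g p) = f' p * cnj (g' p)" by eventually_elim simp
  show "L2_pairing f g = L2_pairing f' g'"
    unfolding L2_pairing_def
  proof (rule integral_cong_AE[OF _ _ ae])
    show "(\<lambda>p. f p * cnj (g p)) \<in> borel_measurable lborel" "(\<lambda>p. f' p * cnj (g' p)) \<in> borel_measurable lborel"
      using a by (auto simp only: L2_rel_def intro!: borel_measurable_integrable integrable_times_L2 square_integrable_cnj)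
  qed
qed

lemma L2_cases:
  obtains U where "square_integrable U" "u = L2_class U"
  using square_integrable_rep_L2[of u] that by force

lemma integral_cnj_mult: "(LINT w|lborel. cnj (f w) * g w) = cnj (L2_pairing f g)"
  by (simp add: L2_pairing_def flip: Bochner_Integration.integral_cnj)

lemma L2_rel_refl: "square_integrable f \<Longrightarrow> L2_rel f f"
  by (simp add: L2_rel_def)

lemma L2_inner_class:
  "square_integrable f \<Longrightarrow> square_integrable g \<Longrightarrow> L2_inner (L2_class f) (L2_class g) = L2_pairing f g"
  by (intro L2_inner.abs_eq L2_rel_refl)

lemma L2_class_add:
  "square_integrable f \<Longrightarrow> square_integrable g \<Longrightarrow> L2_class f + L2_class g = L2_class (\<lambda>p. f p + g p)"
  by (intro plus_L2.abs_eq L2_rel_refl)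

lemma L2_class_scaleC: "square_integrable f \<Longrightarrow> c *\<^sub>C L2_class f = L2_class (\<lambda>p. c * f p)"
  by (intro scaleC_L2.abs_eq L2_rel_refl)

lemma L2_class_eq_0: "square_integrable f \<Longrightarrow> AE p in lborel. f p = 0 \<Longrightarrow> L2_class f = 0"
  using norm_L2_class[of f] L2_seminorm_zero_iff[of f] by (metis norm_eq_zero)

interpretation L2: hilbert_product L2_inner
proof
  fix x y z :: "heisenberg L2" and c :: complex
  show "L2_inner (x + y) z = L2_inner x z + L2_inner y z"
    by transfer (simp add: L2_rel_def L2_pairing_add_left)
  show "L2_inner (c *\<^sub>C x) z = c * L2_inner x z"
    by transfer (rule L2_pairing_cmult_left)
  show "L2_inner y x = cnj (L2_inner x y)"
    by transfer (rule L2_pairing_commute)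
  show "L2_inner x x = complex_of_real ((norm x)\<^sup>2)"
    by transfer (rule L2_pairing_self)
  show "cmod (L2_inner x y) \<le> norm x * norm y"
    by transfer (simp add: L2_rel_def L2_pairing_bound)
qed

text \<open>Antisymmetry moves one copy of each field across, producing the Dirichlet form, from
  which symmetry and nonnegativity are both read off.\<close>

lemma L2_pairing_sub_laplacian:
  assumes f: "f \<in> schwartz_space" and g: "g \<in> schwartz_space"
  shows "L2_pairing (sub_laplacian f) g = L2_pairing (hX f) (hX g) + L2_pairing (hY f) (hY g)"
proof -
  note s = schwartz_square_integrable hderiv_schwartz f g
  have "L2_pairing (sub_laplacian f) g = - L2_pairing (\<lambda>p. hX (hX f) p + hY (hY f) p) g"
    unfolding sub_laplacian_eq[OF f] L2_pairing_cmult_left by simp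
  also have "\<dots> = - (L2_pairing (hX (hX f)) g + L2_pairing (hY (hY f)) g)"
    by (subst L2_pairing_add_left) (intro s refl)+
  also have "\<dots> = L2_pairing (hX f) (hX g) + L2_pairing (hY f) (hY g)"
    using f g by (simp add: hderiv_antisymmetric hderiv_schwartz)
  finally show ?thesis .
qed

lemma L2_pairing_sub_laplacian_commute:
  assumes "f \<in> schwartz_space" "g \<in> schwartz_space"
  shows "L2_pairing (sub_laplacian f) g = L2_pairing f (sub_laplacian g)"
  unfolding L2_pairing_sub_laplacian[OF assms] L2_pairing_commute[of f "sub_laplacian g"] L2_pairing_sub_laplacian[OF assms(2,1)]
  by (simp flip: L2_pairing_commute)

lemma L2_pairing_sub_laplacian_self:
  assumes "f \<in> schwartz_space"
  shows "Re (L2_pairing (sub_laplacian f) f) = (L2_seminorm (hX f))\<^sup>2 + (L2_seminorm (hY f))\<^sup>2"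
  unfolding L2_pairing_sub_laplacian[OF assms assms] L2_pairing_self by simp

text \<open>The common end of two totality proofs, for the Schwartz space and for the range of L +
  1: it is enough to annihilate left translates of kernels on which the two sub-Laplacians
  agree.\<close>

lemma gaussian_test_total:
  assumes h: "square_integrable h"
    and zero: "\<And>k p. k \<in> schwartz_space \<Longrightarrow> (\<And>q. right_laplacian k q = sub_laplacian k q) \<Longrightarrow>
      (LINT w|lborel. h w * k (hmult (- p) w)) = 0"
  shows "AE w in lborel. h w = 0"
proof (rule gaussian_translates_total[OF h])
  fix p r assume "1 \<le> (r::real)"
  then have r: "r \<noteq> 0" by simp
  show "(LINT w|lborel. h w * gauss 0 (hdil r (hmult (- p) w))) = 0"
    by (rule zero[of "\<lambda>q. gauss 0 (hdil r q)"]) (intro schwartz_hdil gauss_schwartz r right_laplacian_gauss_hdil)+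
qed

lemma sub_laplacian_opE:
  assumes "(u, v) \<in> sub_laplacian_op"
  obtains f where "f \<in> schwartz_space" "u = L2_class f" "v = L2_class (sub_laplacian f)"
  using assms by (auto simp: sub_laplacian_op_def)

lemma sub_laplacian_opI: "f \<in> schwartz_space \<Longrightarrow> (L2_class f, L2_class (sub_laplacian f)) \<in> sub_laplacian_op"
  by (auto simp: sub_laplacian_op_def)

lemmas schwartz_L2 = schwartz_square_integrable schwartz_square_integrable[OF sub_laplacian_schwartz]

lemma schwartz_total:
  assumes h: "\<And>f. f \<in> schwartz_space \<Longrightarrow> L2_inner h (L2_class f) = 0"
  shows "h = 0"
proof -
  obtain H where H: "square_integrable H" "h = L2_class H" by (rule L2_cases)
  have "AE w in lborel. cnj (H w) = 0"
  proof (rule gaussian_test_total[OF square_integrable_cnj[OF H(1)]])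
    fix k :: "heisenberg \<Rightarrow> complex" and p assume "k \<in> schwartz_space"
    then have s: "(\<lambda>w. k (hmult (- p) w)) \<in> schwartz_space" by (rule schwartz_hmult)
    show "(LINT w|lborel. cnj (H w) * k (hmult (- p) w)) = 0"
      using h[OF s] H schwartz_L2(1)[OF s] by (simp add: L2_inner_class integral_cnj_mult)
  qed
  then show ?thesis using L2_class_eq_0[OF H(1)] H(2) by simp
qed

interpretation sub_laplacian: positive_symmetric L2_inner sub_laplacian_op
proof
  have "L2_class (\<lambda>_::heisenberg. 0) = 0" by (intro L2_class_eq_0) auto
  moreover have "sub_laplacian (\<lambda>_. 0) = (\<lambda>_. 0)"
    using sub_laplacian_cmult[OF schwartz_zero, of 0] by simp
  ultimately show "(0, 0) \<in> sub_laplacian_op"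
    using sub_laplacian_opI[OF schwartz_zero] by simp
next
  fix u v u' v' assume "(u, v) \<in> sub_laplacian_op" "(u', v') \<in> sub_laplacian_op"
  then obtain f g where f: "f \<in> schwartz_space" "u = L2_class f" "v = L2_class (sub_laplacian f)"
    and g: "g \<in> schwartz_space" "u' = L2_class g" "v' = L2_class (sub_laplacian g)"
    by (metis sub_laplacian_opE)
  show "(u + u', v + v') \<in> sub_laplacian_op"
    using sub_laplacian_opI[OF schwartz_add[OF f(1) g(1)]]
    by (simp add: f g L2_class_add schwartz_L2 sub_laplacian_add)
  show "L2_inner v u' = L2_inner u v'"
    by (simp add: f g L2_inner_class schwartz_L2 L2_pairing_sub_laplacian_commute)
next
  fix u v c assume "(u, v) \<in> sub_laplacian_op"
  then obtain f where f: "f \<in> schwartz_space" "u = L2_class f" "v = L2_class (sub_laplacian f)"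
    by (rule sub_laplacian_opE)
  show "(c *\<^sub>C u, c *\<^sub>C v) \<in> sub_laplacian_op"
    using sub_laplacian_opI[OF schwartz_cmult[OF f(1), of c]]
    by (simp add: f L2_class_scaleC schwartz_L2 sub_laplacian_cmult)
  show "0 \<le> Re (L2_inner v u)"
    by (simp add: f L2_inner_class schwartz_L2 L2_pairing_sub_laplacian_self)
next
  fix h assume "\<And>u v. (u, v) \<in> sub_laplacian_op \<Longrightarrow> L2_inner h u = 0"
  then show "h = 0" using sub_laplacian_opI by (intro schwartz_total) blast
next
  fix h assume h: "\<And>u v. (u, v) \<in> sub_laplacian_op \<Longrightarrow> L2_inner h (v + u) = 0"
  obtain H where H: "square_integrable H" "h = L2_class H" by (rule L2_cases)
  have o: "(LINT w|lborel. cnj (H w) * (sub_laplacian f w + f w)) = 0" if f: "f \<in> schwartz_space" for f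
  proof -
    have "square_integrable (\<lambda>w. sub_laplacian f w + f w)" by (intro square_integrable_add schwartz_L2 f)
    then show ?thesis
      using h[OF sub_laplacian_opI[OF f]] H f by (simp add: L2_class_add schwartz_L2 L2_inner_class integral_cnj_mult)
  qed
  have "AE w in lborel. cnj (H w) = 0"
    by (rule gaussian_test_total[OF square_integrable_cnj[OF H(1)]])
      (rule convolution_vanishes[OF square_integrable_cnj[OF H(1)] o])
  then show "h = 0" using L2_class_eq_0[OF H(1)] H(2) by simp
qed

lemma sub_laplacian_closure_eq: "sub_laplacian_closure = sub_laplacian.T"
  by (simp add: sub_laplacian_closure_def sub_laplacian.T_def)

text \<open>Density follows from totality by the projection argument, applied to the complex
  subspace of Schwartz classes.\<close>

lemma schwartz_dense:
  fixes U :: "heisenberg \<Rightarrow> complex"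
  assumes U: "square_integrable U" and e: "0 < e"
  obtains f where "f \<in> schwartz_space" "L2_seminorm (\<lambda>p. U p - f p) < e"
proof -
  have "closure (L2_class ` schwartz_space) = (UNIV :: heisenberg L2 set)"
  proof (rule L2.closure_eq_UNIV_if_orthogonal)
    show "L2.complex_subspace (L2_class ` schwartz_space)"
      unfolding L2.complex_subspace_def
    proof (intro conjI ballI allI)
      have "L2_class (\<lambda>_::heisenberg. 0) = 0" by (intro L2_class_eq_0) auto
      then show "0 \<in> L2_class ` (schwartz_space :: (heisenberg \<Rightarrow> complex) set)"
        by (intro image_eqI[of _ _ "\<lambda>_. 0"]) (simp_all add: schwartz_zero)
    next
      fix x y :: "heisenberg L2" assume "x \<in> L2_class ` schwartz_space" "y \<in> L2_class ` schwartz_space"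
      then show "x + y \<in> L2_class ` schwartz_space"
        by (auto simp: L2_class_add schwartz_L2 intro!: imageI schwartz_add)
    next
      fix c and x :: "heisenberg L2" assume "x \<in> L2_class ` schwartz_space"
      then show "c *\<^sub>C x \<in> L2_class ` schwartz_space"
        by (auto simp: L2_class_scaleC schwartz_L2 intro!: imageI schwartz_cmult)
    qed
  qed (use schwartz_total in blast)
  then have "L2_class U \<in> closure (L2_class ` schwartz_space)" by simp
  then obtain f where f: "f \<in> schwartz_space" "dist (L2_class f) (L2_class U) < e"
    using e unfolding closure_approachable by blast
  then have "L2_seminorm (\<lambda>p. U p - f p) < e"
    using norm_diff_L2_class[OF U schwartz_L2(1)[OF f(1)]] by (simp add: dist_norm norm_minus_commute)
  then show ?thesis using f(1) that by blast
qed

lemma sub_laplacian_T_iff: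
  assumes U: "square_integrable U" and V: "square_integrable V"
  shows "(L2_class U, L2_class V) \<in> sub_laplacian.T \<longleftrightarrow> (\<exists>F. (\<forall>n. F n \<in> schwartz_space)
    \<and> (\<lambda>n. L2_seminorm (\<lambda>p. F n p - U p)) \<longlonglongrightarrow> 0 \<and> (\<lambda>n. L2_seminorm (\<lambda>p. sub_laplacian (F n) p - V p)) \<longlonglongrightarrow> 0)"
    (is "_ \<longleftrightarrow> ?R")
proof -
  have l: "(\<lambda>n. L2_class (G n)) \<longlonglongrightarrow> L2_class W \<longleftrightarrow> (\<lambda>n. L2_seminorm (\<lambda>p. G n p - W p)) \<longlonglongrightarrow> 0"
    if "\<And>n. square_integrable (G n)" "square_integrable W" for G and W :: "heisenberg \<Rightarrow> complex"
    unfolding norm_diff_L2_class[OF that, symmetric] tendsto_norm_zero_iff by (rule LIM_zero_iff[symmetric])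
  show ?thesis
  proof
    assume "(L2_class U, L2_class V) \<in> sub_laplacian.T"
    then obtain f g where fg: "\<And>n. (f n, g n) \<in> sub_laplacian_op" "f \<longlonglongrightarrow> L2_class U" "g \<longlonglongrightarrow> L2_class V"
      by (auto simp: sub_laplacian.T_sequential)
    have "\<forall>n. \<exists>F. F \<in> schwartz_space \<and> f n = L2_class F \<and> g n = L2_class (sub_laplacian F)"
      using fg(1) by (metis sub_laplacian_opE)
    then obtain F where F: "\<And>n. F n \<in> schwartz_space" "f = (\<lambda>n. L2_class (F n))" "g = (\<lambda>n. L2_class (sub_laplacian (F n)))"
      by metis
    show ?R
      using F(1) fg(2,3) U V unfolding F(2,3) by (subst (asm) (1 2) l) (auto intro: schwartz_L2)
  next
    assume ?R
    then obtain F where F: "\<And>n. F n \<in> schwartz_space"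
      "(\<lambda>n. L2_seminorm (\<lambda>p. F n p - U p)) \<longlonglongrightarrow> 0" "(\<lambda>n. L2_seminorm (\<lambda>p. sub_laplacian (F n) p - V p)) \<longlonglongrightarrow> 0" by blast
    have "(\<lambda>n. L2_class (F n)) \<longlonglongrightarrow> L2_class U" "(\<lambda>n. L2_class (sub_laplacian (F n))) \<longlonglongrightarrow> L2_class V"
      using F U V by (subst l; auto intro: schwartz_L2)+
    then show "(L2_class U, L2_class V) \<in> sub_laplacian.T"
      unfolding sub_laplacian.T_sequential using sub_laplacian_opI[OF F(1)]
      by (intro exI[of _ "\<lambda>n. L2_class (F n)"] exI[of _ "\<lambda>n. L2_class (sub_laplacian (F n))"]) simp
  qed
qed


section \<open>Absence of eigenvalues\<close>

text \<open>L is homogeneous of degree two and a dilation rescales all L2 norms by the same factor,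
  so approximating sequences in the graph are dilated term by term. The eigenvalue c becomes r^2
  c.\<close>

lemma dilate_eigenfunction:
  assumes U: "square_integrable U" and r: "0 < r"
    and eig: "(L2_class U, L2_class (\<lambda>p. c * U p)) \<in> sub_laplacian.T"
  shows "(L2_class (\<lambda>p. U (hdil r p)), L2_class (\<lambda>p. complex_of_real (r\<^sup>2) * c * U (hdil r p))) \<in> sub_laplacian.T"
proof -
  have r0: "r \<noteq> 0" "r\<^sup>2 \<noteq> 0" using r by auto
  have Ur: "square_integrable (\<lambda>p. U (hdil r p))" unfolding hdil_def by (intro square_integrable_haff U r0)
  obtain F where F: "\<And>n. F n \<in> schwartz_space"
      "(\<lambda>n. L2_seminorm (\<lambda>p. F n p - U p)) \<longlonglongrightarrow> 0" "(\<lambda>n. L2_seminorm (\<lambda>p. sub_laplacian (F n) p - c * U p)) \<longlonglongrightarrow> 0"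
    using eig sub_laplacian_T_iff[OF U square_integrable_scale[OF U]] by blast
  define \<kappa> where "\<kappa> = sqrt (r\<^sup>2 * \<bar>r\<^sup>2\<bar>)"
  have k: "\<kappa> \<noteq> 0" using r by (simp add: \<kappa>_def)
  have dil: "L2_seminorm (\<lambda>p. W (hdil r p)) = L2_seminorm W / \<kappa>" if "square_integrable W" for W
    using square_integrable_haff(2)[OF that r0, of 0 0 0] k by (simp add: hdil_def \<kappa>_def)
  have d1: "square_integrable (\<lambda>p. F n p - U p)" "square_integrable (\<lambda>p. sub_laplacian (F n) p - c * U p)" for n
    by (intro square_integrable_diff schwartz_L2 F U square_integrable_scale)+
  show ?thesis
    unfolding sub_laplacian_T_iff[OF Ur square_integrable_scale[OF Ur]]
  proof (intro exI[of _ "\<lambda>n p. F n (hdil r p)"] conjI allI)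
    show "(\<lambda>p. F n (hdil r p)) \<in> schwartz_space" for n by (intro schwartz_hdil F r0)
    show "(\<lambda>n. L2_seminorm (\<lambda>p. F n (hdil r p) - U (hdil r p))) \<longlonglongrightarrow> 0"
      using tendsto_divide[OF F(2) tendsto_const[of \<kappa>] k] by (simp add: dil[OF d1(1)])
    have "(\<lambda>p. sub_laplacian (\<lambda>p. F n (hdil r p)) p - complex_of_real (r\<^sup>2) * c * U (hdil r p))
      = (\<lambda>p. complex_of_real (r\<^sup>2) * (sub_laplacian (F n) (hdil r p) - c * U (hdil r p)))" for n
      by (simp add: sub_laplacian_hdil[OF F(1) r0(1)] algebra_simps)
    then have "L2_seminorm (\<lambda>p. sub_laplacian (\<lambda>p. F n (hdil r p)) p - complex_of_real (r\<^sup>2) * c * U (hdil r p))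
      = r\<^sup>2 * (L2_seminorm (\<lambda>p. sub_laplacian (F n) p - c * U p) / \<kappa>)" for n
      by (simp only: L2_seminorm_scale dil[OF d1(2)]) (simp add: norm_power)
    moreover have "(\<lambda>n. r\<^sup>2 * (L2_seminorm (\<lambda>p. sub_laplacian (F n) p - c * U p) / \<kappa>)) \<longlonglongrightarrow> r\<^sup>2 * (0 / \<kappa>)"
      by (intro tendsto_intros F k)
    ultimately show "(\<lambda>n. L2_seminorm (\<lambda>p. sub_laplacian (\<lambda>p. F n (hdil r p)) p - complex_of_real (r\<^sup>2) * c * U (hdil r p))) \<longlonglongrightarrow> 0"
      by simp
  qed
qed

lemma no_positive_eigenvalue:
  assumes l: "0 < l" and eig: "(u, complex_of_real l *\<^sub>C u) \<in> sub_laplacian.T"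
  shows "u = 0"
proof -
  obtain U where U: "square_integrable U" "u = L2_class U" by (rule L2_cases)
  let ?l = "complex_of_real l"
  have eU: "(L2_class U, L2_class (\<lambda>p. ?l * U p)) \<in> sub_laplacian.T"
    using eig U by (simp add: L2_class_scaleC)
  have Ur: "square_integrable (\<lambda>p. U (hdil r p))" if "0 < r" for r
    unfolding hdil_def using that by (intro square_integrable_haff U) auto
  \<comment> \<open>The eigenvalues l and r^2 l are real and differ for positive r other than 1, so
    symmetry forces orthogonality.\<close>
  have orth: "L2_pairing U (\<lambda>p. U (hdil r p)) = 0" if r: "0 < r" "r \<noteq> 1" for r
  proof -
    let ?W = "\<lambda>p. U (hdil r p)"
    have "L2_inner (L2_class (\<lambda>p. ?l * U p)) (L2_class ?W) = L2_inner (L2_class U) (L2_class (\<lambda>p. complex_of_real (r\<^sup>2) * ?l * ?W p))"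
      by (rule sub_laplacian.T_sym[OF eU dilate_eigenfunction[OF U(1) r(1) eU]])
    then have "?l * L2_pairing U ?W = cnj (complex_of_real (r\<^sup>2) * ?l) * L2_pairing U ?W"
      using U Ur[OF r(1)] by (simp only: L2_inner_class square_integrable_scale L2_pairing_cmult_left L2_pairing_cmult_right)
    then have "complex_of_real (l * (1 - r\<^sup>2)) * L2_pairing U ?W = 0" by (simp add: algebra_simps)
    moreover have "l * (1 - r\<^sup>2) \<noteq> 0" using l r by (auto simp: power2_eq_1_iff)
    ultimately show ?thesis by (simp only: mult_eq_0_iff of_real_eq_0_iff) simp
  qed
  \<comment> \<open>U is replaced by a Schwartz approximant f, whose dilates converge when paired
    with U. Replacing the dilated U by the dilated f costs 4 e, and replacing U by f at r = 1 costs
    e.\<close>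
  have small: "(L2_seminorm U)\<^sup>2 \<le> 5 * L2_seminorm U * e" if e: "0 < e" for e
  proof -
    obtain f where f: "f \<in> schwartz_space" "L2_seminorm (\<lambda>p. U p - f p) < e" using schwartz_dense[OF U(1) e] by blast
    note sf = schwartz_L2(1)[OF f(1)]
    have fr: "square_integrable (\<lambda>p. f (hdil r p))" if "0 < r" for r
      unfolding hdil_def using that by (intro square_integrable_haff sf) auto
    have fm: "(\<lambda>p. cnj (f (hdil r p))) \<in> borel_measurable borel" for r
      by (intro borel_measurable_continuous_onI continuous_on_cnj continuous_on_schwartz_compose[OF f(1)] continuous_on_hdil continuous_on_id)
    obtain C where C: "\<And>(p::heisenberg) q. 1 + norm p \<le> 4 * (1 + norm q) \<Longrightarrow> cmod (f q) \<le> C * decay p"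
      using schwartz_decay_bound[OF f(1) zero_less_numeral] by blast
    have lim: "((\<lambda>r. L2_pairing U (\<lambda>p. f (hdil r p))) \<longlongrightarrow> L2_pairing U f) (at 1)"
      unfolding L2_pairing_def
    proof (rule pairing_tendsto[OF U(1) fm])
      show "(\<lambda>p. cnj (f p)) \<in> borel_measurable borel" using fm[of 1] by (simp add: hdil_def haff_def zero_prod_def case_prod_beta)
      show "((\<lambda>r. cnj (f (hdil r p))) \<longlongrightarrow> cnj (f p)) (at 1)" for p
      proof -
        obtain x y t where p: "p = (x, y, t)" by (cases p)
        have "((\<lambda>r. (r * x, r * y, r\<^sup>2 * t)) \<longlongrightarrow> (1 * x, 1 * y, 1\<^sup>2 * t)) (at 1)" by (intro tendsto_intros)
        then have d: "((\<lambda>r. hdil r p) \<longlongrightarrow> p) (at 1)" by (simp add: p hdil_eq)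
        have "isCont f p" using schwartz_continuous[OF f(1)] by (simp add: continuous_on_eq_continuous_at del: split_paired_All)
        from tendsto_cnj[OF isCont_tendsto_compose[OF this d]] show ?thesis .
      qed
      show "(0::real) < 1 / 2" by simp
      fix r :: real and p :: heisenberg assume "dist r 1 < 1 / 2"
      then have r: "1 / 2 < r" unfolding dist_real_def abs_less_iff by argo
      obtain x y t where p: "p = (x, y, t)" by (cases p)
      \<comment> \<open>For r > 1/2 the dilation by 1 / (2 r) is a contraction recovering p. Since
        dilation by 2 expands norms at most fourfold, the comparison constant is 4.\<close>
      have "norm p \<le> norm (hdil 2 (hdil r p))"
      proof -
        have "hdil (1 / (2 * r)) (hdil 2 (hdil r p)) = p" using r by (simp add: p hdil_eq power_divide power_mult_distrib)
        then show ?thesis using norm_hdil_le[of "1 / (2 * r)" "hdil 2 (hdil r p)"] r by simp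
      qed
      also have "\<dots> \<le> 4 * norm (hdil r p)"
      proof -
        have "norm (hdil 2 q) \<le> 4 * norm q" for q
        proof -
          obtain a b c where q: "q = (a, b, c)" by (cases q)
          have "hdil 2 q = 4 *\<^sub>R (a / 2, b / 2, c)" by (simp add: q hdil_eq)
          then have "norm (hdil 2 q) = 4 * norm (a / 2, b / 2, c)" by (simp only: norm_scaleR abs_numeral)
          also have "norm (a / 2, b / 2, c) \<le> norm q"
          proof -
            have "a\<^sup>2 / 4 + b\<^sup>2 / 4 \<le> a\<^sup>2 + b\<^sup>2" using zero_le_power2[of a] zero_le_power2[of b] by argo
            then show ?thesis by (auto simp: q norm_Pair power_divide intro!: real_sqrt_le_mono)
          qed
          finally show ?thesis by simp
        qed
        then show ?thesis .
      qed
      finally show "cmod (cnj (f (hdil r p))) \<le> C * decay p" by (simp add: C)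
    qed
    \<comment> \<open>Dilation divides the L2 norm by r^2, which exceeds 1/4 here.\<close>
    have dl: "L2_seminorm (\<lambda>p. U (hdil r p) - f (hdil r p)) \<le> 4 * e" if r: "1 / 2 < r" for r
    proof -
      have rr: "r \<noteq> 0" "r\<^sup>2 \<noteq> 0" using r by auto
      have q: "1 / 4 \<le> r\<^sup>2" using power_mono[of "1/2" r 2] r by (simp add: power2_eq_square)
      have "L2_seminorm (\<lambda>p. U p - f p) = sqrt (r\<^sup>2 * \<bar>r\<^sup>2\<bar>) * L2_seminorm (\<lambda>p. U (hdil r p) - f (hdil r p))"
        unfolding hdil_def by (rule square_integrable_haff(2)[OF square_integrable_diff[OF U(1) sf] rr])
      also have "sqrt (r\<^sup>2 * \<bar>r\<^sup>2\<bar>) = r\<^sup>2" by (rule real_sqrt_unique) (simp_all add: power2_eq_square)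
      finally have "r\<^sup>2 * L2_seminorm (\<lambda>p. U (hdil r p) - f (hdil r p)) \<le> e" using f(2) by simp
      moreover have "1 / 4 * L2_seminorm (\<lambda>p. U (hdil r p) - f (hdil r p)) \<le> r\<^sup>2 * L2_seminorm (\<lambda>p. U (hdil r p) - f (hdil r p))"
        by (intro mult_right_mono q L2_seminorm_nonneg)
      ultimately show ?thesis by simp
    qed
    have "cmod (L2_pairing U f) \<le> 4 * L2_seminorm U * e"
    proof (rule tendsto_upperbound[OF tendsto_norm[OF lim]])
      show "\<forall>\<^sub>F r in at 1. cmod (L2_pairing U (\<lambda>p. f (hdil r p))) \<le> 4 * L2_seminorm U * e"
        unfolding eventually_at
      proof (intro exI[of _ "1 / 2"] conjI ballI impI)
        fix r :: real assume "r \<noteq> 1 \<and> dist r 1 < 1 / 2"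
        then have "r \<noteq> 1" "\<bar>r - 1\<bar> < 1 / 2" by (auto simp: dist_real_def)
        then have r: "1 / 2 < r" "r \<noteq> 1" unfolding abs_less_iff by argo+
        then have r0: "0 < r" by simp
        have "L2_pairing U (\<lambda>p. U (hdil r p) - f (hdil r p)) = - L2_pairing U (\<lambda>p. f (hdil r p))"
          using orth[OF r0 r(2)] by (simp add: L2_pairing_diff_right U(1) Ur[OF r0] fr[OF r0])
        then have "cmod (L2_pairing U (\<lambda>p. f (hdil r p))) = cmod (L2_pairing U (\<lambda>p. U (hdil r p) - f (hdil r p)))" by simp
        also have "\<dots> \<le> L2_seminorm U * L2_seminorm (\<lambda>p. U (hdil r p) - f (hdil r p))"
          by (intro L2_pairing_bound U square_integrable_diff Ur fr r0)
        also have "\<dots> \<le> L2_seminorm U * (4 * e)" by (intro mult_left_mono dl r L2_seminorm_nonneg)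
        finally show "cmod (L2_pairing U (\<lambda>p. f (hdil r p))) \<le> 4 * L2_seminorm U * e" by simp
      qed simp
    qed simp
    moreover have "cmod (L2_pairing U (\<lambda>p. U p - f p)) \<le> L2_seminorm U * e"
      using L2_pairing_bound[OF U(1) square_integrable_diff[OF U(1) sf]] mult_left_mono[OF less_imp_le[OF f(2)] L2_seminorm_nonneg[of U]]
      by linarith
    moreover have "L2_pairing U U = L2_pairing U (\<lambda>p. U p - f p) + L2_pairing U f" by (simp add: L2_pairing_diff_right U(1) sf)
    then have "cmod (L2_pairing U U) \<le> cmod (L2_pairing U (\<lambda>p. U p - f p)) + cmod (L2_pairing U f)" by (metis norm_triangle_ineq)
    ultimately show ?thesis by (simp add: L2_pairing_self norm_power)
  qed
  have "L2_seminorm U = 0"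
  proof (rule ccontr)
    assume "L2_seminorm U \<noteq> 0"
    then have n: "0 < L2_seminorm U" using L2_seminorm_nonneg[of U] by simp
    \<comment> \<open>With e equal to a tenth of the norm, the estimate says that the squared norm
      is at most half of itself.\<close>
    have "(L2_seminorm U)\<^sup>2 \<le> 5 * L2_seminorm U * (L2_seminorm U / 10)" by (rule small) (use n in simp)
    then show False using n by (simp add: power2_eq_square)
  qed
  then show ?thesis using norm_L2_class[OF U(1)] U(2) by simp
qed

section \<open>Null vectors and transport along the flow of X\<close>

lemma hderiv_hflow:
  assumes "f \<in> schwartz_space"
  shows "hderiv \<sigma> a b (\<lambda>p. f (hflow \<sigma> a b s p)) = (\<lambda>p. hderiv \<sigma> a b f (hflow \<sigma> a b s p))"
proof -
  have "haff_linear 1 1 (2 * \<sigma> * s * b) (- (2 * \<sigma> * s * a)) (hvec \<sigma> a b p)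
    = 1 *\<^sub>R hvec \<sigma> a b (haff 1 1 (2 * \<sigma> * s * b) (- (2 * \<sigma> * s * a)) (s * a, s * b, 0) p)" for p
    by (cases p) (simp add: haff_linear_def haff_def hvec_def algebra_simps)
  from hderiv_haff[OF assms this] show ?thesis by (simp add: hflow_haff)
qed

lemma schwartz_hflow: "f \<in> schwartz_space \<Longrightarrow> (\<lambda>p. f (hflow \<sigma> a b s p)) \<in> schwartz_space"
  unfolding hflow_haff by (rule schwartz_haff) auto

text \<open>The x-coordinate advances at unit speed, so the norm grows without bound and first-order
  decay of f suffices.\<close>

lemma hflow_X_escapes:
  assumes f: "f \<in> schwartz_space"
  shows "(\<lambda>n. f (hflow 1 1 0 (real n) p)) \<longlonglongrightarrow> 0"
proof -
  obtain x y t where p: "p = (x, y, t)" by (cases p)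
  obtain C where C: "\<And>q. norm q ^ 1 * cmod (f q) \<le> C"
    using schwartz_rapidly_decreasing[OF f] unfolding rapidly_decreasing_def by blast
  have le: "cmod (f (hflow 1 1 0 (real n) p)) \<le> C / (real n + x)" if "0 < real n + x" for n
  proof -
    have "real n + x \<le> norm (hflow 1 1 0 (real n) p)"
      using heis_norm_bounds(1)[of "x + real n" y "t + real n * (2 * (0 - y))"] by (simp add: hflow_def hvec_def p)
    then have "(real n + x) * cmod (f (hflow 1 1 0 (real n) p)) \<le> C"
      using C[of "hflow 1 1 0 (real n) p"] mult_right_mono[OF _ norm_ge_zero] by (metis order_trans power_one_right)
    then show ?thesis using that by (simp add: pos_le_divide_eq mult.commute)
  qed
  have "filterlim (\<lambda>n. real n + x) at_top sequentially"
    using filterlim_tendsto_add_at_top[OF tendsto_const filterlim_real_sequentially, of x] by (simp add: add.commute)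
  then have "(\<lambda>n. C / (real n + x)) \<longlonglongrightarrow> 0"
    by (intro tendsto_divide_0[OF tendsto_const] filterlim_at_top_imp_at_infinity)
  moreover have "eventually (\<lambda>n. cmod (f (hflow 1 1 0 (real n) p)) \<le> C / (real n + x)) sequentially"
  proof -
    obtain N :: nat where "- x < real N" using reals_Archimedean2 by blast
    then show ?thesis unfolding eventually_sequentially by (intro exI[of _ N] allI impI le) (use of_nat_mono in fastforce)
  qed
  ultimately show ?thesis by (rule Lim_null_comparison[rotated])
qed

text \<open>A null vector \<open>u\<close> is orthogonal to the range of \<open>X\<close>, so its pairing with \<open>f\<close> does not change when
  \<open>f\<close> is transported along the flow of \<open>X\<close>; but the transported functions tend weakly to \<open>0\<close>.\<close>

lemma no_zero_eigenvalue:
  assumes eig: "(u, 0) \<in> sub_laplacian.T"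
  shows "u = 0"
proof -
  obtain U where U: "square_integrable U" "u = L2_class U" by (rule L2_cases)
  define h where "h p = cnj (U p)" for p
  have h: "square_integrable h" unfolding h_def by (rule square_integrable_cnj[OF U(1)])
  have z: "L2_class (\<lambda>_::heisenberg. 0) = 0" by (intro L2_class_eq_0) auto
  obtain F where F: "\<And>n. F n \<in> schwartz_space"
      "(\<lambda>n. L2_seminorm (\<lambda>p. F n p - U p)) \<longlonglongrightarrow> 0" "(\<lambda>n. L2_seminorm (\<lambda>p. sub_laplacian (F n) p - 0)) \<longlonglongrightarrow> 0"
    using eig sub_laplacian_T_iff[OF U(1), of "\<lambda>_. 0"] by (auto simp: U(2) z)
  have LF: "(\<lambda>n. L2_seminorm (sub_laplacian (F n))) \<longlonglongrightarrow> 0" using F(3) by simp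
  \<comment> \<open>The Dirichlet form dominates |X F|^2 and is at most |L F| |F|, where L F tends
    to 0 and F stays bounded.\<close>
  have XF: "(\<lambda>n. L2_seminorm (hX (F n))) \<longlonglongrightarrow> 0"
  proof -
    have b: "(L2_seminorm (hX (F n)))\<^sup>2 \<le> L2_seminorm (sub_laplacian (F n)) * (L2_seminorm (\<lambda>p. F n p - U p) + L2_seminorm U)" for n
    proof -
      have "(L2_seminorm (hX (F n)))\<^sup>2 \<le> Re (L2_pairing (sub_laplacian (F n)) (F n))"
        using L2_pairing_sub_laplacian_self[OF F(1)] by simp
      also have "\<dots> \<le> L2_seminorm (sub_laplacian (F n)) * L2_seminorm (F n)"
        using complex_Re_le_cmod L2_pairing_bound[OF schwartz_L2(2)[OF F(1)] schwartz_L2(1)[OF F(1)]] by (rule order_trans)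
      also have "L2_seminorm (F n) \<le> L2_seminorm (\<lambda>p. F n p - U p) + L2_seminorm U"
        using L2_seminorm_triangle[OF square_integrable_diff[OF schwartz_L2(1)[OF F(1)] U(1)] U(1)] by simp
      finally show ?thesis by (simp add: mult_left_mono L2_seminorm_nonneg)
    qed
    have "(\<lambda>n. L2_seminorm (sub_laplacian (F n)) * (L2_seminorm (\<lambda>p. F n p - U p) + L2_seminorm U)) \<longlonglongrightarrow> 0 * (0 + L2_seminorm U)"
      by (intro tendsto_intros LF F(2))
    then have "(\<lambda>n. L2_seminorm (sub_laplacian (F n)) * (L2_seminorm (\<lambda>p. F n p - U p) + L2_seminorm U)) \<longlonglongrightarrow> 0"
      by simp
    then have "(\<lambda>n. (L2_seminorm (hX (F n)))\<^sup>2) \<longlonglongrightarrow> 0"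
      by (rule tendsto_sandwich[OF always_eventually always_eventually tendsto_const, rotated 2]) (use b in auto)
    then have "(\<lambda>n. sqrt ((L2_seminorm (hX (F n)))\<^sup>2)) \<longlonglongrightarrow> sqrt 0" by (rule tendsto_real_sqrt)
    then show ?thesis by (simp add: L2_seminorm_nonneg)
  qed
  \<comment> \<open>X is moved onto the approximants F n, where it tends to 0; so X U = 0 in the
    weak sense.\<close>
  have orth: "(LINT w|lborel. h w * hX f w) = 0" if f: "f \<in> schwartz_space" for f
  proof -
    note sX = schwartz_L2(1)[OF hderiv_schwartz[OF f, of 1 1 0]]
    have "cmod (L2_pairing (hX f) U) \<le> L2_seminorm (hX f) * L2_seminorm (\<lambda>p. F n p - U p) + L2_seminorm f * L2_seminorm (hX (F n))" for n
    proof -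
      have "L2_pairing (hX f) U = L2_pairing (hX f) (F n) - L2_pairing (hX f) (\<lambda>p. F n p - U p)"
        by (simp add: L2_pairing_diff_right sX U(1) schwartz_L2 F(1))
      also have "L2_pairing (hX f) (F n) = - L2_pairing f (hX (F n))" by (rule hderiv_antisymmetric[OF f F(1)])
      finally have "cmod (L2_pairing (hX f) U) \<le> cmod (L2_pairing f (hX (F n))) + cmod (L2_pairing (hX f) (\<lambda>p. F n p - U p))"
        using norm_triangle_ineq4[of "- L2_pairing f (hX (F n))" "L2_pairing (hX f) (\<lambda>p. F n p - U p)"] by simp
      then show ?thesis
        using L2_pairing_bound[OF schwartz_L2(1)[OF f] schwartz_L2(1)[OF hderiv_schwartz[OF F(1)]], of 1 1 0 n]
          L2_pairing_bound[OF sX square_integrable_diff[OF schwartz_L2(1)[OF F(1)] U(1)], of n] by simp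
    qed
    moreover have "(\<lambda>n. L2_seminorm (hX f) * L2_seminorm (\<lambda>p. F n p - U p) + L2_seminorm f * L2_seminorm (hX (F n)))
        \<longlonglongrightarrow> L2_seminorm (hX f) * 0 + L2_seminorm f * 0"
      by (intro tendsto_intros F(2) XF)
    ultimately have "cmod (L2_pairing (hX f) U) \<le> L2_seminorm (hX f) * 0 + L2_seminorm f * 0"
      by (intro LIMSEQ_le_const) auto
    then show ?thesis by (simp add: L2_pairing_def h_def mult.commute)
  qed
  have zero: "(LINT w|lborel. h w * f w) = 0" if f: "f \<in> schwartz_space" for f
  proof -
    define v where "v s = (LINT w|lborel. h w * f (hflow 1 1 0 s w))" for s
    \<comment> \<open>The derivative of v is the pairing of h with X applied to the transported
      function, because X commutes with its own flow.\<close>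
    have "(v has_vector_derivative 0) (at s within UNIV)" for s
      using hflow_pairing[OF h f, of 1 1 0 s] orth[OF schwartz_hflow[OF f, of 1 1 0 s]]
      by (simp add: v_def[abs_def] hderiv_hflow[OF f])
    then obtain c where c: "\<And>s. v s = c"
      using has_vector_derivative_zero_constant[of UNIV v] by auto
    have v0: "v 0 = (LINT w|lborel. h w * f w)" by (simp add: v_def)
    \<comment> \<open>h is first replaced by a Schwartz function g, which is integrable: then A |g|
      is a majorant under which pointwise escape gives convergence to 0. The error is uniform in
      time since the flow preserves the norm of f.\<close>
    have bound: "cmod c \<le> L2_seminorm f * e" if e: "0 < e" for e
    proof -
      obtain g where g: "g \<in> schwartz_space" "L2_seminorm (\<lambda>p. h p - g p) < e" using schwartz_dense[OF h e] by blast
      note sg = schwartz_L2(1)[OF g(1)]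
      have sf: "square_integrable (\<lambda>w. f (hflow 1 1 0 s w))" for s by (intro schwartz_L2 schwartz_hflow f)
      have nf: "L2_seminorm (\<lambda>w. f (hflow 1 1 0 s w)) = L2_seminorm f" for s
        unfolding hflow_haff using square_integrable_haff(2)[OF schwartz_L2(1)[OF f], of 1 1] by simp
      obtain A where A: "0 \<le> A" "\<And>x. cmod (f x) \<le> A * decay x" using schwartz_decay_bound'[OF f] by blast
      have A': "cmod (f x) \<le> A" for x
        using A(2)[of x] mult_left_mono[OF decay_le_one[of x] A(1)] by simp
      have lim: "(\<lambda>n. LINT w|lborel. g w * f (hflow 1 1 0 (real n) w)) \<longlonglongrightarrow> (LINT w|lborel. g w * 0)"
      proof (rule integral_dominated_convergence)
        obtain B where B: "\<And>x. cmod (g x) \<le> B * decay x" using schwartz_decay_bound'[OF g(1)] by blast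
        have [measurable]: "g \<in> borel_measurable borel" "(\<lambda>w. f (hflow 1 1 0 s w)) \<in> borel_measurable borel" for s
          using g(1) schwartz_hflow[OF f] by (auto intro: schwartz_measurable)
        have ig: "integrable lborel (\<lambda>w. cmod (g w))"
          by (rule Bochner_Integration.integrable_bound[OF integrable_mult_right[OF integrable_decay, of B]])
            (use order_trans[OF B abs_ge_self] in \<open>simp_all add: AE_I2\<close>)
        then show "integrable lborel (\<lambda>w. cmod (g w) * A)" by simp
        show "AE w in lborel. norm (g w * f (hflow 1 1 0 (real n) w)) \<le> cmod (g w) * A" for n
          by (rule AE_I2) (simp add: norm_mult mult_left_mono A')
        show "AE w in lborel. (\<lambda>n. g w * f (hflow 1 1 0 (real n) w)) \<longlonglongrightarrow> g w * 0"
          by (intro AE_I2 tendsto_intros hflow_X_escapes f)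
        show "(\<lambda>w. g w * f (hflow 1 1 0 (real n) w)) \<in> borel_measurable lborel" for n by measurable
        show "(\<lambda>w. g w * 0) \<in> borel_measurable lborel" by simp
      qed
      have "cmod (c - (LINT w|lborel. g w * f (hflow 1 1 0 (real n) w))) \<le> L2_seminorm f * e" for n
      proof -
        have "c - (LINT w|lborel. g w * f (hflow 1 1 0 (real n) w)) = (LINT w|lborel. (h w - g w) * f (hflow 1 1 0 (real n) w))"
          unfolding c[of "real n", symmetric] v_def left_diff_distrib
          by (intro Bochner_Integration.integral_diff[symmetric] integrable_times_L2 h sg sf)
        also have "cmod \<dots> \<le> L2_seminorm (\<lambda>p. h p - g p) * L2_seminorm f"
          using cmod_integral_le_L2[OF square_integrable_diff[OF h sg] sf] by (simp add: nf)
        also have "\<dots> \<le> e * L2_seminorm f" using g(2) by (intro mult_right_mono L2_seminorm_nonneg) simp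
        finally show ?thesis by (simp add: mult.commute)
      qed
      moreover have "(\<lambda>n. cmod (c - (LINT w|lborel. g w * f (hflow 1 1 0 (real n) w)))) \<longlonglongrightarrow> cmod (c - 0)"
        using lim by (intro tendsto_intros) simp
      ultimately show ?thesis by (intro LIMSEQ_le_const2[of _ "cmod c"]) auto
    qed
    have "c = 0"
    proof (rule ccontr)
      assume "c \<noteq> 0"
      then have "0 < cmod c / (2 * (L2_seminorm f + 1))" by (simp add: L2_seminorm_nonneg add_nonneg_pos)
      from bound[OF this] have "cmod c \<le> cmod c * (L2_seminorm f / (2 * (L2_seminorm f + 1)))" by (simp add: mult.commute)
      moreover have "L2_seminorm f / (2 * (L2_seminorm f + 1)) \<le> 1 / 2"
        using L2_seminorm_nonneg[of f] by (simp add: field_simps)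
      ultimately have "cmod c \<le> cmod c * (1 / 2)" by (meson mult_left_mono norm_ge_zero order_trans)
      then show False using \<open>c \<noteq> 0\<close> by simp
    qed
    then show ?thesis using c[of 0] v0 by simp
  qed
  show ?thesis
  proof (rule schwartz_total)
    fix f :: "heisenberg \<Rightarrow> complex" assume f: "f \<in> schwartz_space"
    have "L2_pairing f U = 0" using zero[OF f] by (simp add: L2_pairing_def h_def mult.commute)
    then show "L2_inner u (L2_class f) = 0"
      using L2_pairing_commute[of U f] by (simp add: U(2) L2_inner_class U(1) schwartz_L2 f)
  qed
qed


section \<open>Approximate eigenfunctions\<close>

text \<open>Transfers membership in the Schwartz space from \<open>gauss\<close>. The frequency
  \<eta> / \<delta> compensates for the scaling of t by \<delta>.\<close>

lemma wave_eq_gauss: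
  assumes "0 < \<eta>" "0 < \<delta>"
  shows "wave \<eta> (\<delta>\<^sup>2) \<eta> = (\<lambda>p. gauss (0, 0, \<eta> / \<delta>) (haff (sqrt \<eta>) \<delta> 0 0 0 p))"
proof
  fix p :: heisenberg
  obtain x y t where p: "p = (x, y, t)" by (cases p)
  have "sqrt \<eta> * z * (sqrt \<eta> * z) = \<eta> * z\<^sup>2" for z
    using assms by (simp add: power2_eq_square mult_ac flip: mult.assoc[of "sqrt \<eta>" "sqrt \<eta>"])
  then have "haff (sqrt \<eta>) \<delta> 0 0 0 p \<bullet> haff (sqrt \<eta>) \<delta> 0 0 0 p = \<eta> * (x\<^sup>2 + y\<^sup>2) + \<delta>\<^sup>2 * t\<^sup>2"
    by (simp only: p haff_def zero_prod_def inner_prod_def inner_real_def fst_conv snd_conv add_Pair prod.case)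
      (simp add: algebra_simps power2_eq_square abs_of_pos[OF assms(1)])
  moreover have "haff (sqrt \<eta>) \<delta> 0 0 0 p \<bullet> (0, 0, \<eta> / \<delta>) = \<eta> * t"
    using assms by (simp add: p haff_def inner_prod_def)
  ultimately show "wave \<eta> (\<delta>\<^sup>2) \<eta> p = gauss (0, 0, \<eta> / \<delta>) (haff (sqrt \<eta>) \<delta> 0 0 0 p)"
    unfolding gauss_def by (simp add: p wave_def)
qed

lemma wave_schwartz: "0 < \<eta> \<Longrightarrow> 0 < \<delta> \<Longrightarrow> wave \<eta> (\<delta>\<^sup>2) \<eta> \<in> schwartz_space"
  unfolding wave_eq_gauss by (intro schwartz_haff gauss_schwartz) auto

text \<open>The main term is the lowest Landau level; the remainder comes from derivatives of the
  cut-off in t, which enter X and Y with coefficients linear in z, hence the common factor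
  |z|^2.\<close>

lemma sub_laplacian_wave:
  assumes "0 < \<eta>" "0 < \<delta>"
  defines "w \<equiv> wave \<eta> (\<delta>\<^sup>2) \<eta>"
  shows "sub_laplacian w (x, y, t) = of_real (4 * \<eta>) * w (x, y, t)
    + of_real (x\<^sup>2 + y\<^sup>2) * (of_real (8 * \<delta>\<^sup>2 - 16 * \<delta> ^ 4 * t\<^sup>2) + \<i> * of_real (16 * \<eta> * \<delta>\<^sup>2 * t)) * w (x, y, t)"
proof -
  have i2: "\<i> * (\<i> * z) = - z" for z by (simp flip: mult.assoc)
  show ?thesis
    unfolding w_def sub_laplacian_eq[OF wave_schwartz[OF assms(1,2)]] hderiv2_wave
    by (simp add: power2_eq_square power4_eq_xxxx algebra_simps i2)
qed

lemma L2_seminorm_mono: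
  assumes "square_integrable f" "square_integrable g" "\<And>p. cmod (f p) \<le> cmod (g p)"
  shows "L2_seminorm f \<le> L2_seminorm g"
  unfolding L2_seminorm_def
  using assms by (intro real_sqrt_le_mono integral_mono power_mono) (auto simp: square_integrable_def)

lemma weyl_sequence:
  assumes l: "0 \<le> l" and e: "0 < e"
  shows "\<exists>u v. (u, v) \<in> sub_laplacian.T \<and> u \<noteq> 0 \<and> norm (v - complex_of_real l *\<^sub>C u) \<le> e * norm u"
proof -
  \<comment> \<open>Then 4 \<eta> = l + e/2, positive even for l = 0. Half of the tolerance pays for
    this shift and the other half for the cut-off error.\<close>
  define \<eta> where "\<eta> = l / 4 + e / 8"
  have \<eta>: "0 < \<eta>" using l e by (simp add: \<eta>_def)
  \<comment> \<open>The profile independent of \<delta>: the modulus of the wave is \<psi> with t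
    scaled by \<delta>.\<close>
  define \<psi> where "\<psi> = (\<lambda>p::heisenberg. gauss 0 (haff (sqrt \<eta>) 1 0 0 0 p))"
  have \<psi>s: "\<psi> \<in> schwartz_space" unfolding \<psi>_def using \<eta> by (intro schwartz_haff gauss_schwartz) auto
  define m where "m c f = (\<lambda>p::heisenberg. complex_of_real (p \<bullet> c) * f p)" for c and f :: "heisenberg \<Rightarrow> complex"
  have ms: "m c f \<in> schwartz_space" if "f \<in> schwartz_space" for c f
    unfolding m_def using schwartz_affine_mult[OF that, of c 0] by simp
  define B0 where "B0 = (\<lambda>p. \<psi> p + m (0, 0, 1) (m (0, 0, 1) \<psi>) p)"
  \<comment> \<open>The profile |z|^2 (1 + t^2) \<psi>, again independent of \<delta>, which
    dominates the error after rescaling t.\<close>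
  define B where "B = (\<lambda>p. m (1, 0, 0) (m (1, 0, 0) B0) p + m (0, 1, 0) (m (0, 1, 0) B0) p)"
  have B0s: "B0 \<in> schwartz_space" unfolding B0_def by (intro schwartz_add ms \<psi>s)
  have Bs: "B \<in> schwartz_space" unfolding B_def by (intro schwartz_add ms B0s)
  have Be: "B (x, y, t) = complex_of_real ((x\<^sup>2 + y\<^sup>2) * (1 + t\<^sup>2)) * \<psi> (x, y, t)" for x y t
    by (simp add: B_def B0_def m_def inner_prod_def algebra_simps power2_eq_square)
  have \<psi>n: "0 < L2_seminorm \<psi>"
  proof -
    have "\<not> (AE p in lborel. \<psi> p = 0)"
    proof
      assume "AE p in lborel. \<psi> p = 0"
      then have "AE p::heisenberg in lborel. False" by eventually_elim (simp add: \<psi>_def gauss_def)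
      then show False by (simp add: eventually_False ae_filter_eq_bot_iff emeasure_lborel_UNIV)
    qed
    then show ?thesis using L2_seminorm_zero_iff[OF schwartz_L2(1)[OF \<psi>s]] L2_seminorm_nonneg[of \<psi>] by simp
  qed
  \<comment> \<open>16 covers \<delta> |8 - 16 s^2| for \<delta> \<le> 1, and 16 \<eta> covers the
    phase term through |s| \<le> 1 + s^2.\<close>
  define K where "K = 16 * \<eta> + 16"
  have K: "0 < K" using \<eta> by (simp add: K_def)
  \<comment> \<open>Small enough that \<delta> K |B| is at most half the tolerance times |\<psi>|;
    the added 1 keeps the denominator positive.\<close>
  define \<delta> where "\<delta> = min 1 (e / 2 * L2_seminorm \<psi> / (K * L2_seminorm B + 1))"
  have KB: "0 < K * L2_seminorm B + 1" using K L2_seminorm_nonneg[of B] by (simp add: add_nonneg_pos)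
  have \<delta>: "0 < \<delta>" "\<delta> \<le> 1" using e \<psi>n KB by (auto simp: \<delta>_def)
  have \<delta>e: "\<delta> * (K * L2_seminorm B) \<le> e / 2 * L2_seminorm \<psi>"
  proof -
    have "\<delta> * (K * L2_seminorm B) \<le> \<delta> * (K * L2_seminorm B + 1)" using \<delta> by simp
    also have "\<dots> \<le> (e / 2 * L2_seminorm \<psi> / (K * L2_seminorm B + 1)) * (K * L2_seminorm B + 1)"
      using KB by (intro mult_right_mono) (auto simp: \<delta>_def)
    also have "\<dots> = e / 2 * L2_seminorm \<psi>" using KB by (metis less_numeral_extra(3) nonzero_eq_divide_eq)
    finally show ?thesis .
  qed
  define f where "f = wave \<eta> (\<delta>\<^sup>2) \<eta>"
  have fs: "f \<in> schwartz_space" unfolding f_def by (rule wave_schwartz[OF \<eta> \<delta>(1)])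
  \<comment> \<open>The norms of the wave and of the error bound carry the same Jacobian factor 1 /
    \<kappa>, so it cancels from the comparison.\<close>
  define \<kappa> where "\<kappa> = sqrt (1\<^sup>2 * \<bar>\<delta>\<bar>)"
  have \<kappa>: "0 < \<kappa>" using \<delta> by (simp add: \<kappa>_def)
  have dil: "L2_seminorm (\<lambda>p. W (haff 1 \<delta> 0 0 0 p)) = L2_seminorm W / \<kappa>" if "square_integrable W" for W
    using square_integrable_haff(2)[OF that, of 1 \<delta> 0 0 0] \<delta> \<kappa> by (simp add: \<kappa>_def)
  have h: "haff 1 \<delta> 0 0 0 (x, y, t) = (x, y, \<delta> * t)" for x y t by (simp add: haff_def zero_prod_def)
  have cf: "cmod (f (x, y, t)) = cmod (\<psi> (haff 1 \<delta> 0 0 0 (x, y, t)))" for x y t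
  proof -
    have a: "haff (sqrt \<eta>) \<delta> 0 0 0 (x, y, t) = haff (sqrt \<eta>) 1 0 0 0 (haff 1 \<delta> 0 0 0 (x, y, t))"
      by (simp add: haff_def zero_prod_def)
    show ?thesis unfolding f_def wave_eq_gauss[OF \<eta> \<delta>(1)] \<psi>_def cmod_gauss a ..
  qed
  have "cmod (f p) = cmod (\<psi> (haff 1 \<delta> 0 0 0 p))" for p by (cases p) (simp only: cf)
  then have "L2_seminorm f = L2_seminorm (\<lambda>p. \<psi> (haff 1 \<delta> 0 0 0 p))"
    by (simp add: L2_seminorm_def)
  then have nf: "L2_seminorm f = L2_seminorm \<psi> / \<kappa>"
    by (simp only: dil[OF schwartz_L2(1)[OF \<psi>s]])
  define E where "E p = sub_laplacian f p - complex_of_real (4 * \<eta>) * f p" for p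
  have Es: "square_integrable E" unfolding E_def by (intro square_integrable_diff square_integrable_scale schwartz_L2 fs)
  have "L2_seminorm E \<le> L2_seminorm (\<lambda>p. complex_of_real (\<delta> * K) * B (haff 1 \<delta> 0 0 0 p))"
  proof (rule L2_seminorm_mono[OF Es])
    show "square_integrable (\<lambda>p. complex_of_real (\<delta> * K) * B (haff 1 \<delta> 0 0 0 p))"
      using \<delta> by (intro square_integrable_scale square_integrable_haff schwartz_L2 Bs) auto
    fix p :: heisenberg
    obtain x y t where p: "p = (x, y, t)" by (cases p)
    \<comment> \<open>In this variable the phase term 16 \<eta> \<delta>^2 t becomes 16 \<eta>
      \<delta> s, so the relative error is of first order in \<delta>.\<close>
    define s where "s = \<delta> * t"
    have "cmod (complex_of_real (8 * \<delta>\<^sup>2 - 16 * \<delta> ^ 4 * t\<^sup>2) + \<i> * complex_of_real (16 * \<eta> * \<delta>\<^sup>2 * t))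
        \<le> \<bar>8 * \<delta>\<^sup>2 - 16 * \<delta> ^ 4 * t\<^sup>2\<bar> + \<bar>16 * \<eta> * \<delta>\<^sup>2 * t\<bar>"
      by (rule order_trans[OF norm_triangle_ineq]) (simp only: norm_mult norm_of_real norm_ii)
    also have "\<dots> = \<delta> * (\<delta> * \<bar>8 - 16 * s\<^sup>2\<bar> + 16 * \<eta> * \<bar>s\<bar>)"
    proof -
      have "8 * \<delta>\<^sup>2 - 16 * \<delta> ^ 4 * t\<^sup>2 = (\<delta> * \<delta>) * (8 - 16 * s\<^sup>2)" "16 * \<eta> * \<delta>\<^sup>2 * t = (\<delta> * 16 * \<eta>) * s"
        by (simp_all add: s_def power2_eq_square power4_eq_xxxx algebra_simps)
      then show ?thesis using \<delta> \<eta> by (simp only: abs_mult) (simp add: algebra_simps)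
    qed
    also have "\<dots> \<le> \<delta> * (K * (1 + s\<^sup>2))"
    proof (rule mult_left_mono)
      have "\<bar>8 - 16 * s\<^sup>2\<bar> \<le> 16 * (1 + s\<^sup>2)"
        by (rule abs_leI) (use zero_le_power2[of s] in argo)+
      then have "\<delta> * \<bar>8 - 16 * s\<^sup>2\<bar> \<le> 1 * (16 * (1 + s\<^sup>2))"
        using \<delta> by (intro mult_mono) auto
      moreover have "0 \<le> (\<bar>s\<bar> - 1)\<^sup>2" by simp
      then have "\<bar>s\<bar> \<le> 1 + s\<^sup>2" by (simp add: power2_diff)
      then have "16 * \<eta> * \<bar>s\<bar> \<le> 16 * \<eta> * (1 + s\<^sup>2)" using \<eta> by (intro mult_left_mono) auto
      ultimately show "\<delta> * \<bar>8 - 16 * s\<^sup>2\<bar> + 16 * \<eta> * \<bar>s\<bar> \<le> K * (1 + s\<^sup>2)" by (simp add: K_def algebra_simps)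
    qed (use \<delta> in simp)
    finally have q: "cmod (complex_of_real (8 * \<delta>\<^sup>2 - 16 * \<delta> ^ 4 * t\<^sup>2) + \<i> * complex_of_real (16 * \<eta> * \<delta>\<^sup>2 * t)) \<le> \<delta> * (K * (1 + s\<^sup>2))" .
    have "cmod (E p) = (x\<^sup>2 + y\<^sup>2) * cmod (complex_of_real (8 * \<delta>\<^sup>2 - 16 * \<delta> ^ 4 * t\<^sup>2) + \<i> * complex_of_real (16 * \<eta> * \<delta>\<^sup>2 * t)) * cmod (f p)"
    proof -
      have "E p = complex_of_real (x\<^sup>2 + y\<^sup>2) * (complex_of_real (8 * \<delta>\<^sup>2 - 16 * \<delta> ^ 4 * t\<^sup>2) + \<i> * complex_of_real (16 * \<eta> * \<delta>\<^sup>2 * t)) * f p"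
        unfolding E_def f_def p sub_laplacian_wave[OF \<eta> \<delta>(1)] by simp
      then show ?thesis by (simp only: norm_mult norm_of_real) simp
    qed
    also have "\<dots> \<le> (x\<^sup>2 + y\<^sup>2) * (\<delta> * (K * (1 + s\<^sup>2))) * cmod (f p)"
      by (intro mult_right_mono mult_left_mono q) auto
    also have "\<dots> = cmod (complex_of_real (\<delta> * K) * B (haff 1 \<delta> 0 0 0 p))"
    proof -
      have "cmod (f p) = cmod (\<psi> (x, y, s))" using cf[of x y t] by (simp add: p h s_def)
      moreover have "B (haff 1 \<delta> 0 0 0 p) = complex_of_real ((x\<^sup>2 + y\<^sup>2) * (1 + s\<^sup>2)) * \<psi> (x, y, s)"
        by (simp only: p h Be s_def)
      moreover have "0 \<le> \<delta> * K" "0 \<le> (x\<^sup>2 + y\<^sup>2) * (1 + s\<^sup>2)" using \<delta> K by auto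
      ultimately show ?thesis by (simp only: norm_mult norm_of_real abs_of_nonneg) (simp add: mult_ac)
    qed
    finally show "cmod (E p) \<le> cmod (complex_of_real (\<delta> * K) * B (haff 1 \<delta> 0 0 0 p))" .
  qed
  also have "\<dots> = \<delta> * (K * L2_seminorm B) / \<kappa>"
    using \<delta> K by (simp only: L2_seminorm_scale dil[OF schwartz_L2(1)[OF Bs]]) (simp add: norm_mult)
  also have "\<dots> \<le> e / 2 * L2_seminorm \<psi> / \<kappa>" using \<delta>e \<kappa> by (intro divide_right_mono) auto
  finally have En: "L2_seminorm E \<le> e / 2 * L2_seminorm f" by (simp add: nf)
  have eq: "(\<lambda>p. sub_laplacian f p - complex_of_real l * f p) = (\<lambda>p. E p + complex_of_real (e / 2) * f p)"
    by (rule ext) (simp add: E_def \<eta>_def algebra_simps)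
  have "L2_seminorm (\<lambda>p. sub_laplacian f p - complex_of_real l * f p) \<le> L2_seminorm E + L2_seminorm (\<lambda>p. complex_of_real (e / 2) * f p)"
    unfolding eq by (intro L2_seminorm_triangle Es square_integrable_scale schwartz_L2 fs)
  also have "L2_seminorm (\<lambda>p. complex_of_real (e / 2) * f p) = e / 2 * L2_seminorm f"
    unfolding L2_seminorm_scale using e by simp
  finally have fin: "L2_seminorm (\<lambda>p. sub_laplacian f p - complex_of_real l * f p) \<le> e * L2_seminorm f"
    using En by simp
  show ?thesis
  proof (intro exI conjI)
    show "(L2_class f, L2_class (sub_laplacian f)) \<in> sub_laplacian.T"
      using sub_laplacian_opI[OF fs] sub_laplacian.T0_subset by blast
    have "norm (L2_class f) \<noteq> 0" using \<psi>n \<kappa> by (simp add: norm_L2_class schwartz_L2 fs nf)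
    then show "L2_class f \<noteq> 0" by auto
    show "norm (L2_class (sub_laplacian f) - complex_of_real l *\<^sub>C L2_class f) \<le> e * norm (L2_class f)"
      using fin by (simp add: L2_class_scaleC norm_diff_L2_class norm_L2_class schwartz_L2 fs square_integrable_scale)
  qed
qed

theorem theorem2p0p2:
  shows "op_spectrum sub_laplacian_closure = op_continuous_spectrum sub_laplacian_closure \<and>
         op_continuous_spectrum sub_laplacian_closure = complex_of_real ` {0..}"
proof -
  have noeig: "u = 0" if "0 \<le> l" "(u, complex_of_real l *\<^sub>C u) \<in> sub_laplacian.T" for l u
  proof (cases "l = 0")
    case True
    have "complex_of_real 0 *\<^sub>C u = 0" using norm_scaleC[of 0 u] by simp
    then show ?thesis using no_zero_eigenvalue that True by simp
  next
    case False
    then show ?thesis using no_positive_eigenvalue[of l u] that by simp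
  qed
  show ?thesis
    unfolding sub_laplacian_closure_eq
    using sub_laplacian.spectrum_nonneg_axis[OF noeig weyl_sequence] by simp
qed

end
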